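(* Let $n\ge 1$, $1\le p<\infty$, and let $w$ be a weight on $\mathbb{R}^{n+1}$. The following conditions are equivalent. (i) $w\in RH^+_q$ for some $1<q<\infty$. (ii) There exist constants $C,\delta>0$ such that $$\frac{w(E)}{w(R^+)}\le C\biggl(\frac{|E|}{|R^-|}\biggr)^{\delta}$$ for every parabolic rectangle $R\subset\mathbb{R}^{n+1}$ and every measurable set $E\subset R^-$. (iii) For every $\beta>0$ there exists $0<\alpha<1$ such that for every parabolic rectangle $R\subset\mathbb{R}^{n+1}$ and every measurable set $E\subset R^-$ for which $|E|<\alpha|R^-|$ we have $w(E)<\beta w(R^+)$. (iv) There exist $0<\alpha<1$ and $0<\beta<1/2^{n+p}$ such that for every parabolic rectangle $R\subset\mathbb{R}^{n+1}$ and every measurable set $E\subset R^-$ for which $|E|<\alpha|R^-|$ we have $w(E)<\beta w(R^+)$. (v) There exist $0<\alpha<1$ and $0<\beta<1/2^{n+p}$ such that for every parabolic rectangle $R\subset\mathbb{R}^{n+1}$ we have $$w\bigl(R^-\cap\{\alpha w>w_{R^+}\}\bigr)<\beta w(R^+).$$ (vi) There exists a constant $C$ such that $$\int_{R^-}M^+(w\chi_{R^-})\,dx\,dt\le C\int_{R^+}w\,dx\,dt$$ for every parabolic rectangle $R\subset\mathbb{R}^{n+1}$. (vii) There exists a constant $C$ such that $$\int_{R^-}w\log^+\biggl(\frac{w}{w_{R^+}}\biggr)\,dx\,dt\le C\,w(R^+)$$ for every parabolic rectangle $R\subset\mathbb{R}^{n+1}$.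
   Context: Points of $\mathbb{R}^{n+1}$ are written $(x,t)$ with $x\in\mathbb{R}^n$, $t\in\mathbb{R}$. The exponent $p$ is fixed. For $x\in\mathbb{R}^n$, $t\in\mathbb{R}$, $L>0$ let $Q(x,L)=\{y\in\mathbb{R}^n:|y_i-x_i|\le L/2,\ i=1,\dots,n\}$. A parabolic rectangle is a set $R=R(x,t,L)=Q(x,L)\times(t-L^p,t+L^p)$; its upper and lower parts are $R^+=Q(x,L)\times(t,t+L^p)$ and $R^-=Q(x,L)\times(t-L^p,t)$. A weight is a locally integrable nonnegative function $w$ on $\mathbb{R}^{n+1}$. $|A|$ denotes Lebesgue measure, $w(A)=\int_A w\,dx\,dt$, and $w_A=\frac1{|A|}\int_A w\,dx\,dt$. Also $\log^+ s=\max\{\log s,0\}$ (with $\log^+0=0$), and $\chi_A$ is the characteristic function of $A$. For $1<q<\infty$, $w\in RH^+_q$ means there is a constant $C$ with $$\Bigl(\frac1{|R^-|}\int_{R^-}w^q\,dx\,dt\Bigr)^{1/q}\le C\,\frac1{|R^+|}\int_{R^+}w\,dx\,dt$$ for every parabolic rectangle $R\subset\mathbb{R}^{n+1}$. The uncentered forward in time parabolic maximal function of a locally integrable function $f$ is $$M^+f(x,t)=\sup_{R}\frac1{|R^+|}\int_{R^+}|f|\,dy\,ds,$$ the supremum being over all parabolic rectangles $R$ with $(x,t)\in R^-$.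
   Formalization: In (iii)–(v), "w(E)<βw(R⁺)" (in (v), E is the displayed set) is also counted as true when w(E)=w(R⁺)=0, and in (ii), (vii) 0/0=0 and a/0=∞ for a>0; read literally the equivalence fails for w=0 and for w=χ_{t>0}. *)

theory Defs
  imports "HOL-Analysis.Analysis"
begin

text \<open>
  A point (x,t) of the space-time \<open>\<real>\<^sup>n \<times> \<real>\<close> has type \<open>(real ^ 'n) \<times> real\<close>, where
  \<open>n = CARD('n)\<close>.  A parabolic rectangle is given by its parameters x, t, L with \<open>L > 0\<close>.
  ``Measurable'' means Lebesgue measurable.
\<close>

definition cube :: "real ^ 'n \<Rightarrow> real \<Rightarrow> (real ^ 'n) set" where
  "cube x L = {y. \<forall>i. \<bar>y $ i - x $ i\<bar> \<le> L / 2}"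

definition rect_upper :: "real \<Rightarrow> real ^ 'n \<Rightarrow> real \<Rightarrow> real \<Rightarrow> ((real ^ 'n) \<times> real) set" where
  "rect_upper p x t L = cube x L \<times> {t <..< t + L powr p}"

definition rect_lower :: "real \<Rightarrow> real ^ 'n \<Rightarrow> real \<Rightarrow> real \<Rightarrow> ((real ^ 'n) \<times> real) set" where
  "rect_lower p x t L = cube x L \<times> {t - L powr p <..< t}"

definition locally_integrable :: "('a::euclidean_space \<Rightarrow> real) \<Rightarrow> bool" where
  "locally_integrable f \<longleftrightarrow> (\<forall>K. compact K \<longrightarrow> set_integrable lebesgue K f)"

definition weight :: "((real ^ 'n) \<times> real \<Rightarrow> real) \<Rightarrow> bool" where
  "weight w \<longleftrightarrow> locally_integrable w \<and> (\<forall>z. 0 \<le> w z)"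

text \<open>
  Integrals and averages take values in \<open>[0,\<infinity>]\<close>, so that an infinite left-hand side
  makes an inequality fail rather than silently count as 0.  Division in \<^typ>\<open>ennreal\<close> satisfies
  \<open>0 / 0 = 0\<close> and \<open>a / 0 = \<infinity>\<close> for \<open>a > 0\<close>; this is the reading of quotients with denominator
  \<open>w(R\<^sup>+)\<close> for rectangles with \<open>w(R\<^sup>+) = 0\<close>.  Consistently with this, an inequality
  \<open>w(E) < \<beta> w(R\<^sup>+)\<close> is read as \<open>w(E) / w(R\<^sup>+) < \<beta>\<close>, that is, it is also considered to hold when
  \<open>w(E) = w(R\<^sup>+) = 0\<close>.  Otherwise it would fail already for \<open>w = 0\<close>, which is a reverse
  Hoelder weight.
\<close>

definition mass :: "('a::euclidean_space \<Rightarrow> real) \<Rightarrow> 'a set \<Rightarrow> ennreal" where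
  "mass w A = (\<integral>\<^sup>+z\<in>A. ennreal (w z) \<partial>lebesgue)"

definition average :: "('a::euclidean_space \<Rightarrow> real) \<Rightarrow> 'a set \<Rightarrow> ennreal" where
  "average w A = mass w A / emeasure lebesgue A"

text \<open>The power and \<open>log\<^sup>+\<close> on \<open>[0,\<infinity>]\<close>; the power is only used for exponents \<open>a > 0\<close>.  The value
  \<open>log\<^sup>+ 0 = 0\<close> relies on \<open>ln 0 = 0\<close>.\<close>

definition ennreal_powr :: "ennreal \<Rightarrow> real \<Rightarrow> ennreal" where
  "ennreal_powr s a = (if s = \<infinity> then \<infinity> else ennreal (enn2real s powr a))"

definition log_plus :: "ennreal \<Rightarrow> ennreal" where
  "log_plus s = (if s = \<infinity> then \<infinity> else ennreal (max (ln (enn2real s)) 0))"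

definition RH_plus :: "real \<Rightarrow> real \<Rightarrow> ((real ^ 'n) \<times> real \<Rightarrow> real) \<Rightarrow> bool" where
  "RH_plus p q w \<longleftrightarrow> (\<exists>C\<ge>0. \<forall>x t L. L > 0 \<longrightarrow>
     ennreal_powr (average (\<lambda>z. w z powr q) (rect_lower p x t L)) (1 / q)
       \<le> ennreal C * average w (rect_upper p x t L))"

definition max_plus :: "real \<Rightarrow> ((real ^ 'n) \<times> real \<Rightarrow> real) \<Rightarrow> (real ^ 'n) \<times> real \<Rightarrow> ennreal" where
  "max_plus p f z =
     (SUP (x, t, L) \<in> {(x, t, L). L > 0 \<and> z \<in> rect_lower p x t L}.
        average (\<lambda>y. \<bar>f y\<bar>) (rect_upper p x t L))"

end

theory Submission
  imports Defs
begin

text \<open>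
  The implications are (i) \<open>\<Longrightarrow>\<close> (ii) \<open>\<Longrightarrow>\<close> (iii) \<open>\<Longrightarrow>\<close> (iv) \<open>\<Longrightarrow>\<close> (v) \<open>\<Longrightarrow>\<close> (i) and
  (i) \<open>\<Longrightarrow>\<close> (vii) \<open>\<Longrightarrow>\<close> (vi) \<open>\<Longrightarrow>\<close> (v). The core is (v) \<open>\<Longrightarrow>\<close> (i). Stop on a parabolic dyadic grid at the
  cells whose upper rectangle has average above \<open>\<lambda>\<close>. The upper rectangles of different stopping cells overlap
  without control, so the stopping family is enlarged upwards in time until neighbouring sizes are
  comparable; then at most four of the upper rectangles overlap. Summing (v) over these cells gives
  \<open>w(D \<inter> {w > \<Lambda> \<lambda>}) \<le> 4 \<beta> (1 + 40 \<theta>) w(D' \<inter> {w > \<theta> \<lambda>})\<close>, where \<open>D'\<close> reaches slightly later in time than \<open>D\<close>.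
  Since \<open>\<beta> < 1 / 2\<^sup>n\<^sup>+\<^sup>p \<le> 1 / 4\<close>, the factor is below 1 for small \<open>\<theta>\<close>. The gap in time shrinks geometrically as
  \<open>\<lambda>\<close> grows, so iteration gives power decay of the distribution function of \<open>w\<close>. For (vi) \<open>\<Longrightarrow>\<close> (v),
  a reverse weak type inequality is summed over the levels \<open>2\<^sup>k \<lambda>\<close>, which gains a logarithm.
\<close>

section \<open>Parabolic rectangles\<close>

definition time_shift :: "real \<Rightarrow> ('a \<times> real) set \<Rightarrow> ('a \<times> real) set" where
  "time_shift s V = (\<lambda>z. (fst z, snd z + s)) ` V"

lemma mem_time_shift: "z \<in> time_shift s V \<longleftrightarrow> (fst z, snd z - s) \<in> V"
proof
  assume "(fst z, snd z - s) \<in> V"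
  then show "z \<in> time_shift s V"
    unfolding time_shift_def by (intro image_eqI[of _ _ "(fst z, snd z - s)"]) auto
qed (auto simp: time_shift_def)

lemma time_shift_eq_translation:
  "time_shift s V = (+) (0, s) ` (V :: ('a::euclidean_space \<times> real) set)"
  unfolding time_shift_def by (intro image_cong) (auto simp: prod_eq_iff)

lemma sets_time_shift [measurable, simp]:
  fixes V :: "('a::euclidean_space \<times> real) set"
  shows "V \<in> sets lebesgue \<Longrightarrow> time_shift s V \<in> sets lebesgue"
  unfolding time_shift_eq_translation by (rule lebesgue_sets_translation)

lemma emeasure_time_shift [simp]:
  fixes V :: "('a::euclidean_space \<times> real) set"
  shows "emeasure lebesgue (time_shift s V) = emeasure lebesgue V"
  using emeasure_lebesgue_affine[of 1 "(0, s)" V]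
  by (simp add: time_shift_eq_translation add.commute image_def)

lemma cube_eq_cbox: "cube x L = cbox (\<chi> i. x $ i - L / 2) (\<chi> i. x $ i + L / 2)"
  unfolding cube_def by (auto simp: mem_box_cart abs_le_iff field_simps) (smt (verit) field_sum_of_halves)+

lemma cube_mono:
  assumes "\<And>i. \<bar>x $ i - y $ i\<bar> \<le> (M - L) / 2"
  shows "cube x L \<subseteq> cube y M"
  unfolding cube_def
proof safe
  fix z :: "real ^ 'a" and i assume "\<forall>i. \<bar>z $ i - x $ i\<bar> \<le> L / 2"
  then have "\<bar>z $ i - x $ i\<bar> \<le> L / 2" by auto
  with assms[of i] show "\<bar>z $ i - y $ i\<bar> \<le> M / 2" unfolding diff_divide_distrib by linarith
qed

lemma sets_cube [measurable, simp]: "cube x L \<in> sets borel"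
  by (simp add: cube_eq_cbox)

lemma emeasure_cube: "0 \<le> L \<Longrightarrow> emeasure lborel (cube (x :: real ^ 'n) L) = ennreal (L ^ CARD('n))"
proof -
  assume L: "0 \<le> L"
  have "measure lborel (cbox (\<chi> i. x $ i - L / 2) (\<chi> i. x $ i + L / 2)) = L ^ CARD('n)"
    using L by (subst content_cbox_cart) (auto simp: mem_box_cart interval_ne_empty_cart)
  moreover have "emeasure lborel (cube x L) = ennreal (measure lborel (cube x L))"
    unfolding cube_eq_cbox using emeasure_lborel_cbox_finite
    by (metis emeasure_eq_ennreal_measure infinity_ennreal_def less_irrefl)
  ultimately show ?thesis
    by (simp add: cube_eq_cbox)
qed

lemma sets_Times_borel [measurable]:
  "A \<in> sets borel \<Longrightarrow> B \<in> sets borel \<Longrightarrow> A \<times> (B :: real set) \<in> sets (lebesgue :: ((real ^ 'n) \<times> real) measure)"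
proof -
  assume "A \<in> sets borel" "B \<in> sets borel"
  then have "A \<times> B \<in> sets (borel \<Otimes>\<^sub>M borel)" by (intro pair_measureI)
  then have "A \<times> B \<in> sets borel" unfolding borel_prod .
  then show ?thesis by (metis sets_completionI_sets sets_lborel)
qed

lemma emeasure_cube_Times:
  fixes x :: "real ^ 'n"
  assumes "0 \<le> L" "I \<in> sets borel"
  shows "emeasure lebesgue (cube x L \<times> I) = ennreal (L ^ CARD('n)) * emeasure lborel I"
proof -
  have "cube x L \<times> I \<in> sets (borel \<Otimes>\<^sub>M borel)" using assms by (intro pair_measureI) auto
  then have "cube x L \<times> I \<in> sets borel" unfolding borel_prod .
  then have "emeasure lebesgue (cube x L \<times> I) = emeasure lborel (cube x L \<times> I)" by simp
  also have "\<dots> = emeasure (lborel \<Otimes>\<^sub>M lborel) (cube x L \<times> I)" by (simp add: lborel_prod)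
  also have "\<dots> = emeasure lborel (cube x L) * emeasure lborel I"
    using assms by (intro lborel.emeasure_pair_measure_Times) auto
  finally show ?thesis using assms by (simp add: emeasure_cube)
qed

lemma sets_rect [measurable, simp]:
  "rect_upper p (x :: real ^ 'n) t L \<in> sets lebesgue"
  "rect_lower p (x :: real ^ 'n) t L \<in> sets lebesgue"
  unfolding rect_upper_def rect_lower_def by (auto intro!: sets_Times_borel)

definition rect_volume :: "nat \<Rightarrow> real \<Rightarrow> real \<Rightarrow> real" where
  "rect_volume n p L = L ^ n * L powr p"

lemma rect_volume_pos: "0 < L \<Longrightarrow> 0 < rect_volume n p L"
  by (simp add: rect_volume_def)

lemma rect_volume_half_power:
  assumes "0 < L"
  shows "rect_volume CARD('n) p L
    = 2 powr ((real CARD('n::finite) + p) * real k) * rect_volume CARD('n) p (L / 2 ^ k)"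
proof -
  have "2 powr ((real CARD('n) + p) * real k) = (2 ^ k) ^ CARD('n) * (2 ^ k) powr p"
    by (simp add: algebra_simps powr_add powr_powr flip: powr_realpow)
  then show ?thesis using assms
    by (simp add: rect_volume_def powr_divide power_divide)
qed

lemma emeasure_rect:
  assumes "0 < L"
  shows "emeasure lebesgue (rect_upper p (x :: real ^ 'n) t L) = ennreal (rect_volume CARD('n) p L)"
    "emeasure lebesgue (rect_lower p (x :: real ^ 'n) t L) = ennreal (rect_volume CARD('n) p L)"
  using assms unfolding rect_upper_def rect_lower_def rect_volume_def
  by (subst emeasure_cube_Times; simp flip: ennreal_mult)+

lemma measure_rect_lower:
  assumes "0 < L"
  shows "measure lebesgue (rect_lower p (x :: real ^ 'n) t L) = rect_volume CARD('n) p L"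
  using emeasure_rect(2)[OF assms, of p x t] rect_volume_pos[OF assms] by (metis enn2real_ennreal less_eq_real_def measure_def)

lemma null_sets_time_slice: "{z. snd z = c} \<in> null_sets (lebesgue :: ((real ^ 'n) \<times> real) measure)"
proof -
  have "(0 :: real ^ 'n, 1 :: real) \<in> Basis" by (simp add: Basis_prod_def)
  from negligible_standard_hyperplane[OF this, of c]
  have "negligible {z :: (real ^ 'n) \<times> real. snd z = c}" by (simp add: inner_prod_def)
  then show ?thesis by (simp add: negligible_iff_null_sets)
qed

lemma null_sets_space_slice: "{z. fst z $ i = c} \<in> null_sets (lebesgue :: ((real ^ 'n) \<times> real) measure)"
proof -
  have "(axis i 1 :: real ^ 'n, 0 :: real) \<in> Basis" by (auto simp: Basis_prod_def Basis_vec_def)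
  from negligible_standard_hyperplane[OF this, of c]
  have "negligible {z :: (real ^ 'n) \<times> real. fst z $ i = c}" by (simp add: inner_prod_def inner_axis)
  then show ?thesis by (simp add: negligible_iff_null_sets)
qed

definition half_centres :: "real ^ 'n \<Rightarrow> real \<Rightarrow> (real ^ 'n) set" where
  "half_centres x L = (\<lambda>\<sigma>. \<chi> i. x $ i + (if \<sigma> i then L / 4 else - L / 4)) ` UNIV"

lemma finite_half_centres [simp]: "finite (half_centres x L)"
  by (simp add: half_centres_def)

lemma card_half_centres: "card (half_centres (x :: real ^ 'n) L) \<le> 2 ^ CARD('n)"
proof -
  have "card (half_centres x L) \<le> card (UNIV :: ('n \<Rightarrow> bool) set)"
    unfolding half_centres_def by (rule card_image_le) simp
  then show ?thesis by (simp add: card_fun)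
qed

lemma half_centres_cover:
  assumes "y \<in> cube x L"
  shows "\<exists>c\<in>half_centres x L. y \<in> cube c (L / 2)"
proof -
  define c where "c = (\<chi> i. x $ i + (if y $ i \<ge> x $ i then L / 4 else - L / 4))"
  have "c \<in> half_centres x L" unfolding half_centres_def c_def
    by (rule image_eqI[of _ _ "\<lambda>i. y $ i \<ge> x $ i"]) auto
  moreover have "y \<in> cube c (L / 2)"
    unfolding cube_def
  proof safe
    fix i
    have "\<bar>y $ i - x $ i\<bar> \<le> L / 2" using assms by (simp add: cube_def)
    moreover have "c $ i = x $ i + (if x $ i \<le> y $ i then L / 4 else - L / 4)" by (simp add: c_def)
    ultimately show "\<bar>y $ i - c $ i\<bar> \<le> L / 2 / 2"
      by (cases "x $ i \<le> y $ i") (simp_all add: abs_if split: if_splits)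
  qed
  ultimately show ?thesis by blast
qed

lemma half_centres_subset:
  assumes "c \<in> half_centres x L" "0 < L"
  shows "cube c (L / 2) \<subseteq> cube x L"
  using assms by (intro cube_mono) (auto simp: half_centres_def)

lemma measurable_locally_integrable:
  assumes "locally_integrable (f :: 'a::euclidean_space \<Rightarrow> real)"
  shows "f \<in> borel_measurable lebesgue"
proof (rule borel_measurable_LIMSEQ_real)
  show "(\<lambda>x. indicator (cball 0 (real i)) x * f x) \<in> borel_measurable lebesgue" for i
    using assms[unfolded locally_integrable_def, rule_format, of "cball 0 (real i)"]
    by (simp add: set_integrable_def integrable_iff_bounded)
  show "(\<lambda>i. indicator (cball 0 (real i)) x * f x) \<longlonglongrightarrow> f x" for x
  proof (rule tendsto_eventually)
    obtain n where "norm x \<le> real n" using real_arch_simple by blast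
    then show "\<forall>\<^sub>F i in sequentially. indicator (cball 0 (real i)) x * f x = f x"
      by (intro eventually_sequentiallyI[of n]) (auto simp: indicator_def)
  qed
qed

locale parabolic_weight =
  fixes p :: real and w :: "(real ^ 'n) \<times> real \<Rightarrow> real"
  assumes p_ge_1: "1 \<le> p" and weight: "weight w"
begin

definition mu :: "((real ^ 'n) \<times> real) measure" where
  "mu = density lebesgue (\<lambda>z. ennreal (w z))"

lemma w_nonneg [simp]: "0 \<le> w z"
  using weight unfolding weight_def by blast

lemma w_measurable [measurable]: "w \<in> borel_measurable lebesgue"
  using weight by (intro measurable_locally_integrable) (simp add: weight_def)

lemma sets_mu [simp, measurable_cong]: "sets mu = sets lebesgue"
  by (simp add: mu_def)

lemma space_mu [simp]: "space mu = UNIV"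
  by (simp add: mu_def)

lemma emeasure_mu: "A \<in> sets lebesgue \<Longrightarrow> emeasure mu A = (\<integral>\<^sup>+z\<in>A. ennreal (w z) \<partial>lebesgue)"
  by (simp add: mu_def emeasure_density)

lemma mass_eq: "A \<in> sets lebesgue \<Longrightarrow> mass w A = emeasure mu A"
  by (simp add: mass_def emeasure_mu)

lemma null_sets_mu: "N \<in> null_sets lebesgue \<Longrightarrow> N \<in> null_sets mu"
  unfolding mu_def by (rule absolutely_continuousI_density[unfolded absolutely_continuous_def, THEN subsetD]) auto

lemma emeasure_mu_finite:
  assumes "A \<in> sets lebesgue" "bounded A"
  shows "emeasure mu A < top"
proof -
  obtain r where r: "A \<subseteq> cball 0 r" using bounded_subset_ballD[of A 0] assms ball_subset_cball by blast
  have "set_integrable lebesgue (cball 0 r) w"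
    using weight by (simp add: weight_def locally_integrable_def)
  then have "(\<integral>\<^sup>+z. ennreal (norm (indicator (cball 0 r) z *\<^sub>R w z)) \<partial>lebesgue) < top"
    by (simp add: set_integrable_def integrable_iff_bounded)
  also have "(\<integral>\<^sup>+z. ennreal (norm (indicator (cball 0 r) z *\<^sub>R w z)) \<partial>lebesgue)
      = (\<integral>\<^sup>+z\<in>cball 0 r. ennreal (w z) \<partial>lebesgue)"
    by (intro nn_integral_cong) (auto split: split_indicator)
  also have "(\<integral>\<^sup>+z\<in>cball 0 r. ennreal (w z) \<partial>lebesgue) = emeasure mu (cball 0 r)"
    by (simp add: emeasure_mu)
  finally show ?thesis
    using emeasure_mono[OF r, of mu] by (simp add: order_le_less_trans)
qed

lemma bounded_cube_Times: "bounded I \<Longrightarrow> bounded (cube (x :: real ^ 'n) L \<times> (I :: real set))"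
  by (simp add: bounded_Times cube_eq_cbox)

lemma bounded_rect: "bounded (rect_upper p (x :: real ^ 'n) t L)" "bounded (rect_lower p (x :: real ^ 'n) t L)"
  unfolding rect_upper_def rect_lower_def by (auto intro!: bounded_cube_Times)

lemma mu_rect_finite: "emeasure mu (rect_upper p x t L) < top" "emeasure mu (rect_lower p x t L) < top"
  by (auto intro!: emeasure_mu_finite bounded_rect)

lemma mu_Chebyshev:
  assumes "A \<in> sets lebesgue" "0 \<le> l" "\<And>z. z \<in> A \<Longrightarrow> w z \<le> l"
  shows "emeasure mu A \<le> ennreal l * emeasure lebesgue A"
proof -
  have "emeasure mu A \<le> (\<integral>\<^sup>+z. ennreal l * indicator A z \<partial>lebesgue)"
    using assms by (auto simp: emeasure_mu split: split_indicator intro!: nn_integral_mono ennreal_leI)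
  then show ?thesis using assms by (simp add: nn_integral_cmult_indicator)
qed

lemma mu_Chebyshev_ge:
  assumes "A \<in> sets lebesgue" "0 \<le> l" "\<And>z. z \<in> A \<Longrightarrow> l \<le> w z"
  shows "ennreal l * emeasure lebesgue A \<le> emeasure mu A"
proof -
  have "(\<integral>\<^sup>+z. ennreal l * indicator A z \<partial>lebesgue) \<le> emeasure mu A"
    using assms by (auto simp: emeasure_mu split: split_indicator intro!: nn_integral_mono ennreal_leI)
  then show ?thesis using assms by (simp add: nn_integral_cmult_indicator)
qed

lemma sets_superlevel [measurable, simp]: "{z. l < w z} \<in> sets lebesgue"
proof -
  have "{z \<in> space lebesgue. l < w z} \<in> sets lebesgue" by measurable
  then show ?thesis by simp
qed

end

section \<open>Parabolic grids\<close>

text \<open>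
  Cells of generation \<open>k\<close> have side \<open>L / 2 ^ k\<close>. Exact parabolic scaling would require the height
  \<open>(L / 2 ^ k) powr p\<close>, which does not give nested cells; the height is rounded down to \<open>L powr p\<close> over a
  power of two, losing at most a factor 2.
\<close>

locale parabolic_grid = parabolic_weight p w
  for p :: real and w :: "(real ^ 'n) \<times> real \<Rightarrow> real" +
  fixes a :: "real ^ 'n" and b L :: real
  assumes L_pos: "0 < L"
begin

definition expo :: "nat \<Rightarrow> nat" where "expo k = nat \<lfloor>real k * p\<rfloor> + 1"
definition side :: "nat \<Rightarrow> real" where "side k = L / 2 ^ k"
definition height :: "nat \<Rightarrow> real" where "height k = L powr p / 2 ^ expo k"
definition space_idx :: "nat \<Rightarrow> (real ^ 'n) \<times> real \<Rightarrow> 'n \<Rightarrow> int" where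
  "space_idx k z i = \<lfloor>(fst z $ i - a $ i) / side k\<rfloor>"
definition time_idx :: "nat \<Rightarrow> (real ^ 'n) \<times> real \<Rightarrow> int" where
  "time_idx k z = \<lfloor>(snd z - b) / height k\<rfloor>"
definition cell :: "nat \<Rightarrow> (real ^ 'n) \<times> real \<Rightarrow> ((real ^ 'n) \<times> real) set" where
  "cell k z = {y. space_idx k y = space_idx k z \<and> time_idx k y = time_idx k z}"
definition bottom :: "nat \<Rightarrow> (real ^ 'n) \<times> real \<Rightarrow> real" where
  "bottom k z = b + time_idx k z * height k"
definition centre :: "nat \<Rightarrow> (real ^ 'n) \<times> real \<Rightarrow> real ^ 'n" where
  "centre k z = (\<chi> i. a $ i + (space_idx k z i + 1 / 2) * side k)"
definition up_rect :: "nat \<Rightarrow> (real ^ 'n) \<times> real \<Rightarrow> ((real ^ 'n) \<times> real) set" where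
  "up_rect k z = rect_upper p (centre k z) (bottom k z + height k) (side k)"
definition low_rect :: "nat \<Rightarrow> (real ^ 'n) \<times> real \<Rightarrow> ((real ^ 'n) \<times> real) set" where
  "low_rect k z = rect_lower p (centre k z) (bottom k z + height k) (side k)"

lemma side_pos [simp]: "0 < side k"
  by (simp add: side_def L_pos)

lemma height_pos [simp]: "0 < height k"
  using L_pos by (simp add: height_def)

lemma side_powr: "side k powr p = L powr p / 2 powr (real k * p)"
  using L_pos by (simp add: side_def powr_divide powr_powr flip: powr_realpow)

lemma height_less: "height k < side k powr p"
proof -
  have "real k * p < real (expo k)" using p_ge_1 by (simp add: expo_def) linarith
  then have "2 powr (real k * p) < 2 ^ expo k" by (simp flip: powr_realpow)
  then show ?thesis using L_pos by (simp add: side_powr height_def divide_strict_left_mono)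
qed

lemma side_powr_le: "side k powr p \<le> 2 * height k"
proof -
  have "0 \<le> \<lfloor>real k * p\<rfloor>" using p_ge_1 by simp
  then have "real (expo k) - 1 \<le> real k * p" by (simp add: expo_def)
  then have "2 powr (real (expo k) - 1) \<le> 2 powr (real k * p)" by simp
  then have "2 ^ expo k \<le> 2 * 2 powr (real k * p)" by (simp add: powr_diff powr_realpow field_simps)
  then show ?thesis using L_pos by (simp add: side_powr height_def field_simps)
qed

lemma expo_Suc: "expo k + 1 \<le> expo (Suc k)"
proof -
  have "\<lfloor>real k * p\<rfloor> + 1 \<le> \<lfloor>real (Suc k) * p\<rfloor>"
    using p_ge_1 by (simp add: algebra_simps) linarith
  moreover have "0 \<le> \<lfloor>real k * p\<rfloor>" using p_ge_1 by simp
  ultimately show ?thesis unfolding expo_def by linarith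
qed

lemma expo_mono: "j \<le> k \<Longrightarrow> expo j \<le> expo k"
  by (induction k rule: dec_induct) (use expo_Suc le_trans add_leD1 in blast)+

lemma height_Suc: "2 * height (Suc k) \<le> height k"
proof -
  have "(2::real) ^ (expo k + 1) \<le> 2 ^ expo (Suc k)" using expo_Suc by (rule power_increasing) simp
  then show ?thesis using L_pos by (simp add: height_def field_simps)
qed

lemma height_mono: "j \<le> k \<Longrightarrow> height k \<le> height j"
  using L_pos expo_mono[of j k] by (simp add: height_def divide_left_mono)

lemma height_mult: "j \<le> k \<Longrightarrow> height j = real_of_int (2 ^ (expo k - expo j)) * height k"
  using power_add[of "2::real" "expo k - expo j" "expo j"] expo_mono[of j k] by (simp add: height_def)

lemma side_mult: "j \<le> k \<Longrightarrow> side j = real_of_int (2 ^ (k - j)) * side k"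
  using power_add[of "2::real" "k - j" j] by (simp add: side_def)

lemma space_idx_coarse: "j \<le> k \<Longrightarrow> space_idx j z i = space_idx k z i div 2 ^ (k - j)"
  unfolding space_idx_def side_mult
  by (subst floor_divide_real_eq_div[symmetric]) (auto simp: field_simps)

lemma time_idx_coarse: "j \<le> k \<Longrightarrow> time_idx j z = time_idx k z div 2 ^ (expo k - expo j)"
  unfolding time_idx_def height_mult
  by (subst floor_divide_real_eq_div[symmetric]) (auto simp: field_simps)

lemma cell_self [simp]: "z \<in> cell k z"
  by (simp add: cell_def)

lemma cell_eq: "y \<in> cell k z \<Longrightarrow> cell k y = cell k z"
  by (auto simp: cell_def)

lemma cell_coarse: "j \<le> k \<Longrightarrow> y \<in> cell k z \<Longrightarrow> y \<in> cell j z"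
  by (auto simp: cell_def space_idx_coarse time_idx_coarse fun_eq_iff)

lemma
  assumes "y \<in> cell k z"
  shows centre_cong: "centre k y = centre k z" and bottom_cong: "bottom k y = bottom k z"
    and up_rect_cong: "up_rect k y = up_rect k z" and low_rect_cong: "low_rect k y = low_rect k z"
  using assms by (simp_all add: cell_def centre_def bottom_def up_rect_def low_rect_def)

lemma space_bounds:
  "a $ i + space_idx k z i * side k \<le> fst z $ i" "fst z $ i < a $ i + (space_idx k z i + 1) * side k"
  using floor_divide_lower[of "side k" "fst z $ i - a $ i"] floor_divide_upper[of "side k" "fst z $ i - a $ i"]
  by (simp_all add: space_idx_def)

lemma time_bounds: "bottom k z \<le> snd z" "snd z < bottom k z + height k"
  using floor_divide_lower[of "height k" "snd z - b"] floor_divide_upper[of "height k" "snd z - b"]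
  by (simp_all add: time_idx_def bottom_def algebra_simps)

lemma time_idx_eqI:
  assumes "b + real_of_int m * height k \<le> t" "t < b + (real_of_int m + 1) * height k"
  shows "time_idx k (x, t) = m"
proof -
  have "m \<le> (t - b) / height k" "(t - b) / height k < m + 1"
    using assms by (simp_all add: field_simps)
  then show ?thesis by (simp add: time_idx_def floor_eq_iff)
qed

lemma space_idx_eqI:
  assumes "\<And>i. a $ i + real_of_int (m i) * side k \<le> fst z $ i"
    "\<And>i. fst z $ i < a $ i + (real_of_int (m i) + 1) * side k"
  shows "space_idx k z = m"
proof
  fix i
  have "m i \<le> (fst z $ i - a $ i) / side k" "(fst z $ i - a $ i) / side k < m i + 1"
    using assms(1,2)[of i] by (simp_all add: field_simps)
  then show "space_idx k z i = m i" by (simp add: space_idx_def floor_eq_iff)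
qed

lemma bottom_mono:
  assumes "j \<le> k" shows "bottom j z \<le> bottom k z"
proof -
  have "time_idx j z * 2 ^ (expo k - expo j) \<le> time_idx k z"
    unfolding time_idx_coarse[OF assms]
    using div_mult_mod_eq[of "time_idx k z" "2 ^ (expo k - expo j)"]
      pos_mod_sign[of "2 ^ (expo k - expo j)" "time_idx k z"] zero_less_power[of "2::int" "expo k - expo j"]
    by linarith
  then have "real_of_int (time_idx j z * 2 ^ (expo k - expo j)) * height k \<le> time_idx k z * height k"
    by (intro mult_right_mono) (auto intro: less_imp_le simp del: of_int_mult)
  then show ?thesis using assms by (simp add: bottom_def height_mult[OF assms] mult.assoc)
qed

lemma top_mono:
  assumes "j \<le> k" shows "bottom k z + height k \<le> bottom j z + height j"
proof -
  have "time_idx k z < (time_idx j z + 1) * 2 ^ (expo k - expo j)"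
    unfolding time_idx_coarse[OF assms] distrib_right
    using div_mult_mod_eq[of "time_idx k z" "2 ^ (expo k - expo j)"]
      pos_mod_bound[of "2 ^ (expo k - expo j)" "time_idx k z"] zero_less_power[of "2::int" "expo k - expo j"]
    by linarith
  then have "time_idx k z + 1 \<le> (time_idx j z + 1) * 2 ^ (expo k - expo j)" by simp
  then have "real_of_int (time_idx k z + 1) \<le> real_of_int ((time_idx j z + 1) * 2 ^ (expo k - expo j))"
    by (simp only: of_int_le_iff)
  then have "real_of_int (time_idx k z + 1) * height k
      \<le> real_of_int ((time_idx j z + 1) * 2 ^ (expo k - expo j)) * height k"
    by (intro mult_right_mono) (auto intro: less_imp_le)
  then show ?thesis using assms by (simp add: bottom_def height_mult[OF assms] algebra_simps)
qed

lemma cell_subset_low_rect: "cell k z \<subseteq> low_rect k z"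
proof
  fix y assume y: "y \<in> cell k z"
  then have eq: "centre k y = centre k z" "bottom k y = bottom k z"
    by (auto dest: centre_cong bottom_cong)
  have "fst y \<in> cube (centre k y) (side k)"
    unfolding cube_def
  proof safe
    fix i show "\<bar>fst y $ i - centre k y $ i\<bar> \<le> side k / 2"
      using space_bounds[where i = i and k = k and z = y] by (simp add: centre_def abs_le_iff field_simps)
  qed
  then show "y \<in> low_rect k z"
    using time_bounds[where k = k and z = y] height_less[of k] unfolding low_rect_def rect_lower_def eq
    by (auto simp: mem_Times_iff)
qed

lemma sets_cell [measurable, simp]: "cell k z \<in> sets lebesgue"
proof -
  have "{y. space_idx k y i = space_idx k z i} \<in> sets borel" for i
  proof -
    have "(\<lambda>y. (fst y $ i - a $ i) / side k) \<in> borel_measurable borel"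
      by (intro borel_measurable_continuous_onI continuous_intros) (auto simp: less_imp_neq[OF side_pos, symmetric])
    then have "(\<lambda>y. real_of_int (space_idx k y i)) \<in> borel_measurable borel"
      unfolding space_idx_def by measurable
    then have "{y \<in> space borel. real_of_int (space_idx k y i) = real_of_int (space_idx k z i)} \<in> sets borel"
      by measurable
    then show ?thesis by simp
  qed
  then have "(\<Inter>i. {y. space_idx k y i = space_idx k z i}) \<in> sets borel" by (intro sets.finite_INT) auto
  moreover have "{y. time_idx k y = time_idx k z} \<in> sets borel"
  proof -
    have "(\<lambda>y :: (real ^ 'n) \<times> real. (snd y - b) / height k) \<in> borel_measurable borel"
      by (intro borel_measurable_continuous_onI continuous_intros) (auto simp: less_imp_neq[OF height_pos, symmetric])
    then have "(\<lambda>y :: (real ^ 'n) \<times> real. real_of_int (time_idx k y)) \<in> borel_measurable borel"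
      unfolding time_idx_def by measurable
    then have "{y \<in> space borel. real_of_int (time_idx k y) = real_of_int (time_idx k z)} \<in> sets borel"
      by measurable
    then show ?thesis by simp
  qed
  ultimately have "(\<Inter>i. {y. space_idx k y i = space_idx k z i}) \<inter> {y. time_idx k y = time_idx k z} \<in> sets borel"
    by (rule sets.Int)
  also have "(\<Inter>i. {y. space_idx k y i = space_idx k z i}) \<inter> {y. time_idx k y = time_idx k z} = cell k z"
    by (auto simp: cell_def fun_eq_iff)
  finally show ?thesis by (metis sets_completionI_sets sets_lborel)
qed

lemma sets_up_rect [measurable, simp]: "up_rect k z \<in> sets lebesgue"
  and sets_low_rect [measurable, simp]: "low_rect k z \<in> sets lebesgue"
  by (simp_all add: up_rect_def low_rect_def)

lemma mem_shifted_cell: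
  assumes "space_idx k y = space_idx k z" "time_idx k y = time_idx k z + m"
  shows "y \<in> time_shift (real_of_int m * height k) (cell k z)"
proof -
  have "time_idx k (fst y, snd y - real_of_int m * height k) = time_idx k z"
    using time_bounds[where k = k and z = y] assms by (intro time_idx_eqI) (simp_all add: bottom_def algebra_simps)
  moreover have "space_idx k (fst y, snd y - real_of_int m * height k) = space_idx k z"
    unfolding assms(1)[symmetric] by (simp add: space_idx_def fun_eq_iff)
  ultimately show ?thesis by (simp add: mem_time_shift cell_def)
qed

lemma up_rect_cover:
  obtains N where "N \<in> null_sets lebesgue"
    "up_rect k z \<subseteq> time_shift (height k) (cell k z) \<union> time_shift (2 * height k) (cell k z) \<union> N"
proof
  let ?N = "\<Union>i. {y :: (real ^ 'n) \<times> real. fst y $ i = a $ i + (space_idx k z i + 1) * side k}"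
  show "?N \<in> null_sets lebesgue"
    by (intro null_sets_UN') (auto intro!: null_sets_space_slice)
  show "up_rect k z \<subseteq> time_shift (height k) (cell k z) \<union> time_shift (2 * height k) (cell k z) \<union> ?N"
  proof
    fix y assume y: "y \<in> up_rect k z"
    show "y \<in> time_shift (height k) (cell k z) \<union> time_shift (2 * height k) (cell k z) \<union> ?N"
    proof (cases "y \<in> ?N")
      case False
      have cu: "\<bar>fst y $ i - centre k z $ i\<bar> \<le> side k / 2" for i
        using y by (auto simp: up_rect_def rect_upper_def cube_def)
      have sp: "space_idx k y = space_idx k z"
      proof (rule space_idx_eqI)
        fix i
        show "a $ i + real_of_int (space_idx k z i) * side k \<le> fst y $ i"
          using cu[of i] by (simp add: centre_def abs_le_iff field_simps)
        have "fst y $ i \<noteq> a $ i + (space_idx k z i + 1) * side k" using False by auto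
        then show "fst y $ i < a $ i + (real_of_int (space_idx k z i) + 1) * side k"
          using cu[of i] by (simp add: centre_def abs_le_iff field_simps)
      qed
      have ti: "bottom k z + height k < snd y" "snd y < bottom k z + height k + side k powr p"
        using y by (auto simp: up_rect_def rect_upper_def)
      show ?thesis
      proof (cases "snd y < bottom k z + 2 * height k")
        case True
        have "time_idx k (fst y, snd y) = time_idx k z + 1"
          using ti True by (intro time_idx_eqI) (simp_all add: bottom_def algebra_simps)
        with mem_shifted_cell[OF sp, of 1] show ?thesis by simp
      next
        case False
        have "time_idx k (fst y, snd y) = time_idx k z + 2"
          using ti False side_powr_le[of k] by (intro time_idx_eqI) (simp_all add: bottom_def algebra_simps)
        with mem_shifted_cell[OF sp, of 2] show ?thesis by simp
      qed
    qed auto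
  qed
qed

lemma emeasure_up_rect_le:
  assumes "sets M = sets lebesgue" "\<And>N. N \<in> null_sets lebesgue \<Longrightarrow> N \<in> null_sets M"
  shows "emeasure M (up_rect k z)
    \<le> emeasure M (time_shift (height k) (cell k z)) + emeasure M (time_shift (2 * height k) (cell k z))"
proof -
  obtain N where N: "N \<in> null_sets lebesgue"
    "up_rect k z \<subseteq> time_shift (height k) (cell k z) \<union> time_shift (2 * height k) (cell k z) \<union> N"
    by (rule up_rect_cover)
  let ?U = "time_shift (height k) (cell k z) \<union> time_shift (2 * height k) (cell k z)"
  have sets: "?U \<in> sets M" "N \<in> null_sets M"
    using assms(1) assms(2)[OF N(1)] by simp_all
  have "emeasure M (up_rect k z) \<le> emeasure M (?U \<union> N)"
    by (rule emeasure_mono[OF N(2)]) (use sets in blast)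
  also have "\<dots> = emeasure M ?U"
    by (rule emeasure_Un_null_set[OF sets])
  also have "\<dots> \<le> emeasure M (time_shift (height k) (cell k z)) + emeasure M (time_shift (2 * height k) (cell k z))"
    by (rule emeasure_subadditive) (simp_all add: assms(1))
  finally show ?thesis .
qed

lemma rect_volume_side_le: "ennreal (rect_volume CARD('n) p (side k)) \<le> 2 * emeasure lebesgue (cell k z)"
proof -
  have "ennreal (rect_volume CARD('n) p (side k)) = emeasure lebesgue (up_rect k z)"
    unfolding up_rect_def emeasure_rect[OF side_pos] ..
  also have "\<dots> \<le> emeasure lebesgue (time_shift (height k) (cell k z))
      + emeasure lebesgue (time_shift (2 * height k) (cell k z))"
    by (rule emeasure_up_rect_le) auto
  also have "\<dots> = 2 * emeasure lebesgue (cell k z)"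
    unfolding emeasure_time_shift mult_2 ..
  finally show ?thesis .
qed

lemma emeasure_cell_le: "emeasure lebesgue (cell k z) \<le> ennreal (rect_volume CARD('n) p (side k))"
  using emeasure_mono[OF cell_subset_low_rect[of k z], of lebesgue]
  unfolding low_rect_def emeasure_rect(2)[OF side_pos] by simp

lemma rect_volume_side_Suc: "rect_volume CARD('n) p (side k) = 2 powr (real CARD('n) + p) * rect_volume CARD('n) p (side (Suc k))"
proof -
  have "side k / 2 ^ 1 = side (Suc k)" by (simp add: side_def)
  then show ?thesis
    using rect_volume_half_power[OF side_pos[of k], of p 1, where 'n = 'n] by simp
qed

lemma up_rect_Suc_subset:
  "up_rect (Suc k) z \<subseteq> low_rect k z \<union> up_rect k z \<union> {y. snd y = bottom k z + height k}"
proof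
  fix y assume y: "y \<in> up_rect (Suc k) z"
  have "cube (centre (Suc k) z) (side (Suc k)) \<subseteq> cube (centre k z) (side k)"
  proof (rule cube_mono)
    fix i
    have s: "side k = 2 * side (Suc k)" using side_mult[of k "Suc k"] by simp
    have d: "space_idx k z i = space_idx (Suc k) z i div 2" using space_idx_coarse[of k "Suc k"] by simp
    let ?s = "space_idx (Suc k) z i"
    have "?s = 2 * (?s div 2) \<or> ?s = 2 * (?s div 2) + 1" by presburger
    then have "centre (Suc k) z $ i - centre k z $ i = - side (Suc k) / 2 \<or>
        centre (Suc k) z $ i - centre k z $ i = side (Suc k) / 2"
    proof (elim disjE)
      assume "?s = 2 * (?s div 2)"
      then have "real_of_int ?s = 2 * real_of_int (?s div 2)" by linarith
      then show ?thesis by (simp add: centre_def s d algebra_simps)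
    next
      assume "?s = 2 * (?s div 2) + 1"
      then have "real_of_int ?s = 2 * real_of_int (?s div 2) + 1" by linarith
      then show ?thesis by (simp add: centre_def s d algebra_simps)
    qed
    then show "\<bar>centre (Suc k) z $ i - centre k z $ i\<bar> \<le> (side k - side (Suc k)) / 2"
      using side_pos[of "Suc k"] unfolding s by (smt (verit) field_sum_of_halves)
  qed
  moreover have "fst y \<in> cube (centre (Suc k) z) (side (Suc k))"
    "bottom (Suc k) z + height (Suc k) < snd y" "snd y < bottom (Suc k) z + height (Suc k) + side (Suc k) powr p"
    using y by (auto simp: up_rect_def rect_upper_def)
  moreover have "side (Suc k) powr p \<le> side k powr p"
    using p_ge_1 L_pos by (intro powr_mono2) (auto simp: side_def field_simps)
  moreover from calculation have "bottom k z + height k - side k powr p < snd y"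
    using bottom_mono[of k "Suc k" z] height_less[of k] height_pos[of "Suc k"] by linarith
  ultimately show "y \<in> low_rect k z \<union> up_rect k z \<union> {y. snd y = bottom k z + height k}"
    using top_mono[of k "Suc k" z]
    by (auto simp: up_rect_def low_rect_def rect_upper_def rect_lower_def mem_Times_iff)
qed

lemma height_nonneg [simp]: "0 \<le> height k" and height_neq_0 [simp]: "height k \<noteq> 0"
  by (rule less_imp_le[OF height_pos], rule less_imp_neq[OF height_pos, symmetric])

lemma time_shift_mono: "U \<subseteq> V \<Longrightarrow> time_shift s U \<subseteq> time_shift s V"
  by (auto simp: time_shift_def)

lemma space_idx_time_indep: "space_idx k (fst z, s) = space_idx k z"
  by (simp add: space_idx_def fun_eq_iff)

lemma time_idx_shift: "time_idx k (x, t - real_of_int m * height k) = time_idx k (x, t) - m"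
proof -
  have "(t - real_of_int m * height k - b) / height k = (t - b) / height k - real_of_int m"
    by (simp add: diff_divide_distrib)
  then show ?thesis by (simp add: time_idx_def)
qed

definition saturated :: "nat \<Rightarrow> ((real ^ 'n) \<times> real) set \<Rightarrow> bool" where
  "saturated k V \<longleftrightarrow> (\<forall>z\<in>V. cell k z \<subseteq> V)"

lemma saturatedD: "saturated k V \<Longrightarrow> z \<in> V \<Longrightarrow> y \<in> cell k z \<Longrightarrow> y \<in> V"
  by (auto simp: saturated_def)

lemma cell_sym: "y \<in> cell k z \<Longrightarrow> z \<in> cell k y"
  by (auto simp: cell_def)

lemma saturated_mono: "j \<le> k \<Longrightarrow> saturated j V \<Longrightarrow> saturated k V"
  using cell_coarse unfolding saturated_def by blast

lemma saturated_Un: "saturated k U \<Longrightarrow> saturated k V \<Longrightarrow> saturated k (U \<union> V)"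
  by (auto simp: saturated_def)

lemma saturated_Int: "saturated k U \<Longrightarrow> saturated k V \<Longrightarrow> saturated k (U \<inter> V)"
  by (auto simp: saturated_def)

lemma saturated_UN: "(\<And>i. i \<in> I \<Longrightarrow> saturated k (V i)) \<Longrightarrow> saturated k (\<Union>i\<in>I. V i)"
  unfolding saturated_def by blast

lemma saturated_Diff: "saturated k U \<Longrightarrow> saturated k V \<Longrightarrow> saturated k (U - V)"
  using cell_sym unfolding saturated_def by blast

lemma saturated_empty [simp]: "saturated k {}"
  by (simp add: saturated_def)

lemma saturated_time_shift:
  assumes "saturated k V" shows "saturated k (time_shift (real_of_int m * height k) V)"
  unfolding saturated_def
proof safe
  fix x t x' t'
  assume z: "(x, t) \<in> time_shift (real_of_int m * height k) V" and y: "(x', t') \<in> cell k (x, t)"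
  have "(x', t' - real_of_int m * height k) \<in> cell k (x, t - real_of_int m * height k)"
    using y space_idx_time_indep[of k "(x, t)" "t - real_of_int m * height k"]
      space_idx_time_indep[of k "(x', t')" "t' - real_of_int m * height k"]
    by (simp add: cell_def time_idx_shift)
  then show "(x', t') \<in> time_shift (real_of_int m * height k) V"
    using z saturatedD[OF assms] by (simp add: mem_time_shift)
qed

lemma saturated_UN_cells: "saturated k V \<Longrightarrow> V = \<Union>(cell k ` V)"
  unfolding saturated_def by (auto intro: cell_self)

lemma countable_cells: "countable (cell k ` V)"
proof -
  let ?g = "\<lambda>(s, t). {y. space_idx k y = s \<and> time_idx k y = t}"
  have "cell k ` V = ?g ` ((\<lambda>z. (space_idx k z, time_idx k z)) ` V)"
    unfolding image_image by (simp add: cell_def)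
  moreover have "countable ((\<lambda>z. (space_idx k z, time_idx k z)) ` V)" by (rule countableI_type)
  ultimately show ?thesis by simp
qed

lemma cells_disjoint: "c \<in> cell k ` V \<Longrightarrow> d \<in> cell k ` V \<Longrightarrow> c \<noteq> d \<Longrightarrow> c \<inter> d = {}"
  using cell_eq by blast

lemma sets_saturated: "saturated k V \<Longrightarrow> V \<in> sets lebesgue"
proof -
  assume V: "saturated k V"
  have "\<Union>(cell k ` V) \<in> sets lebesgue"
    by (rule sets.countable_Union) (auto intro: countable_cells)
  then show ?thesis unfolding saturated_UN_cells[OF V, symmetric] .
qed

lemma saturated_sum_le:
  assumes V: "saturated k V" and sets: "sets \<nu> = sets lebesgue" "sets \<rho> = sets lebesgue"
    and le: "\<And>z. z \<in> V \<Longrightarrow> emeasure \<rho> (cell k z)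
      \<le> c * (emeasure \<nu> (time_shift s (cell k z)) + emeasure \<nu> (time_shift r (cell k z)))"
  shows "emeasure \<rho> V \<le> c * (emeasure \<nu> (time_shift s V) + emeasure \<nu> (time_shift r V))"
proof -
  let ?I = "cell k ` V"
  have shift: "emeasure \<nu> (time_shift s V) = (\<integral>\<^sup>+i. emeasure \<nu> (time_shift s i) \<partial>count_space ?I)" for s
  proof -
    have "time_shift s V = time_shift s (\<Union>?I)" using saturated_UN_cells[OF V] by simp
    also have "\<dots> = (\<Union>i\<in>?I. time_shift s i)" by (auto simp: time_shift_def)
    finally have eq: "time_shift s V = (\<Union>i\<in>?I. time_shift s i)" .
    have "disjoint_family_on (time_shift s) ?I"
      unfolding disjoint_family_on_def
    proof (intro ballI impI)
      fix c d assume "c \<in> ?I" "d \<in> ?I" "c \<noteq> d"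
      then have "c \<inter> d = {}" by (rule cells_disjoint)
      then show "time_shift s c \<inter> time_shift s d = {}" by (auto simp: mem_time_shift)
    qed
    then show ?thesis unfolding eq
      using sets countable_cells by (intro emeasure_UN_countable) auto
  qed
  have "emeasure \<rho> V = emeasure \<rho> (\<Union>i\<in>?I. i)" using saturated_UN_cells[OF V] by simp
  also have "\<dots> = (\<integral>\<^sup>+i. emeasure \<rho> i \<partial>count_space ?I)"
    using sets countable_cells cells_disjoint[of _ k V]
    by (intro emeasure_UN_countable) (auto simp: disjoint_family_on_def)
  also have "\<dots> \<le> (\<integral>\<^sup>+i. c * (emeasure \<nu> (time_shift s i) + emeasure \<nu> (time_shift r i)) \<partial>count_space ?I)"
    using le by (intro nn_integral_mono) auto
  also have "\<dots> = c * (emeasure \<nu> (time_shift s V) + emeasure \<nu> (time_shift r V))"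
    by (simp add: nn_integral_cmult nn_integral_add shift)
  finally show ?thesis .
qed

lemma time_idx_cases:
  assumes "0 \<le> \<theta>" "\<theta> < real_of_int m * height k"
  obtains d where "0 \<le> d" "d \<le> m" "time_idx k z = time_idx k (fst z, snd z - \<theta>) + d"
proof
  let ?d = "time_idx k z - time_idx k (fst z, snd z - \<theta>)"
  have "(snd z - \<theta> - b) / height k \<le> (snd z - b) / height k"
    using assms by (intro divide_right_mono) auto
  then show "0 \<le> ?d" by (simp add: time_idx_def floor_mono)
  have "(snd z - b) / height k \<le> (snd z - \<theta> - b) / height k + real_of_int m"
  proof -
    have "(snd z - b) / height k \<le> (snd z - \<theta> - b + real_of_int m * height k) / height k"
      using assms by (intro divide_right_mono) auto
    then show ?thesis by (simp add: add_divide_distrib)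
  qed
  then have "\<lfloor>(snd z - b) / height k\<rfloor> \<le> \<lfloor>(snd z - \<theta> - b) / height k + real_of_int m\<rfloor>"
    by (rule floor_mono)
  then show "?d \<le> m" unfolding time_idx_def by simp
qed simp

section \<open>Marked cells\<close>

text \<open>
  If a cell of generation \<open>k\<close> is marked, then so are the cells of generation \<open>Suc k\<close> in its two upward
  translates. So the sizes of the maximal marked cells vary slowly in the time direction, which bounds
  the overlap of their upward translates.
\<close>

primrec marks :: "(nat \<Rightarrow> ((real ^ 'n) \<times> real) set) \<Rightarrow> nat \<Rightarrow> ((real ^ 'n) \<times> real) set" where
  "marks B 0 = {}"
| "marks B (Suc k) = B (Suc k) \<union> time_shift (height k) (marks B k) \<union> time_shift (2 * height k) (marks B k)"

definition fresh :: "(nat \<Rightarrow> ((real ^ 'n) \<times> real) set) \<Rightarrow> nat \<Rightarrow> ((real ^ 'n) \<times> real) set" where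
  "fresh B k = marks B k - (\<Union>j<k. marks B j)"

context
  fixes B :: "nat \<Rightarrow> ((real ^ 'n) \<times> real) set"
  assumes sat_B: "\<And>k. saturated k (B k)"
begin

lemma saturated_marks: "saturated k (marks B k)"
proof (induction k)
  case (Suc k)
  have "saturated (Suc k) (time_shift (height k) (marks B k))"
    "saturated (Suc k) (time_shift (2 * height k) (marks B k))"
    using saturated_time_shift[OF Suc, of 1] saturated_time_shift[OF Suc, of 2]
    by (auto intro: saturated_mono[of k])
  then show ?case by (auto intro!: saturated_Un sat_B)
qed simp

lemma saturated_fresh: "saturated k (fresh B k)"
  unfolding fresh_def
  by (intro saturated_Diff saturated_marks saturated_UN saturated_mono[OF _ saturated_marks]) auto

lemma sets_marks [measurable, simp]: "marks B k \<in> sets lebesgue"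
  by (rule sets_saturated[OF saturated_marks])

lemma UN_fresh: "(\<Union>k. fresh B k) = (\<Union>k. marks B k)"
proof
  show "(\<Union>k. fresh B k) \<subseteq> (\<Union>k. marks B k)" by (auto simp: fresh_def)
  show "(\<Union>k. marks B k) \<subseteq> (\<Union>k. fresh B k)"
  proof
    fix z assume "z \<in> (\<Union>k. marks B k)"
    then obtain k where k: "z \<in> marks B k" by blast
    define j where "j = (LEAST k. z \<in> marks B k)"
    have "z \<in> marks B j" unfolding j_def by (rule LeastI[of _ k]) (rule k)
    moreover have "z \<notin> marks B i" if "i < j" for i using that unfolding j_def by (rule not_less_Least)
    ultimately have "z \<in> fresh B j" by (simp add: fresh_def)
    then show "z \<in> (\<Union>k. fresh B k)" by (rule UN_I[OF UNIV_I])
  qed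
qed

lemma shifted_marks_subset:
  assumes "i = 1 \<or> i = 2"
  shows "time_shift (real_of_int i * height k) (marks B k) \<subseteq> marks B (Suc k)"
  using assms by auto

lemma fresh_shift_disjoint:
  assumes k: "k + 2 \<le> l" and i: "i = 1 \<or> i = 2" and j: "j = 1 \<or> j = (2::int)"
  shows "time_shift (real_of_int i * height k) (fresh B k)
    \<inter> time_shift (real_of_int j * height l) (fresh B l) = {}"
proof (rule ccontr)
  assume "\<not> ?thesis"
  then obtain y where y: "y \<in> time_shift (real_of_int i * height k) (fresh B k)"
    "y \<in> time_shift (real_of_int j * height l) (fresh B l)" by (meson disjoint_iff)
  define v where "v = (fst y, snd y - real_of_int i * height k)"
  define y' where "y' = (fst y, snd y - real_of_int j * height l)"
  have v: "v \<in> marks B k" and y': "y' \<in> fresh B l"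
    using y by (auto simp: mem_time_shift v_def y'_def fresh_def)
  have sp: "space_idx k y' = space_idx k v"
    by (simp add: v_def y'_def space_idx_time_indep)
  have tv: "time_idx k y = time_idx k v + i"
    using time_idx_shift[of k "fst y" "snd y" i] by (simp add: v_def)
  have "4 * height l \<le> height k"
    using height_Suc[of k] height_Suc[of "Suc k"] height_mono[OF k] by simp
  then have "0 \<le> real_of_int j * height l" "real_of_int j * height l < real_of_int 1 * height k"
    using j height_pos[of l] by (elim disjE; simp; linarith)+
  then obtain d where d: "0 \<le> d" "d \<le> 1" "time_idx k y = time_idx k y' + d"
    unfolding y'_def by (rule time_idx_cases)
  then have "time_idx k y' = time_idx k v + (i - d)" using tv by simp
  note mem = mem_shifted_cell[OF sp this]
  have "i - d \<in> {0, 1, 2}" using i d by auto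
  then consider "i - d = 0" | "i - d = 1 \<or> i - d = 2" by blast
  then have "\<exists>m<l. y' \<in> marks B m"
  proof cases
    case 1
    then have "y' \<in> cell k v" using mem by (simp add: mem_time_shift)
    then have "y' \<in> marks B k" using saturatedD[OF saturated_marks v] by simp
    then show ?thesis using k by (intro exI[of _ k]) simp
  next
    case 2
    have "y' \<in> time_shift (real_of_int (i - d) * height k) (marks B k)"
      using mem saturatedD[OF saturated_marks v] by (simp add: mem_time_shift)
    then have "y' \<in> marks B (Suc k)" using shifted_marks_subset[OF 2] by blast
    then show ?thesis using k by (intro exI[of _ "Suc k"]) simp
  qed
  then show False using y' by (auto simp: fresh_def)
qed

lemma fresh_sum_le:
  assumes V: "\<And>k. V k \<subseteq> fresh B k" "\<And>k. saturated k (V k)"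
    and sets: "sets \<nu> = sets lebesgue" "sets \<rho> = sets lebesgue"
    and le: "\<And>k z. z \<in> V k \<Longrightarrow> emeasure \<rho> (cell k z)
      \<le> c * (emeasure \<nu> (time_shift (height k) (cell k z)) + emeasure \<nu> (time_shift (2 * height k) (cell k z)))"
  shows "emeasure \<rho> (\<Union>k. V k) \<le> 4 * c * emeasure \<nu> (\<Union>k. marks B k)"
proof -
  let ?M = "\<Union>k. marks B k"
  note setsV = sets_saturated[OF V(2)]
  have half: "emeasure \<rho> (\<Union>m. V (2 * m + r)) \<le> 2 * c * emeasure \<nu> ?M" for r
  proof -
    have shift: "(\<Sum>m. emeasure \<nu> (time_shift (real_of_int i * height (2 * m + r)) (V (2 * m + r)))) \<le> emeasure \<nu> ?M"
      if i: "i = 1 \<or> i = 2" for i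
    proof -
      let ?S = "\<lambda>m. time_shift (real_of_int i * height (2 * m + r)) (V (2 * m + r))"
      have disj: "?S m \<inter> ?S n = {}" if "m < n" for m n
      proof -
        have "?S m \<subseteq> time_shift (real_of_int i * height (2 * m + r)) (fresh B (2 * m + r))"
          "?S n \<subseteq> time_shift (real_of_int i * height (2 * n + r)) (fresh B (2 * n + r))"
          by (intro time_shift_mono V(1))+
        then show ?thesis using fresh_shift_disjoint[of "2 * m + r" "2 * n + r" i i] i that by auto
      qed
      have "disjoint_family ?S"
        unfolding disjoint_family_on_def
      proof (intro ballI impI)
        fix m n :: nat assume "m \<noteq> n"
        then show "?S m \<inter> ?S n = {}" using disj[of m n] disj[of n m] by (cases "m < n") (simp_all add: Int_commute)
      qed
      then have "(\<Sum>m. emeasure \<nu> (?S m)) = emeasure \<nu> (\<Union>m. ?S m)"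
        by (intro suminf_emeasure) (simp_all add: setsV sets image_subset_iff)
      also have "\<dots> \<le> emeasure \<nu> ?M"
      proof (rule emeasure_mono)
        have "?S m \<subseteq> marks B (Suc (2 * m + r))" for m
        proof -
          have "V (2 * m + r) \<subseteq> marks B (2 * m + r)" using V(1)[of "2 * m + r"] by (auto simp: fresh_def)
          from order_trans[OF time_shift_mono[OF this] shifted_marks_subset[OF i]] show ?thesis .
        qed
        then show "(\<Union>m. ?S m) \<subseteq> ?M" by blast
        show "?M \<in> sets \<nu>" unfolding sets by auto
      qed
      finally show ?thesis .
    qed
    have "emeasure \<rho> (\<Union>m. V (2 * m + r)) \<le> (\<Sum>m. emeasure \<rho> (V (2 * m + r)))"
      by (intro emeasure_subadditive_countably) (simp add: setsV sets image_subset_iff)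
    also have "\<dots> \<le> (\<Sum>m. c * (emeasure \<nu> (time_shift (height (2 * m + r)) (V (2 * m + r)))
        + emeasure \<nu> (time_shift (2 * height (2 * m + r)) (V (2 * m + r)))))"
    proof (rule suminf_le)
      fix m
      show "emeasure \<rho> (V (2 * m + r)) \<le> c * (emeasure \<nu> (time_shift (height (2 * m + r)) (V (2 * m + r)))
        + emeasure \<nu> (time_shift (2 * height (2 * m + r)) (V (2 * m + r))))"
        by (rule saturated_sum_le[OF V(2) sets le])
    qed (rule summableI)+
    also have "\<dots> = c * (\<Sum>m. emeasure \<nu> (time_shift (height (2 * m + r)) (V (2 * m + r)))
        + emeasure \<nu> (time_shift (2 * height (2 * m + r)) (V (2 * m + r))))"
      by (rule ennreal_suminf_cmult)
    also have "\<dots> = c * ((\<Sum>m. emeasure \<nu> (time_shift (height (2 * m + r)) (V (2 * m + r))))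
        + (\<Sum>m. emeasure \<nu> (time_shift (2 * height (2 * m + r)) (V (2 * m + r)))))"
      by (subst suminf_add) simp_all
    also have "\<dots> \<le> c * (emeasure \<nu> ?M + emeasure \<nu> ?M)"
      using shift[of 1] shift[of 2] by (intro mult_left_mono add_mono) auto
    finally show ?thesis by (simp only: mult_2 distrib_left distrib_right)
  qed
  have "(\<Union>k. V k) \<subseteq> (\<Union>m. V (2 * m + 0)) \<union> (\<Union>m. V (2 * m + 1))"
  proof safe
    fix x t k assume "(x, t) \<in> V k" "(x, t) \<notin> (\<Union>m. V (2 * m + 1))"
    moreover from this have "k \<noteq> 2 * (k div 2) + 1" by (metis UN_I UNIV_I)
    then have "k = 2 * (k div 2) + 0" by presburger
    ultimately have "(x, t) \<in> V (2 * (k div 2) + 0)" by simp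
    then show "(x, t) \<in> (\<Union>m. V (2 * m + 0))" by (rule UN_I[OF UNIV_I])
  qed
  then have "emeasure \<rho> (\<Union>k. V k) \<le> emeasure \<rho> ((\<Union>m. V (2 * m + 0)) \<union> (\<Union>m. V (2 * m + 1)))"
    by (rule emeasure_mono) (simp add: sets setsV sets.Un sets.countable_UN image_subset_iff)
  also have "\<dots> \<le> emeasure \<rho> (\<Union>m. V (2 * m + 0)) + emeasure \<rho> (\<Union>m. V (2 * m + 1))"
    by (rule emeasure_subadditive) (simp_all add: sets setsV sets.countable_UN image_subset_iff)
  also have "\<dots> \<le> 2 * c * emeasure \<nu> ?M + 2 * c * emeasure \<nu> ?M"
    by (intro add_mono half)
  also have "\<dots> = 4 * c * emeasure \<nu> ?M"
    by (simp only: numeral_Bit0[of "num.Bit0 num.One"] distrib_right)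
  finally show ?thesis .
qed

lemma marks_origin:
  assumes "z \<in> marks B k"
  shows "\<exists>j\<le>k. \<exists>\<theta>\<ge>0. \<theta> \<le> 4 * height j - 4 * height k \<and> (fst z, snd z - \<theta>) \<in> B j \<inter> fresh B j"
  using assms
proof (induction k arbitrary: z rule: less_induct)
  case (less k)
  then obtain k' where k: "k = Suc k'" by (cases k) auto
  from less.prems consider "z \<in> B k" | i :: int where "i = 1 \<or> i = 2"
    "(fst z, snd z - real_of_int i * height k') \<in> marks B k'"
    unfolding k by (auto simp: mem_time_shift) (metis of_int_1 mult_1 of_int_numeral)+
  then show ?case
  proof cases
    case 1
    show ?thesis
    proof (cases "z \<in> fresh B k")
      case True
      with 1 show ?thesis by (intro exI[of _ k] conjI exI[of _ 0]) auto
    next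
      case False
      then obtain l where l: "l < k" "z \<in> marks B l" using less.prems by (auto simp: fresh_def)
      from less.IH[OF l] obtain j \<theta> where "j \<le> l" "0 \<le> \<theta>" "\<theta> \<le> 4 * height j - 4 * height l"
        "(fst z, snd z - \<theta>) \<in> B j \<inter> fresh B j" by blast
      moreover have "height k \<le> height l" using l by (intro height_mono) auto
      ultimately show ?thesis using l by (intro exI[of _ j] conjI exI[of _ \<theta>]) auto
    qed
  next
    case 2
    from less.IH[OF _ 2(2)] obtain j \<theta> where j: "j \<le> k'" "0 \<le> \<theta>" "\<theta> \<le> 4 * height j - 4 * height k'"
      "(fst z, snd z - real_of_int i * height k' - \<theta>) \<in> B j \<inter> fresh B j" unfolding k by auto
    have "real_of_int i * height k' \<le> 2 * height k'" "0 \<le> real_of_int i * height k'"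
      using 2(1) by auto
    moreover have "\<theta> + real_of_int i * height k' \<le> 4 * height j - 4 * height (Suc k')"
      using calculation j(3) height_Suc[of k'] by linarith
    ultimately show ?thesis using j unfolding k
      by (intro exI[of _ j] conjI exI[of _ "\<theta> + real_of_int i * height k'"]) (auto simp: algebra_simps)
  qed
qed

lemma emeasure_marks_le:
  "emeasure lebesgue (\<Union>k. marks B k) \<le> 5 * emeasure lebesgue (\<Union>k. B k \<inter> fresh B k)"
proof -
  let ?J = "\<lambda>k. B k \<inter> fresh B k"
  have satJ: "saturated k (?J k)" for k by (intro saturated_Int sat_B saturated_fresh)
  note setsJ = sets_saturated[OF satJ]
  have "(\<Union>k. marks B k) \<subseteq> (\<Union>d\<in>{0..4::int}. \<Union>j. time_shift (real_of_int d * height j) (?J j))"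
  proof safe
    fix x t k assume "(x, t) \<in> marks B k"
    from marks_origin[OF this] obtain j \<theta> where j: "0 \<le> \<theta>" "\<theta> \<le> 4 * height j - 4 * height k"
      and y: "(x, t - \<theta>) \<in> ?J j" by auto
    have "\<theta> < real_of_int 4 * height j" using j height_pos[of k] by linarith
    with j(1) obtain d where d: "0 \<le> d" "d \<le> 4" "time_idx j (x, t) = time_idx j (fst (x, t), snd (x, t) - \<theta>) + d"
      by (rule time_idx_cases)
    have "space_idx j (x, t) = space_idx j (fst (x, t), snd (x, t) - \<theta>)"
      using space_idx_time_indep[of j "(x, t)" "t - \<theta>"] by simp
    from mem_shifted_cell[OF this d(3)]
    have "(x, t) \<in> time_shift (real_of_int d * height j) (?J j)"
      using saturatedD[OF satJ y] by (simp add: mem_time_shift)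
    then show "(x, t) \<in> (\<Union>d\<in>{0..4::int}. \<Union>j. time_shift (real_of_int d * height j) (?J j))"
      using d by auto
  qed
  then have "emeasure lebesgue (\<Union>k. marks B k)
      \<le> emeasure lebesgue (\<Union>d\<in>{0..4::int}. \<Union>j. time_shift (real_of_int d * height j) (?J j))"
    using setsJ by (intro emeasure_mono sets.finite_UN sets.countable_UN) auto
  also have "\<dots> \<le> (\<Sum>d\<in>{0..4::int}. emeasure lebesgue (\<Union>j. time_shift (real_of_int d * height j) (?J j)))"
    using setsJ by (intro emeasure_subadditive_finite) auto
  also have "\<dots> \<le> (\<Sum>d\<in>{0..4::int}. \<Sum>j. emeasure lebesgue (time_shift (real_of_int d * height j) (?J j)))"
    using setsJ by (intro sum_mono emeasure_subadditive_countably) auto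
  also have "\<dots> = 5 * (\<Sum>j. emeasure lebesgue (?J j))" unfolding emeasure_time_shift by simp
  also have "(\<Sum>j. emeasure lebesgue (?J j)) = emeasure lebesgue (\<Union>j. ?J j)"
  proof (rule suminf_emeasure)
    have "fresh B m \<inter> fresh B n = {}" if "m < n" for m n using that by (auto simp: fresh_def)
    then show "disjoint_family ?J" unfolding disjoint_family_on_def
      by (metis (no_types, lifting) Int_assoc Int_commute inf_bot_right linorder_neqE_nat)
  qed (use setsJ in auto)
  finally show ?thesis .
qed

end

end

declare emeasure_completion [simp del]

context parabolic_weight
begin

definition mu_above :: "real \<Rightarrow> ((real ^ 'n) \<times> real) measure" where
  "mu_above l = density lebesgue (\<lambda>z. ennreal (w z) * indicator {z. l < w z} z)"

lemma sets_mu_above [simp, measurable_cong]: "sets (mu_above l) = sets lebesgue"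
  by (simp add: mu_above_def)

lemma emeasure_mu_above:
  assumes "X \<in> sets lebesgue"
  shows "emeasure (mu_above l) X = emeasure mu (X \<inter> {z. l < w z})"
proof -
  have [measurable]: "{z. l < w z} \<in> sets lebesgue" by simp
  have "emeasure (mu_above l) X = (\<integral>\<^sup>+z. ennreal (w z) * indicator {z. l < w z} z * indicator X z \<partial>lebesgue)"
    unfolding mu_above_def using assms by (intro emeasure_density) measurable
  also have "\<dots> = (\<integral>\<^sup>+z\<in>X \<inter> {z. l < w z}. ennreal (w z) \<partial>lebesgue)"
    by (intro nn_integral_cong) (auto split: split_indicator)
  also have "\<dots> = emeasure mu (X \<inter> {z. l < w z})"
    using assms by (intro emeasure_mu[symmetric] sets.Int) auto
  finally show ?thesis .
qed

lemma null_sets_mu_above: "N \<in> null_sets lebesgue \<Longrightarrow> N \<in> null_sets (mu_above l)"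
  using null_sets_mu[of N] emeasure_mu_above[of N l] emeasure_mono[of "N \<inter> {z. l < w z}" N mu]
  by (auto simp: null_sets_def)

lemma mu_le_mu_above:
  assumes X: "X \<in> sets lebesgue" and l: "0 \<le> l"
  shows "emeasure mu X \<le> emeasure (mu_above l) X + ennreal l * emeasure lebesgue X"
proof -
  have l_sets: "{z. l < w z} \<in> sets lebesgue" by simp
  have "X = (X \<inter> {z. l < w z}) \<union> (X - {z. l < w z})" by blast
  then have "emeasure mu X \<le> emeasure mu (X \<inter> {z. l < w z}) + emeasure mu (X - {z. l < w z})"
    using X by (metis emeasure_subadditive sets.Int sets.Diff l_sets sets_mu)
  also have "emeasure mu (X - {z. l < w z}) \<le> ennreal l * emeasure lebesgue (X - {z. l < w z})"
    using X l by (intro mu_Chebyshev) auto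
  also have "\<dots> \<le> ennreal l * emeasure lebesgue X"
    using X by (intro mult_left_mono emeasure_mono) auto
  finally show ?thesis using X by (simp add: emeasure_mu_above add_left_mono)
qed

end

context parabolic_grid
begin

lemma saturated_sum_le_single:
  assumes V: "saturated k V" and "0 \<le> C" and sets: "sets \<rho> = sets lebesgue"
    and le: "\<And>z. z \<in> V \<Longrightarrow> emeasure \<rho> (cell k z) \<le> ennreal C * emeasure lebesgue (cell k z)"
  shows "emeasure \<rho> V \<le> ennreal C * emeasure lebesgue V"
proof -
  have eq: "ennreal (C / 2) * (x + x) = ennreal C * x" for x
  proof -
    have "ennreal (C / 2) * (x + x) = (ennreal (C / 2) + ennreal (C / 2)) * x"
      by (simp only: distrib_left distrib_right)
    then show ?thesis using assms(2) by (simp flip: ennreal_plus)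
  qed
  have "emeasure \<rho> V
      \<le> ennreal (C / 2) * (emeasure lebesgue (time_shift 0 V) + emeasure lebesgue (time_shift 0 V))"
    using le by (intro saturated_sum_le[OF V _ sets]) (simp_all only: emeasure_time_shift eq)
  then show ?thesis by (simp only: emeasure_time_shift eq)
qed

lemma height_le: "height k \<le> L powr p / 2 ^ k"
proof (induction k)
  case 0
  have "L powr p / 2 ^ expo 0 \<le> L powr p / 1" by (intro divide_left_mono) auto
  then show ?case by (simp add: height_def)
next
  case (Suc k)
  then have "2 * height (Suc k) \<le> L powr p / 2 ^ k" using height_Suc[of k] by linarith
  then show ?case by (simp add: field_simps)
qed

lemma cell_dist_less:
  assumes "y \<in> cell k z"
  shows "dist z y \<le> (real CARD('n) * L + L powr p) / 2 ^ k"
proof -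
  have "\<bar>fst z $ i - fst y $ i\<bar> \<le> L / 2 ^ k" for i
  proof -
    have "space_idx k y = space_idx k z" using assms by (simp add: cell_def)
    then show ?thesis
      using space_bounds[where i = i and k = k and z = z] space_bounds[where i = i and k = k and z = y]
      by (simp add: side_def abs_le_iff algebra_simps)
  qed
  then have "(\<Sum>i\<in>UNIV. \<bar>(fst z - fst y) $ i\<bar>) \<le> (\<Sum>i\<in>(UNIV :: 'n set). L / 2 ^ k)"
    by (intro sum_mono) simp
  then have "norm (fst z - fst y) \<le> real CARD('n) * (L / 2 ^ k)"
    using norm_le_l1_cart[of "fst z - fst y"] by simp
  moreover have "\<bar>snd z - snd y\<bar> \<le> L powr p / 2 ^ k"
  proof -
    have "bottom k y = bottom k z" using assms by (rule bottom_cong)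
    then show ?thesis
      using time_bounds[where k = k and z = z] time_bounds[where k = k and z = y] height_le[of k]
      by (simp add: abs_le_iff)
  qed
  moreover have "dist z y \<le> norm (fst z - fst y) + \<bar>snd z - snd y\<bar>"
    unfolding dist_norm using norm_Pair_le[of "fst z - fst y" "snd z - snd y"]
    by (simp add: prod_eq_iff flip: fst_diff snd_diff)
  ultimately show ?thesis by (simp add: add_divide_distrib)
qed

lemma cell_antimono: "j \<le> k \<Longrightarrow> cell k z \<subseteq> cell j z"
  using cell_coarse by blast

lemma small_cell:
  assumes "open U" "z \<in> U"
  shows "\<exists>k. cell k z \<subseteq> U"
proof -
  obtain e where e: "e > 0" "\<And>y. dist y z < e \<Longrightarrow> y \<in> U" using assms by (auto simp: open_dist)
  let ?c = "real CARD('n) * L + L powr p"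
  have c: "0 < ?c" using L_pos by (intro add_nonneg_pos) auto
  obtain k where "(1 / 2) ^ k < e / ?c" using real_arch_pow_inv[of "e / ?c" "1 / 2"] e c by auto
  then have "?c / 2 ^ k < e" using c by (simp add: field_simps power_one_over)
  then have "y \<in> U" if "y \<in> cell k z" for y
    using cell_dist_less[OF that] by (intro e(2)) (simp add: dist_commute)
  then have "cell k z \<subseteq> U" by blast
  then show ?thesis ..
qed

text \<open>A substitute for Lebesgue's differentiation theorem.\<close>

lemma mu_superlevel_null:
  assumes Z: "Z \<in> sets lebesgue" "emeasure lebesgue Z < top" and K: "0 \<le> K" "K < l"
    and le: "\<And>z k. z \<in> Z \<Longrightarrow> k0 \<le> k \<Longrightarrow> emeasure mu (cell k z) \<le> ennreal K * emeasure lebesgue (cell k z)"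
  shows "emeasure mu (Z \<inter> {z. l < w z}) = 0"
proof -
  define Y where "Y = Z \<inter> {z. l < w z}"
  have Y [measurable]: "Y \<in> sets lebesgue" using Z unfolding Y_def by simp
  have Y_fin: "emeasure lebesgue Y < top"
    using emeasure_mono[of Y Z lebesgue] Z unfolding Y_def by (auto intro: order_le_less_trans)
  have eps: "emeasure mu Y \<le> ennreal K * emeasure lebesgue Y + ennreal \<epsilon>" if \<epsilon>: "\<epsilon> > 0" for \<epsilon>
  proof -
    define e where "e = \<epsilon> / (K + 1)"
    have "e > 0" using \<epsilon> K by (simp add: e_def)
    then obtain U where U: "open U" "Y \<subseteq> U" "emeasure lebesgue (U - Y) < ennreal e"
      using sets_lebesgue_outer_open[OF Y] by metis
    have U_sets [measurable]: "U \<in> sets lebesgue" using U(1) by (simp add: borel_open)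
    define V where "V k = {y. cell k y \<subseteq> U \<and> cell k y \<inter> Y \<noteq> {}}" for k
    have satV: "saturated k (V k)" for k unfolding saturated_def V_def using cell_eq by blast
    have V_le: "emeasure mu (Y \<inter> V k) \<le> ennreal K * emeasure lebesgue U" if k: "k0 \<le> k" for k
    proof -
      have "emeasure mu (V k) \<le> ennreal K * emeasure lebesgue (V k)"
      proof (rule saturated_sum_le_single[OF satV K(1) sets_mu])
        fix z assume "z \<in> V k"
        then obtain y where y: "y \<in> cell k z" "y \<in> Y" unfolding V_def by blast
        have "y \<in> Z" using y(2) by (simp add: Y_def)
        from le[OF this k] show "emeasure mu (cell k z) \<le> ennreal K * emeasure lebesgue (cell k z)"
          unfolding cell_eq[OF y(1)] .
      qed
      also have "\<dots> \<le> ennreal K * emeasure lebesgue U"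
      proof (intro mult_left_mono emeasure_mono)
        show "V k \<subseteq> U" using cell_self unfolding V_def by blast
      qed auto
      finally show ?thesis
        using emeasure_mono[of "Y \<inter> V k" "V k" mu] sets_saturated[OF satV] by (auto intro: order_trans)
    qed
    have YV: "Y \<inter> V k = {z \<in> Y. cell k z \<subseteq> U}" for k unfolding V_def using cell_self by blast
    have "incseq (\<lambda>k. Y \<inter> V (k + k0))"
      unfolding incseq_def YV
    proof (intro allI impI subsetI)
      fix m n z assume "m \<le> n" "z \<in> {z \<in> Y. cell (m + k0) z \<subseteq> U}"
      moreover from this have "cell (n + k0) z \<subseteq> cell (m + k0) z" by (intro cell_antimono) simp
      ultimately show "z \<in> {z \<in> Y. cell (n + k0) z \<subseteq> U}" by blast
    qed
    moreover have "(\<Union>k. Y \<inter> V (k + k0)) = Y"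
    proof
      show "Y \<subseteq> (\<Union>k. Y \<inter> V (k + k0))"
      proof
        fix z assume z: "z \<in> Y"
        then obtain k where "cell k z \<subseteq> U" using small_cell[OF U(1)] U(2) by blast
        then have "cell (k + k0) z \<subseteq> U" using cell_antimono[OF le_add1[of k k0], of z] by blast
        then show "z \<in> (\<Union>k. Y \<inter> V (k + k0))" using z unfolding YV by blast
      qed
    qed auto
    ultimately have "emeasure mu Y = (SUP k. emeasure mu (Y \<inter> V (k + k0)))"
      using SUP_emeasure_incseq[of "\<lambda>k. Y \<inter> V (k + k0)" mu] sets_saturated[OF satV] Y
      by (simp add: image_subset_iff sets.Int)
    also have "\<dots> \<le> ennreal K * emeasure lebesgue U" by (intro SUP_least V_le) simp
    also have "emeasure lebesgue U \<le> emeasure lebesgue Y + ennreal e"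
    proof -
      have "emeasure lebesgue U = emeasure lebesgue (Y \<union> (U - Y))" using U(2) by (simp add: Un_absorb1)
      also have "\<dots> \<le> emeasure lebesgue Y + emeasure lebesgue (U - Y)"
        by (intro emeasure_subadditive) auto
      finally show ?thesis using U(3) by (meson add_left_mono less_imp_le order_trans)
    qed
    also have "ennreal K * (emeasure lebesgue Y + ennreal e) = ennreal K * emeasure lebesgue Y + ennreal (K * e)"
      using K \<open>e > 0\<close> by (simp add: distrib_left ennreal_mult)
    also have "\<dots> \<le> ennreal K * emeasure lebesgue Y + ennreal \<epsilon>"
      using K \<epsilon> by (intro add_left_mono ennreal_leI) (simp add: e_def field_simps)
    finally show ?thesis by (meson mult_left_mono zero_le)
  qed
  have "emeasure mu Y \<le> ennreal K * emeasure lebesgue Y"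
    by (rule ennreal_le_epsilon) (rule eps)
  moreover have "ennreal l * emeasure lebesgue Y \<le> emeasure mu Y"
    using K Y by (intro mu_Chebyshev_ge) (auto simp: Y_def)
  ultimately have le': "ennreal l * emeasure lebesgue Y \<le> ennreal K * emeasure lebesgue Y" by order
  have "emeasure lebesgue Y = 0"
  proof (rule ccontr)
    assume "emeasure lebesgue Y \<noteq> 0"
    then have "ennreal K * emeasure lebesgue Y < ennreal l * emeasure lebesgue Y"
      using Y_fin K by (intro ennreal_mult_strict_right_mono) (auto simp: zero_less_iff_neq_zero ennreal_less_iff)
    then show False using le' by simp
  qed
  then have "Y \<in> null_sets mu" by (intro null_sets_mu) (auto simp: null_sets_def)
  then show ?thesis by (auto simp: Y_def)
qed

definition column :: "((real ^ 'n) \<times> real) set" where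
  "column = {z. space_idx 0 z = (\<lambda>_. 0) \<and> b \<le> snd z}"

lemma time_idx_nonneg_iff: "0 \<le> time_idx k z \<longleftrightarrow> b \<le> snd z"
  using height_pos[of k] by (auto simp: time_idx_def zero_le_divide_iff simp del: height_pos)

lemma saturated_column: "saturated k column"
  unfolding saturated_def
proof (intro ballI subsetI)
  fix z y assume z: "z \<in> column" and y: "y \<in> cell k z"
  have "space_idx 0 y = space_idx 0 z" using cell_coarse[OF le0 y] by (simp add: cell_def)
  moreover have "b \<le> snd y"
    using z y unfolding time_idx_nonneg_iff[of k, symmetric] column_def mem_Collect_eq
    by (simp add: cell_def)
  ultimately show "y \<in> column" using z by (simp add: column_def)
qed

lemma sets_column [measurable, simp]: "column \<in> sets lebesgue"
  by (rule sets_saturated[OF saturated_column])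

lemma column_subset: "column \<inter> {z. snd z < T} \<subseteq> cube (\<chi> i. a $ i + L / 2) L \<times> {b..<T}"
proof
  fix z assume z: "z \<in> column \<inter> {z. snd z < T}"
  have "\<bar>fst z $ i - (a $ i + L / 2)\<bar> \<le> L / 2" for i
    using space_bounds[where k = 0 and i = i and z = z] z
    by (intro abs_leI) (auto simp: column_def side_def field_simps)
  then show "z \<in> cube (\<chi> i. a $ i + L / 2) L \<times> {b..<T}"
    using z by (auto simp: cube_def column_def mem_Times_iff)
qed

lemma sets_snd_less [measurable, simp]: "{z. snd z < T} \<in> sets (lebesgue :: ((real ^ 'n) \<times> real) measure)"
proof -
  have "{z. snd z < T} = (UNIV :: (real ^ 'n) set) \<times> {..<T}" by auto
  then show ?thesis by (simp add: sets_Times_borel)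
qed

lemma saturated_bottom: "saturated k {z. bottom k z < T}"
  using bottom_cong unfolding saturated_def by auto

text \<open>
  The maximal marked cells cover the set where \<open>w\<close> is large. Their parents are good, so \<open>high\<close> applies to
  them at a level comparable to \<open>lam\<close>, and every point is charged at most four times. The part of \<open>w\<close>
  below \<open>\<theta> * lam\<close> is absorbed, because the averages over the bad cells exceed \<open>lam\<close>.
\<close>

lemma good_lambda_step:
  assumes high: "\<And>x t r l. 0 < r \<Longrightarrow> 0 \<le> l \<Longrightarrow>
      emeasure mu (rect_upper p x t r) \<le> ennreal (l * rect_volume CARD('n) p r) \<Longrightarrow>
      emeasure mu (rect_lower p x t r \<inter> {z. A * l < w z}) \<le> ennreal \<beta> * emeasure mu (rect_upper p x t r)"
    and doubling: "\<And>x t r. 0 < r \<Longrightarrow> emeasure mu (rect_lower p x t r) \<le> ennreal K * emeasure mu (rect_upper p x t r)"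
    and pos: "0 < lam" "0 \<le> \<beta>" "0 \<le> K" "0 \<le> A" "0 \<le> \<theta>" "\<theta> \<le> 1 / 2"
    and \<Lambda>: "A * ((K + 1) * 2 powr (real CARD('n) + p)) \<le> \<Lambda>" "2 * K < \<Lambda>"
    and root: "\<And>z. z \<in> column \<Longrightarrow> bottom k0 z < T \<Longrightarrow>
      emeasure mu (up_rect k0 z) \<le> ennreal (lam * rect_volume CARD('n) p (side k0))"
  shows "emeasure mu (column \<inter> {z. snd z < T} \<inter> {z. \<Lambda> * lam < w z})
    \<le> ennreal (4 * \<beta> * (1 + 40 * \<theta>)) * emeasure mu (column \<inter> {z. snd z < T + 5 * height k0} \<inter> {z. \<theta> * lam < w z})"
proof -
  let ?vol = "\<lambda>k. rect_volume CARD('n) p (side k)"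
  define B where "B k = (if k0 < k then column \<inter> {z. bottom k z < T}
    \<inter> {z. ennreal (lam * ?vol k) < emeasure mu (up_rect k z)} else {})" for k
  have sat_B: "saturated k (B k)" for k
  proof (cases "k0 < k")
    case True
    have "saturated k {z. ennreal (lam * ?vol k) < emeasure mu (up_rect k z)}"
      using up_rect_cong unfolding saturated_def by auto
    with True show ?thesis unfolding B_def
      by (simp only: if_True saturated_Int saturated_column saturated_bottom)
  qed (simp add: B_def)
  let ?M = "\<Union>k. marks B k"
  have M_sets [measurable]: "?M \<in> sets lebesgue" using sets_marks[OF sat_B] by auto
  have marks_empty: "marks B k = {}" if "k \<le> k0" for k
    using that
  proof (induction k)
    case (Suc k)
    then have "marks B k = {}" by simp
    moreover have "B (Suc k) = {}" using Suc.prems by (simp add: B_def)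
    ultimately show ?case by (simp add: time_shift_def)
  qed simp
  have M_column: "z \<in> column \<and> snd z < T + 5 * height k0" if z: "z \<in> marks B k" for z k
  proof -
    obtain j v where v: "0 \<le> v" "v \<le> 4 * height j - 4 * height k" "(fst z, snd z - v) \<in> B j"
      using marks_origin[OF sat_B z] by blast
    have j: "k0 < j" "(fst z, snd z - v) \<in> column" "bottom j (fst z, snd z - v) < T"
      using v(3) by (auto simp: B_def split: if_splits)
    have "snd z - v < T + height j"
      using j(3) time_bounds(2)[where k = j and z = "(fst z, snd z - v)"] by simp
    then have "snd z < T + 5 * height j" using v(2) height_nonneg[of k] by linarith
    moreover have "height j \<le> height k0" using j(1) by (intro height_mono) simp
    ultimately have "snd z < T + 5 * height k0" by linarith
    moreover have "z \<in> column"
      using j(2) v(1) space_idx_time_indep[of 0 z "snd z - v"] by (simp add: column_def)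
    ultimately show ?thesis by simp
  qed
  have good: "emeasure mu (up_rect k z) \<le> ennreal (lam * ?vol k)"
    if z: "z \<in> column" "bottom k z < T" and k: "k0 \<le> k" "z \<notin> marks B k" for z k
  proof (cases "k = k0")
    case True
    then show ?thesis using root z by simp
  next
    case False
    then have "z \<notin> B k" using k by (cases k) auto
    then show ?thesis using False k z by (auto simp: B_def)
  qed
  let ?high = "{z. \<Lambda> * lam < w z}"
  have cell_high: "emeasure (mu_above (\<Lambda> * lam)) (cell k z)
      \<le> ennreal \<beta> * (emeasure mu (time_shift (height k) (cell k z)) + emeasure mu (time_shift (2 * height k) (cell k z)))"
    if z: "z \<in> fresh B k \<inter> {z. bottom k z < T}" for k z
  proof -
    have "z \<in> marks B k" using z by (simp add: fresh_def)
    then have zc: "z \<in> column" and "\<not> k \<le> k0" using M_column marks_empty by blast+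
    then obtain j where k: "k = Suc j" "k0 \<le> j" by (cases k) auto
    have zj: "z \<notin> marks B j" using z by (auto simp: fresh_def k)
    have "bottom j z < T" using z bottom_mono[of j k z] by (simp add: k)
    note gj = good[OF zc this k(2) zj]
    let ?l = "lam * ((K + 1) * 2 powr (real CARD('n) + p))"
    let ?N = "{y :: (real ^ 'n) \<times> real. snd y = bottom j z + height j}"
    have N: "?N \<in> null_sets mu" by (intro null_sets_mu null_sets_time_slice)
    have "emeasure mu (up_rect k z) \<le> emeasure mu (low_rect j z \<union> up_rect j z \<union> ?N)"
      using up_rect_Suc_subset[of j z] N unfolding k by (intro emeasure_mono) auto
    also have "\<dots> = emeasure mu (low_rect j z \<union> up_rect j z)"
      using N by (intro emeasure_Un_null_set) auto
    also have "\<dots> \<le> emeasure mu (low_rect j z) + emeasure mu (up_rect j z)"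
      by (intro emeasure_subadditive) auto
    also have "\<dots> \<le> ennreal K * emeasure mu (up_rect j z) + emeasure mu (up_rect j z)"
      unfolding low_rect_def up_rect_def by (intro add_right_mono doubling) simp
    also have "\<dots> = ennreal (K + 1) * emeasure mu (up_rect j z)"
      using pos by (simp add: distrib_right)
    also have "\<dots> \<le> ennreal (K + 1) * ennreal (lam * ?vol j)"
      by (intro mult_left_mono gj) simp
    also have "\<dots> = ennreal ((K + 1) * (lam * ?vol j))"
      using pos by (intro ennreal_mult'[symmetric]) simp
    also have "(K + 1) * (lam * ?vol j) = ?l * ?vol k"
      by (simp add: k rect_volume_side_Suc[of j] mult_ac)
    finally have up: "emeasure mu (up_rect k z) \<le> ennreal (?l * ?vol k)" .
    have "emeasure (mu_above (\<Lambda> * lam)) (cell k z) = emeasure mu (cell k z \<inter> ?high)"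
      by (simp add: emeasure_mu_above)
    also have "\<dots> \<le> emeasure mu (low_rect k z \<inter> {z. A * ?l < w z})"
    proof (intro emeasure_mono)
      have "A * ?l \<le> \<Lambda> * lam"
        using mult_right_mono[OF \<Lambda>(1), of lam] pos by (simp add: mult_ac)
      then show "cell k z \<inter> ?high \<subseteq> low_rect k z \<inter> {z. A * ?l < w z}"
        using cell_subset_low_rect[of k z] by auto
    qed (simp add: sets.Int)
    also have "\<dots> \<le> ennreal \<beta> * emeasure mu (up_rect k z)"
      unfolding low_rect_def up_rect_def using pos up[unfolded up_rect_def] by (intro high) auto
    also have "\<dots> \<le> ennreal \<beta> * (emeasure mu (time_shift (height k) (cell k z)) + emeasure mu (time_shift (2 * height k) (cell k z)))"
      by (intro mult_left_mono emeasure_up_rect_le null_sets_mu) auto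
    finally show ?thesis .
  qed
  have M_high: "emeasure (mu_above (\<Lambda> * lam)) (\<Union>k. fresh B k \<inter> {z. bottom k z < T}) \<le> 4 * ennreal \<beta> * emeasure mu ?M"
    by (rule fresh_sum_le[OF sat_B])
      (auto intro!: saturated_Int saturated_fresh sat_B saturated_bottom cell_high)
  have D_high: "emeasure mu (column \<inter> {z. snd z < T} \<inter> ?high) \<le> 4 * ennreal \<beta> * emeasure mu ?M"
  proof -
    let ?D = "column \<inter> {z. snd z < T}" and ?F = "\<Union>k. fresh B k \<inter> {z. bottom k z < T}"
    have F_sets: "?F \<in> sets lebesgue"
    proof -
      have "fresh B k \<inter> {z. bottom k z < T} \<in> sets lebesgue" for k
        by (rule sets_saturated[of k]) (intro saturated_Int saturated_fresh sat_B saturated_bottom)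
      then show ?thesis by auto
    qed
    have "?D - ?M \<in> sets lebesgue" by (intro sets.Diff M_sets sets.Int sets_column sets_snd_less)
    moreover have "emeasure lebesgue (?D - ?M) < top"
    proof -
      have "?D - ?M \<subseteq> cube (\<chi> i. a $ i + L / 2) L \<times> {b..<T}" using column_subset by blast
      then have "emeasure lebesgue (?D - ?M) \<le> emeasure lebesgue (cube (\<chi> i. a $ i + L / 2) L \<times> {b..<T})"
        by (intro emeasure_mono sets_Times_borel) auto
      also have "\<dots> < top"
        using L_pos emeasure_bounded_finite[of "{b..<T}"]
        by (subst emeasure_cube_Times) (auto simp: ennreal_mult_less_top)
      finally show ?thesis .
    qed
    moreover have "emeasure mu (cell k z) \<le> ennreal (2 * K * lam) * emeasure lebesgue (cell k z)"
      if z: "z \<in> ?D - ?M" and k: "k0 \<le> k" for z k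
    proof -
      have "bottom k z < T" using z time_bounds(1)[where k = k and z = z] by auto
      then have g: "emeasure mu (up_rect k z) \<le> ennreal (lam * ?vol k)" using good z k by blast
      have "emeasure mu (cell k z) \<le> emeasure mu (low_rect k z)"
        by (intro emeasure_mono cell_subset_low_rect) simp
      also have "\<dots> \<le> ennreal K * emeasure mu (up_rect k z)"
        unfolding low_rect_def up_rect_def by (intro doubling) simp
      also have "\<dots> \<le> ennreal K * ennreal (lam * ?vol k)" by (intro mult_left_mono g) simp
      also have "\<dots> = ennreal (K * lam) * ennreal (?vol k)"
        using pos by (simp add: mult.assoc flip: ennreal_mult')
      also have "\<dots> \<le> ennreal (K * lam) * (2 * emeasure lebesgue (cell k z))"
        by (intro mult_left_mono rect_volume_side_le) simp
      also have "\<dots> = ennreal (2 * K * lam) * emeasure lebesgue (cell k z)"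
        using pos by (simp add: ennreal_mult' mult_ac)
      finally show ?thesis .
    qed
    ultimately have null: "emeasure mu ((?D - ?M) \<inter> ?high) = 0"
      using pos \<Lambda> by (intro mu_superlevel_null[where K = "2 * K * lam" and ?k0.0 = k0]) auto
    have "?D \<inter> ?high \<subseteq> (?F \<inter> ?high) \<union> ((?D - ?M) \<inter> ?high)"
    proof
      fix z assume z: "z \<in> ?D \<inter> ?high"
      show "z \<in> (?F \<inter> ?high) \<union> ((?D - ?M) \<inter> ?high)"
      proof (cases "z \<in> ?M")
        case True
        then obtain k where "z \<in> fresh B k" using UN_fresh[OF sat_B] by blast
        moreover have "bottom k z < T" using z time_bounds(1)[where k = k and z = z] by auto
        ultimately show ?thesis using z by blast
      qed (use z in blast)
    qed
    then have "emeasure mu (?D \<inter> ?high) \<le> emeasure mu ((?F \<inter> ?high) \<union> ((?D - ?M) \<inter> ?high))"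
      using F_sets by (intro emeasure_mono) auto
    also have "\<dots> \<le> emeasure mu (?F \<inter> ?high) + emeasure mu ((?D - ?M) \<inter> ?high)"
      using F_sets by (intro emeasure_subadditive) auto
    also have "\<dots> = emeasure (mu_above (\<Lambda> * lam)) ?F"
      using F_sets by (simp only: null emeasure_mu_above add_0_right)
    finally show ?thesis using M_high by order
  qed
  let ?\<nu> = "mu_above (\<theta> * lam)"
  have J: "emeasure lebesgue (\<Union>k. B k \<inter> fresh B k) \<le> 4 * ennreal (2 / lam) * emeasure ?\<nu> ?M"
  proof (rule fresh_sum_le[OF sat_B])
    fix k z assume z: "z \<in> B k \<inter> fresh B k"
    let ?U = "up_rect k z"
    have v: "0 < ?vol k" by (intro rect_volume_pos) simp
    have "ennreal (lam * ?vol k) \<le> emeasure mu ?U"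
      using z by (auto simp: B_def less_imp_le split: if_splits)
    also have "\<dots> \<le> emeasure ?\<nu> ?U + ennreal (\<theta> * lam) * emeasure lebesgue ?U"
      using pos by (intro mu_le_mu_above) auto
    also have "ennreal (\<theta> * lam) * emeasure lebesgue ?U \<le> ennreal (lam * ?vol k / 2)"
    proof -
      have "ennreal (\<theta> * lam) * emeasure lebesgue ?U = ennreal (\<theta> * lam * ?vol k)"
        unfolding up_rect_def emeasure_rect[OF side_pos] using pos v by (simp add: ennreal_mult)
      also have "\<dots> \<le> ennreal (lam * ?vol k / 2)"
        using mult_right_mono[OF pos(6), of "lam * ?vol k"] pos v by (intro ennreal_leI) simp
      finally show ?thesis .
    qed
    finally have "ennreal (lam * ?vol k / 2) + ennreal (lam * ?vol k / 2) \<le> emeasure ?\<nu> ?U + ennreal (lam * ?vol k / 2)"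
      using pos v by (simp add: add_left_mono flip: ennreal_plus)
    then have half: "ennreal (lam * ?vol k / 2) \<le> emeasure ?\<nu> ?U" by simp
    have "emeasure lebesgue (cell k z) \<le> ennreal (?vol k)" by (rule emeasure_cell_le)
    also have "\<dots> = ennreal (2 / lam) * ennreal (lam * ?vol k / 2)"
      using pos v by (simp flip: ennreal_mult)
    also have "\<dots> \<le> ennreal (2 / lam) * emeasure ?\<nu> ?U" by (intro mult_left_mono half) simp
    also have "\<dots> \<le> ennreal (2 / lam) * (emeasure ?\<nu> (time_shift (height k) (cell k z))
        + emeasure ?\<nu> (time_shift (2 * height k) (cell k z)))"
      by (intro mult_left_mono emeasure_up_rect_le null_sets_mu_above) auto
    finally show "emeasure lebesgue (cell k z) \<le> ennreal (2 / lam) * (emeasure ?\<nu> (time_shift (height k) (cell k z))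
        + emeasure ?\<nu> (time_shift (2 * height k) (cell k z)))" .
  qed (auto intro!: saturated_Int saturated_fresh sat_B)
  have "emeasure mu ?M \<le> emeasure ?\<nu> ?M + ennreal (\<theta> * lam) * emeasure lebesgue ?M"
    using pos by (intro mu_le_mu_above M_sets) auto
  also have "\<dots> \<le> emeasure ?\<nu> ?M + ennreal (\<theta> * lam) * (5 * (4 * ennreal (2 / lam) * emeasure ?\<nu> ?M))"
    by (intro add_left_mono mult_left_mono order_trans[OF emeasure_marks_le[OF sat_B]] J) auto
  also have "ennreal (\<theta> * lam) * (5 * (4 * ennreal (2 / lam) * emeasure ?\<nu> ?M)) = ennreal (40 * \<theta>) * emeasure ?\<nu> ?M"
  proof -
    have "ennreal (\<theta> * lam) * (5 * (4 * ennreal (2 / lam))) = ennreal (\<theta> * lam * (5 * (4 * (2 / lam))))"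
      using pos by (simp flip: ennreal_mult ennreal_numeral)
    also have "\<theta> * lam * (5 * (4 * (2 / lam))) = 40 * \<theta>" using pos by simp
    finally show ?thesis by (metis mult.assoc)
  qed
  also have "emeasure ?\<nu> ?M + ennreal (40 * \<theta>) * emeasure ?\<nu> ?M = ennreal (1 + 40 * \<theta>) * emeasure ?\<nu> ?M"
    using pos by (simp add: distrib_right)
  finally have M_le: "emeasure mu ?M \<le> ennreal (1 + 40 * \<theta>) * emeasure ?\<nu> ?M" .
  have "emeasure mu (column \<inter> {z. snd z < T} \<inter> ?high) \<le> 4 * ennreal \<beta> * (ennreal (1 + 40 * \<theta>) * emeasure ?\<nu> ?M)"
    by (rule order_trans[OF D_high]) (intro mult_left_mono M_le, simp)
  also have "\<dots> = ennreal (4 * \<beta> * (1 + 40 * \<theta>)) * emeasure ?\<nu> ?M"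
  proof -
    have "ennreal (4 * \<beta> * (1 + 40 * \<theta>)) = 4 * ennreal \<beta> * ennreal (1 + 40 * \<theta>)"
      using pos by (subst ennreal_mult) (auto simp: ennreal_mult' simp del: ennreal_plus)
    then show ?thesis by (simp only: mult.assoc)
  qed
  also have "emeasure ?\<nu> ?M \<le> emeasure mu (column \<inter> {z. snd z < T + 5 * height k0} \<inter> {z. \<theta> * lam < w z})"
    using M_column unfolding emeasure_mu_above[OF M_sets]
    by (intro emeasure_mono) (auto intro!: sets.Int)
  finally show ?thesis by (simp add: mult_left_mono)
qed

abbreviation "root_centre \<equiv> (\<chi> i. a $ i + L / 2)"
abbreviation "root_time \<equiv> b + L powr p"

lemma cube_subset_column:
  obtains N where "N \<in> null_sets lebesgue"
    "cube root_centre L \<times> {b..<T} \<subseteq> column \<inter> {z. snd z < T} \<union> N"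
proof -
  let ?N = "\<Union>i. {y :: (real ^ 'n) \<times> real. fst y $ i = a $ i + L}"
  have "?N \<in> null_sets lebesgue"
    by (rule null_sets_UN'[OF countable_finite[OF finite]]) (rule null_sets_space_slice)
  moreover have "cube root_centre L \<times> {b..<T} \<subseteq> column \<inter> {z. snd z < T} \<union> ?N"
  proof
    fix z assume z: "z \<in> cube root_centre L \<times> {b..<T}"
    show "z \<in> column \<inter> {z. snd z < T} \<union> ?N"
    proof (cases "z \<in> ?N")
      case False
      have "space_idx 0 z = (\<lambda>_. 0)"
      proof (rule space_idx_eqI)
        fix i
        have c: "\<bar>fst z $ i - (a $ i + L / 2)\<bar> \<le> L / 2" and n: "fst z $ i \<noteq> a $ i + L"
          using z False by (auto simp: cube_def)
        show "a $ i + real_of_int 0 * side 0 \<le> fst z $ i" using c unfolding abs_le_iff by (simp add: side_def)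
        show "fst z $ i < a $ i + (real_of_int 0 + 1) * side 0"
          using c n unfolding abs_le_iff by (simp add: side_def)
      qed
      then show ?thesis using z by (auto simp: column_def)
    qed simp
  qed
  ultimately show thesis by (rule that)
qed

lemma mu_le_mu_column:
  assumes "A \<subseteq> cube root_centre L \<times> {b..<T}" "X \<in> sets lebesgue"
  shows "emeasure mu (A \<inter> X) \<le> emeasure mu (column \<inter> {z. snd z < T} \<inter> X)"
proof -
  obtain N where N: "N \<in> null_sets lebesgue"
    "cube root_centre L \<times> {b..<T} \<subseteq> column \<inter> {z. snd z < T} \<union> N"
    by (rule cube_subset_column)
  have sets: "column \<inter> {z. snd z < T} \<inter> X \<in> sets mu"
    using assms by (simp add: sets.Int)
  have "emeasure mu (A \<inter> X) \<le> emeasure mu (column \<inter> {z. snd z < T} \<inter> X \<union> N)"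
    by (rule emeasure_mono)
      (use N(2) assms(1) in blast, rule sets.Un[OF sets null_setsD2[OF null_sets_mu[OF N(1)]]])
  also have "\<dots> = emeasure mu (column \<inter> {z. snd z < T} \<inter> X)"
    by (rule emeasure_Un_null_set[OF sets null_sets_mu[OF N(1)]])
  finally show ?thesis .
qed

lemma mu_root_cube_le:
  assumes "X \<subseteq> cube root_centre L \<times> {b..<b + 2 * L powr p}" "X \<in> sets lebesgue"
  shows "emeasure mu X \<le> emeasure mu (rect_lower p root_centre root_time L) + emeasure mu (rect_upper p root_centre root_time L)"
proof -
  let ?N = "{z :: (real ^ 'n) \<times> real. snd z = b} \<union> {z. snd z = root_time}"
  have N: "?N \<in> null_sets mu"
    by (intro null_sets.Un null_sets_mu null_sets_time_slice)
  have "X \<subseteq> (rect_lower p root_centre root_time L \<union> rect_upper p root_centre root_time L) \<union> ?N"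
    using assms(1) by (auto simp: rect_lower_def rect_upper_def)
  then have "emeasure mu X \<le> emeasure mu ((rect_lower p root_centre root_time L \<union> rect_upper p root_centre root_time L) \<union> ?N)"
    using N by (intro emeasure_mono) auto
  also have "\<dots> = emeasure mu (rect_lower p root_centre root_time L \<union> rect_upper p root_centre root_time L)"
    using N by (intro emeasure_Un_null_set) auto
  also have "\<dots> \<le> emeasure mu (rect_lower p root_centre root_time L) + emeasure mu (rect_upper p root_centre root_time L)"
    by (intro emeasure_subadditive) auto
  finally show ?thesis .
qed

lemma up_rect_subset_root:
  assumes z: "z \<in> column" and top: "bottom k z + height k + side k powr p \<le> T"
  shows "up_rect k z \<subseteq> cube root_centre L \<times> {b<..<T}"
proof -
  have "cube (centre k z) (side k) \<subseteq> cube root_centre L"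
  proof (rule cube_mono)
    fix i
    have "space_idx k z i div 2 ^ k = 0"
      using z space_idx_coarse[of 0 k z i] by (simp add: column_def)
    then have "space_idx k z i = space_idx k z i mod 2 ^ k"
      using div_mult_mod_eq[of "space_idx k z i" "2 ^ k"] by simp
    then have s: "0 \<le> space_idx k z i" "space_idx k z i < 2 ^ k"
      using pos_mod_sign[of "2 ^ k" "space_idx k z i"] pos_mod_bound[of "2 ^ k" "space_idx k z i"] by simp_all
    then have "space_idx k z i + 1 \<le> 2 ^ k" by simp
    then have "real_of_int (space_idx k z i + 1) \<le> real_of_int (2 ^ k)" by (simp only: of_int_le_iff)
    then have "real_of_int (space_idx k z i + 1) * side k \<le> real_of_int (2 ^ k) * side k"
      by (intro mult_right_mono) (auto intro: less_imp_le)
    also have "\<dots> = L" by (simp add: side_def)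
    finally have up: "real_of_int (space_idx k z i + 1) * side k \<le> L" .
    have lo: "0 \<le> real_of_int (space_idx k z i) * side k"
      using s by (intro mult_nonneg_nonneg) (auto intro: less_imp_le)
    have "centre k z $ i - root_centre $ i = real_of_int (space_idx k z i) * side k + side k / 2 - L / 2"
      by (simp add: centre_def algebra_simps)
    then show "\<bar>centre k z $ i - root_centre $ i\<bar> \<le> (L - side k) / 2"
      using up lo unfolding abs_le_iff by (simp add: algebra_simps)
  qed
  moreover have "b \<le> bottom k z"
    using z time_idx_nonneg_iff[of k z] by (auto simp: bottom_def column_def)
  ultimately show ?thesis
    using top height_pos[of k] unfolding up_rect_def rect_upper_def by (auto simp del: height_pos)
qed

end

context parabolic_weight
begin

lemma mu_rect_real:
  assumes "0 < L"
  obtains m where "0 \<le> m" "emeasure mu (rect_upper p x t L) = ennreal (m * rect_volume CARD('n) p L)"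
proof
  let ?v = "rect_volume CARD('n) p L" and ?m = "enn2real (emeasure mu (rect_upper p x t L))"
  have v: "0 < ?v" using assms by (rule rect_volume_pos)
  then show "0 \<le> ?m / ?v" by simp
  show "emeasure mu (rect_upper p x t L) = ennreal (?m / ?v * ?v)"
    using v mu_rect_finite(1)[of x t L] by simp
qed

lemma doubling_of_high:
  assumes high: "\<And>x t r l. 0 < r \<Longrightarrow> 0 \<le> l \<Longrightarrow>
      emeasure mu (rect_upper p x t r) \<le> ennreal (l * rect_volume CARD('n) p r) \<Longrightarrow>
      emeasure mu (rect_lower p x t r \<inter> {z. A * l < w z}) \<le> ennreal \<beta> * emeasure mu (rect_upper p x t r)"
    and pos: "0 \<le> A" "0 \<le> \<beta>" and r: "0 < r"
  shows "emeasure mu (rect_lower p x t r) \<le> ennreal (\<beta> + A) * emeasure mu (rect_upper p x t r)"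
proof -
  let ?v = "rect_volume CARD('n) p r" and ?R = "rect_lower p x t r"
  obtain m where m: "0 \<le> m" "emeasure mu (rect_upper p x t r) = ennreal (m * ?v)"
    using mu_rect_real[OF r] .
  have v: "0 < ?v" using r by (rule rect_volume_pos)
  have "emeasure mu ?R \<le> emeasure (mu_above (A * m)) ?R + ennreal (A * m) * emeasure lebesgue ?R"
    using pos m by (intro mu_le_mu_above) auto
  also have "emeasure (mu_above (A * m)) ?R \<le> ennreal \<beta> * emeasure mu (rect_upper p x t r)"
    by (subst emeasure_mu_above) (simp, rule high[OF r m(1)], simp add: m(2))
  also have "ennreal (A * m) * emeasure lebesgue ?R = ennreal A * emeasure mu (rect_upper p x t r)"
    unfolding emeasure_rect[OF r] m(2) using pos m v by (simp add: mult.assoc flip: ennreal_mult)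
  finally show ?thesis using pos by (simp add: distrib_right)
qed

lemma decay_of_high:
  assumes high: "\<And>x t r l. 0 < r \<Longrightarrow> 0 \<le> l \<Longrightarrow>
      emeasure mu (rect_upper p x t r) \<le> ennreal (l * rect_volume CARD('n) p r) \<Longrightarrow>
      emeasure mu (rect_lower p x t r \<inter> {z. A * l < w z}) \<le> ennreal \<beta> * emeasure mu (rect_upper p x t r)"
    and pos: "0 \<le> A" "0 \<le> \<beta>" and small: "4 * \<beta> < 1"
  obtains c B \<kappa> D where "0 < c" "1 < B" "0 < \<kappa>" "\<kappa> < 1" "0 \<le> D"
    "\<And>x t L m i. 0 < L \<Longrightarrow> 0 < m \<Longrightarrow>
      emeasure mu (rect_upper p x t L) = ennreal (m * rect_volume CARD('n) p L) \<Longrightarrow>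
      emeasure mu (rect_lower p x t L \<inter> {z. c * m * B ^ i < w z}) \<le> ennreal (D * \<kappa> ^ i) * emeasure mu (rect_upper p x t L)"
proof -
  define K where "K = \<beta> + A"
  define \<theta> where "\<theta> = (1 - 4 * \<beta>) / 80"
  define \<kappa> where "\<kappa> = (1 + 4 * \<beta>) / 2"
  define N where "N = real CARD('n) + p"
  define \<Lambda> where "\<Lambda> = max (A * ((K + 1) * 2 powr N)) (max (2 * K + 1) (2 powr N))"
  define B where "B = \<Lambda> / \<theta>"
  define c where "c = \<theta> * (K + 1) * 2 powr (N * 4)"
  have K: "0 \<le> K" using pos by (simp add: K_def)
  have \<theta>: "0 < \<theta>" "\<theta> \<le> 1 / 2" using small pos by (auto simp: \<theta>_def)
  have \<kappa>: "0 < \<kappa>" "\<kappa> < 1" using small pos by (auto simp: \<kappa>_def)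
  have step_const: "4 * \<beta> * (1 + 40 * \<theta>) \<le> \<kappa>"
  proof -
    have "(4 * \<beta>) * (40 * \<theta>) \<le> 1 * (40 * \<theta>)" using small \<theta> by (intro mult_right_mono) auto
    then have "4 * \<beta> * (1 + 40 * \<theta>) \<le> 4 * \<beta> + 40 * \<theta>"
      by (simp only: distrib_left mult_1_right mult_1_left add_left_mono)
    also have "\<dots> = \<kappa>" by (simp add: \<kappa>_def \<theta>_def field_simps)
    finally show ?thesis .
  qed
  have N: "1 \<le> N" using p_ge_1 by (simp add: N_def)
  have "2 powr 1 \<le> 2 powr N" using N by (intro powr_mono) auto
  then have \<Lambda>: "2 powr N \<le> \<Lambda>" "2 \<le> \<Lambda>" "2 * K < \<Lambda>" "A * ((K + 1) * 2 powr N) \<le> \<Lambda>" by (auto simp: \<Lambda>_def)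
  have "\<Lambda> * \<theta> \<le> \<Lambda> * 1" using \<theta> \<Lambda> by (intro mult_left_mono) auto
  then have B: "\<Lambda> \<le> B" using \<theta> by (simp add: B_def field_simps)
  have c: "0 < c" using \<theta> K by (simp add: c_def)
  have main: "emeasure mu (rect_lower p x t L \<inter> {z. c * m * B ^ i < w z}) \<le> ennreal ((K + 1) * \<kappa> ^ i) * emeasure mu (rect_upper p x t L)"
    if L: "0 < L" and m: "0 < m" "emeasure mu (rect_upper p x t L) = ennreal (m * rect_volume CARD('n) p L)" for x t L m i
  proof -
    interpret g: parabolic_grid p w "\<chi> i. x $ i - L / 2" "t - L powr p" L
      by unfold_locales (rule L)
    have root: "(\<chi> i. (\<chi> i. x $ i - L / 2) $ i + L / 2) = x" "t - L powr p + L powr p = t"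
      "t - L powr p + 2 * L powr p = t + L powr p"
      by (simp_all add: vec_eq_iff)
    let ?R = "rect_upper p x t L"
    have total: "emeasure mu X \<le> ennreal (K + 1) * emeasure mu ?R"
      if "X \<subseteq> cube x L \<times> {t - L powr p..<t + L powr p}" "X \<in> sets lebesgue" for X
    proof -
      have "emeasure mu X \<le> emeasure mu (rect_lower p x t L) + emeasure mu ?R"
        by (rule g.mu_root_cube_le[of X, unfolded root]) (use that in auto)
      also have "\<dots> \<le> ennreal K * emeasure mu ?R + emeasure mu ?R"
        unfolding K_def using pos high L by (intro add_right_mono doubling_of_high) auto
      finally show ?thesis using K by (simp add: distrib_right)
    qed
    have claim: "emeasure mu (g.column \<inter> {z. snd z < T} \<inter> {z. c * m * B ^ i < w z})
        \<le> ennreal ((K + 1) * \<kappa> ^ i) * emeasure mu ?R"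
      if "T \<le> t + L powr p * (1 - 10 / 16 * (1 - 1 / 2 ^ i))" for T i
      using that
    proof (induction i arbitrary: T)
      case 0
      have "g.column \<inter> {z. snd z < T} \<inter> {z. c * m * B ^ 0 < w z} \<subseteq> cube x L \<times> {t - L powr p..<t + L powr p}"
        using g.column_subset[of T] 0 unfolding root by fastforce
      from total[OF this] show ?case by simp
    next
      case (Suc i)
      define k0 where "k0 = i + 4"
      define lam where "lam = (K + 1) * 2 powr (N * 4) * m * B ^ i"
      have lam: "\<Lambda> * lam = c * m * B ^ Suc i" "\<theta> * lam = c * m * B ^ i"
        using \<theta> by (simp_all add: lam_def c_def B_def)
      have "0 < lam" using K m B \<Lambda> by (simp add: lam_def)
      have T': "T + 5 * g.height k0 \<le> t + L powr p * (1 - 10 / 16 * (1 - 1 / 2 ^ i))"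
      proof -
        define v :: real where "v = 1 / 2 ^ i"
        have "T + 5 * g.height k0 \<le> T + 5 * (L powr p * (v / 16))"
          using g.height_le[of k0] by (simp add: k0_def power_add v_def)
        also have "\<dots> \<le> t + L powr p * (1 - 10 / 16 * (1 - v))"
        proof -
          have "T \<le> t + L powr p * (1 - 10 / 16 * (1 - v / 2))" using Suc.prems by (simp add: v_def mult.commute)
          moreover have "q * (1 - 10 / 16 * (1 - v / 2)) = 3 / 8 * q + 5 / 16 * (q * v)"
            "q * (1 - 10 / 16 * (1 - v)) = 3 / 8 * q + 5 / 8 * (q * v)" "5 * (q * (v / 16)) = 5 / 16 * (q * v)" for q
            by (simp_all add: field_simps)
          ultimately show ?thesis by simp
        qed
        finally show ?thesis by (simp add: v_def)
      qed
      have "1 / 2 ^ i \<le> (1 :: real)" by simp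
      then have "1 - 10 / 16 * (1 - 1 / 2 ^ i) \<le> (1 :: real)" by argo
      then have "L powr p * (1 - 10 / 16 * (1 - 1 / 2 ^ i)) \<le> L powr p * 1"
        by (rule mult_left_mono) simp
      with T' have T'': "T + 5 * g.height k0 \<le> t + L powr p" by linarith
      have "emeasure mu (g.column \<inter> {z. snd z < T} \<inter> {z. \<Lambda> * lam < w z})
        \<le> ennreal (4 * \<beta> * (1 + 40 * \<theta>)) * emeasure mu (g.column \<inter> {z. snd z < T + 5 * g.height k0} \<inter> {z. \<theta> * lam < w z})"
      proof (rule g.good_lambda_step[OF high])
        show "emeasure mu (rect_lower p x t r) \<le> ennreal K * emeasure mu (rect_upper p x t r)" if "0 < r" for x t r
          unfolding K_def by (rule doubling_of_high[OF high]) (use pos that in auto)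
        show "emeasure mu (g.up_rect k0 z) \<le> ennreal (lam * rect_volume CARD('n) p (g.side k0))"
          if z: "z \<in> g.column" "g.bottom k0 z < T" for z
        proof -
          have "g.bottom k0 z + g.height k0 + g.side k0 powr p \<le> T + 5 * g.height k0"
            using z(2) g.side_powr_le[of k0] g.height_nonneg[of k0] by linarith
          also note T''
          finally have "g.up_rect k0 z \<subseteq> cube x L \<times> {t - L powr p<..<t + L powr p}"
            using g.up_rect_subset_root[OF z(1)] unfolding root by blast
          then have "g.up_rect k0 z \<subseteq> cube x L \<times> {t - L powr p..<t + L powr p}" by fastforce
          from total[OF this] have "emeasure mu (g.up_rect k0 z) \<le> ennreal (K + 1) * ennreal (m * rect_volume CARD('n) p L)"
            using m by simp
          also have "\<dots> = ennreal ((K + 1) * m * rect_volume CARD('n) p L)"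
            using K m rect_volume_pos[OF L, of "CARD('n)" p] by (simp add: mult.assoc del: ennreal_plus flip: ennreal_mult)
          also have "\<dots> \<le> ennreal (lam * rect_volume CARD('n) p (g.side k0))"
          proof (rule ennreal_leI)
            have "rect_volume CARD('n) p L = 2 powr (N * real k0) * rect_volume CARD('n) p (g.side k0)"
              unfolding N_def g.side_def by (rule rect_volume_half_power[OF L])
            moreover have "2 powr (N * real k0) \<le> 2 powr (N * 4) * B ^ i"
            proof -
              have "2 powr (N * real k0) = 2 powr (N * 4) * (2 powr N) ^ i"
                by (simp add: k0_def algebra_simps powr_add powr_powr flip: powr_realpow)
              also have "\<dots> \<le> 2 powr (N * 4) * B ^ i"
                using B \<Lambda> by (intro mult_left_mono power_mono) auto
              finally show ?thesis .
            qed
            ultimately have "(K + 1) * m * rect_volume CARD('n) p L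
                \<le> (K + 1) * m * (2 powr (N * 4) * B ^ i * rect_volume CARD('n) p (g.side k0))"
              using K m rect_volume_pos[OF g.side_pos[of k0], of "CARD('n)" p]
              by (intro mult_left_mono) (auto intro: mult_right_mono)
            then show "(K + 1) * m * rect_volume CARD('n) p L \<le> lam * rect_volume CARD('n) p (g.side k0)"
              by (simp add: lam_def mult_ac)
          qed
          finally show ?thesis .
        qed
      qed (use K \<theta> pos \<Lambda> \<open>0 < lam\<close> in \<open>auto simp: N_def\<close>)
      also have "\<dots> \<le> ennreal \<kappa> * (ennreal ((K + 1) * \<kappa> ^ i) * emeasure mu ?R)"
        unfolding lam(2) by (intro mult_mono Suc.IH T' ennreal_leI step_const) auto
      also have "\<dots> = ennreal ((K + 1) * \<kappa> ^ Suc i) * emeasure mu ?R"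
      proof -
        have "ennreal ((K + 1) * \<kappa> ^ Suc i) = ennreal (\<kappa> * ((K + 1) * \<kappa> ^ i))" by (simp add: mult_ac)
        also have "\<dots> = ennreal \<kappa> * ennreal ((K + 1) * \<kappa> ^ i)" using \<kappa> K by (intro ennreal_mult) auto
        finally show ?thesis by (simp only: mult.assoc)
      qed
      finally show ?case unfolding lam(1) .
    qed
    have "t \<le> t + L powr p * (1 - 10 / 16 * (1 - 1 / 2 ^ i))"
      by (intro add_increasing2 mult_nonneg_nonneg) (auto simp: field_simps)
    note claim[OF this]
    moreover have "emeasure mu (rect_lower p x t L \<inter> {z. c * m * B ^ i < w z})
        \<le> emeasure mu (g.column \<inter> {z. snd z < t} \<inter> {z. c * m * B ^ i < w z})"
    proof (rule g.mu_le_mu_column[unfolded root])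
      show "rect_lower p x t L \<subseteq> cube x L \<times> {t - L powr p..<t}" by (auto simp: rect_lower_def)
    qed simp
    ultimately show ?thesis by order
  qed
  show ?thesis
    by (rule that[of c B \<kappa> "K + 1"]) (use c B \<Lambda> \<kappa> K main in auto)
qed

end

section \<open>Reverse Hoelder inequality from decay of the distribution function\<close>

lemma ennreal_powr_le:
  assumes "s \<le> ennreal r" "0 \<le> r" "0 < a"
  shows "ennreal_powr s a \<le> ennreal (r powr a)"
proof -
  have s: "s \<noteq> \<infinity>" using assms(1) by (auto simp: top_unique)
  have "enn2real s \<le> r" using assms by (simp add: enn2real_leI)
  then have "enn2real s powr a \<le> r powr a" using assms by (intro powr_mono2) auto
  with s show ?thesis by (simp add: ennreal_powr_def ennreal_leI)
qed

context parabolic_weight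
begin

lemma average_upper_eq:
  assumes "0 < L" "0 \<le> m" "emeasure mu (rect_upper p x t L) = ennreal (m * rect_volume CARD('n) p L)"
  shows "average w (rect_upper p x t L) = ennreal m"
  using assms rect_volume_pos[OF assms(1), of "CARD('n)" p]
  by (simp add: average_def mass_eq emeasure_rect divide_ennreal)

lemma geometric_level:
  assumes "0 < y" "1 < (B :: real)" "y < s"
  shows "\<exists>i. y * B ^ i < s \<and> s \<le> y * B ^ Suc i"
proof -
  obtain n where n: "s / y < B ^ n" using real_arch_pow[OF assms(2)] by blast
  define j where "j = (LEAST n. s \<le> y * B ^ n)"
  have "s \<le> y * B ^ n" using n assms by (simp add: field_simps)
  then have j: "s \<le> y * B ^ j" unfolding j_def by (rule LeastI)
  have "j \<noteq> 0" using j assms by (intro notI) simp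
  then obtain i where i: "j = Suc i" using not0_implies_Suc by blast
  have "\<not> s \<le> y * B ^ i" using i unfolding j_def by (intro not_less_Least) simp
  then show ?thesis using j i by (intro exI[of _ i]) simp
qed

lemma RH_plus_of_high:
  assumes high: "\<And>x t r l. 0 < r \<Longrightarrow> 0 \<le> l \<Longrightarrow>
      emeasure mu (rect_upper p x t r) \<le> ennreal (l * rect_volume CARD('n) p r) \<Longrightarrow>
      emeasure mu (rect_lower p x t r \<inter> {z. A * l < w z}) \<le> ennreal \<beta> * emeasure mu (rect_upper p x t r)"
    and pos: "0 \<le> A" "0 \<le> \<beta>" and small: "4 * \<beta> < 1"
  shows "\<exists>q>1. RH_plus p q w"
proof -
  obtain c B \<kappa> D where c: "0 < c" and B: "1 < B" and \<kappa>: "0 < \<kappa>" "\<kappa> < 1" and D: "0 \<le> D"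
    and decay: "\<And>x t L m i. 0 < L \<Longrightarrow> 0 < m \<Longrightarrow>
      emeasure mu (rect_upper p x t L) = ennreal (m * rect_volume CARD('n) p L) \<Longrightarrow>
      emeasure mu (rect_lower p x t L \<inter> {z. c * m * B ^ i < w z}) \<le> ennreal (D * \<kappa> ^ i) * emeasure mu (rect_upper p x t L)"
    by (rule decay_of_high[OF high pos small]) blast+
  define \<epsilon> where "\<epsilon> = - ln \<kappa> / (2 * ln B)"
  define \<rho> where "\<rho> = B powr \<epsilon> * \<kappa>"
  define q where "q = 1 + \<epsilon>"
  define C0 where "C0 = c powr \<epsilon> * (\<beta> + A) + c powr \<epsilon> * B powr \<epsilon> * D / (1 - \<rho>)"
  have \<epsilon>: "0 < \<epsilon>" using B \<kappa> unfolding \<epsilon>_def by (intro divide_pos_pos) auto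
  have "B powr \<epsilon> = \<kappa> powr (- 1 / 2)" using B \<kappa> by (simp add: powr_def \<epsilon>_def)
  then have "\<rho> = \<kappa> powr (- 1 / 2) * \<kappa> powr 1" using \<kappa> by (simp add: \<rho>_def)
  also have "\<dots> = \<kappa> powr (- 1 / 2 + 1)" by (rule powr_add[symmetric])
  also have "\<dots> = \<kappa> powr (1 / 2)" by simp
  also have "\<dots> < \<kappa> powr 0" using \<kappa> by (intro powr_less_mono') auto
  finally have \<rho>: "\<rho> < 1" "0 < \<rho>" using \<kappa> B by (simp_all add: \<rho>_def)
  have q: "1 < q" using \<epsilon> by (simp add: q_def)
  have C0: "0 \<le> C0" using pos D \<rho> by (simp add: C0_def)
  have int_le: "(\<integral>\<^sup>+z\<in>rect_lower p x t L. ennreal (w z powr q) \<partial>lebesgue)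
      \<le> ennreal (C0 * m powr q * rect_volume CARD('n) p L)"
    if L: "0 < L" and m: "0 \<le> m" "emeasure mu (rect_upper p x t L) = ennreal (m * rect_volume CARD('n) p L)" for x t L m
  proof -
    let ?R = "rect_lower p x t L" and ?U = "rect_upper p x t L" and ?v = "rect_volume CARD('n) p L"
    have v: "0 < ?v" using L by (rule rect_volume_pos)
    have dbl: "emeasure mu ?R \<le> ennreal (\<beta> + A) * emeasure mu ?U"
      by (rule doubling_of_high[OF high pos L])
    let ?A = "\<lambda>i. {z. c * m * B ^ i < w z}"
    let ?k = "\<lambda>i. ennreal ((c * m * B ^ Suc i) powr \<epsilon>)"
    have RA: "?R \<inter> ?A i \<in> sets lebesgue" for i by (intro sets.Int) auto
    show ?thesis
    proof (cases "m = 0")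
      case True
      then have "emeasure mu ?R = 0" using dbl m by simp
      then have "AE z in lebesgue. ennreal (w z) * indicator ?R z = 0"
        by (simp add: emeasure_mu nn_integral_0_iff_AE)
      then have "(\<integral>\<^sup>+z\<in>?R. ennreal (w z powr q) \<partial>lebesgue) = (\<integral>\<^sup>+z. 0 \<partial>(lebesgue :: ((real ^ 'n) \<times> real) measure))"
      proof (intro nn_integral_cong_AE, eventually_elim)
        case (elim z)
        then have "w z = 0 \<or> z \<notin> ?R" using w_nonneg[of z] by (auto simp: ennreal_eq_0_iff split: split_indicator_asm)
        then show ?case by auto
      qed
      then show ?thesis by simp
    next
      case False
      then have m_pos: "0 < m" using m by simp
      have "(\<integral>\<^sup>+z\<in>?R. ennreal (w z powr q) \<partial>lebesgue)
        \<le> (\<integral>\<^sup>+z. ennreal (w z) * (ennreal ((c * m) powr \<epsilon>) * indicator ?R z + (\<Sum>i. ?k i * indicator (?R \<inter> ?A i) z)) \<partial>lebesgue)"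
      proof (rule nn_integral_mono)
        fix z
        have "ennreal (w z powr q) \<le> ennreal (w z) * (ennreal ((c * m) powr \<epsilon>) + (\<Sum>i. ?k i * indicator (?R \<inter> ?A i) z))"
          if z: "z \<in> ?R"
        proof (cases "w z \<le> c * m")
          case True
          then have "w z powr \<epsilon> \<le> (c * m) powr \<epsilon>" using \<epsilon> by (intro powr_mono2) auto
          then have "ennreal (w z powr \<epsilon>) \<le> ennreal ((c * m) powr \<epsilon>) + (\<Sum>i. ?k i * indicator (?R \<inter> ?A i) z)"
            by (intro add_increasing2 ennreal_leI) auto
          then have "ennreal (w z) * ennreal (w z powr \<epsilon>) \<le> ennreal (w z) * (ennreal ((c * m) powr \<epsilon>) + (\<Sum>i. ?k i * indicator (?R \<inter> ?A i) z))"
            by (intro mult_left_mono) auto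
          then show ?thesis by (simp add: q_def powr_add flip: ennreal_mult)
        next
          case False
          then obtain i where i: "c * m * B ^ i < w z" "w z \<le> c * m * B ^ Suc i"
            using geometric_level[of "c * m" B "w z"] c m_pos B by auto
          have "w z powr \<epsilon> \<le> (c * m * B ^ Suc i) powr \<epsilon>" using i(2) \<epsilon> by (intro powr_mono2) auto
          then have "ennreal (w z powr \<epsilon>) \<le> ?k i * indicator (?R \<inter> ?A i) z"
            using i(1) z by (simp add: ennreal_leI)
          also have "\<dots> = (\<Sum>j\<in>{i}. ?k j * indicator (?R \<inter> ?A j) z)"
            by (subst sum.insert) (simp_all only: finite.emptyI empty_iff not_False_eq_True sum.empty add_0_right)
          also have "\<dots> \<le> (\<Sum>j. ?k j * indicator (?R \<inter> ?A j) z)" by (intro sum_le_suminf) auto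
          also have "\<dots> \<le> ennreal ((c * m) powr \<epsilon>) + (\<Sum>j. ?k j * indicator (?R \<inter> ?A j) z)" by simp
          finally have "ennreal (w z) * ennreal (w z powr \<epsilon>) \<le> ennreal (w z) * (ennreal ((c * m) powr \<epsilon>) + (\<Sum>i. ?k i * indicator (?R \<inter> ?A i) z))"
            by (intro mult_left_mono) auto
          then show ?thesis by (simp add: q_def powr_add flip: ennreal_mult)
        qed
        then show "ennreal (w z powr q) * indicator ?R z
          \<le> ennreal (w z) * (ennreal ((c * m) powr \<epsilon>) * indicator ?R z + (\<Sum>i. ?k i * indicator (?R \<inter> ?A i) z))"
          by (cases "z \<in> ?R") simp_all
      qed
      also have "\<dots> = (\<integral>\<^sup>+z. (ennreal ((c * m) powr \<epsilon>) * indicator ?R z + (\<Sum>i. ?k i * indicator (?R \<inter> ?A i) z)) \<partial>mu)"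
        unfolding mu_def using RA by (intro nn_integral_density[symmetric]) measurable
      also have "\<dots> = ennreal ((c * m) powr \<epsilon>) * emeasure mu ?R + (\<Sum>i. ?k i * emeasure mu (?R \<inter> ?A i))"
        using RA by (subst nn_integral_add) (auto simp: nn_integral_suminf nn_integral_cmult_indicator)
      also have "\<dots> \<le> ennreal ((c * m) powr \<epsilon>) * (ennreal (\<beta> + A) * emeasure mu ?U)
          + (\<Sum>i. ?k i * (ennreal (D * \<kappa> ^ i) * emeasure mu ?U))"
        by (intro add_mono mult_left_mono dbl suminf_le decay[OF L m_pos m(2)]) auto
      also have "(\<Sum>i. ?k i * (ennreal (D * \<kappa> ^ i) * emeasure mu ?U))
          = (\<Sum>i. ennreal ((c * m) powr \<epsilon> * B powr \<epsilon> * D * \<rho> ^ i) * emeasure mu ?U)"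
      proof (rule suminf_cong)
        fix i
        have "(c * m * B ^ Suc i) powr \<epsilon> = (c * m) powr \<epsilon> * B powr \<epsilon> * (B powr \<epsilon>) ^ i"
          using c m_pos B by (simp add: powr_mult powr_power powr_powr mult_ac flip: powr_realpow)
        then have "(c * m * B ^ Suc i) powr \<epsilon> * (D * \<kappa> ^ i) = (c * m) powr \<epsilon> * B powr \<epsilon> * D * \<rho> ^ i"
          by (simp add: \<rho>_def power_mult_distrib mult_ac)
        moreover have "?k i * ennreal (D * \<kappa> ^ i) = ennreal ((c * m * B ^ Suc i) powr \<epsilon> * (D * \<kappa> ^ i))"
          using D \<kappa> by (intro ennreal_mult[symmetric]) auto
        ultimately show "?k i * (ennreal (D * \<kappa> ^ i) * emeasure mu ?U)
            = ennreal ((c * m) powr \<epsilon> * B powr \<epsilon> * D * \<rho> ^ i) * emeasure mu ?U"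
          by (simp only: mult.assoc[symmetric])
      qed
      also have "\<dots> = ennreal ((c * m) powr \<epsilon> * B powr \<epsilon> * D * (1 / (1 - \<rho>))) * emeasure mu ?U"
      proof -
        have "(\<lambda>i. \<rho> ^ i) sums (1 / (1 - \<rho>))" using \<rho> by (intro geometric_sums) auto
        then have "(\<lambda>i. (c * m) powr \<epsilon> * B powr \<epsilon> * D * \<rho> ^ i) sums ((c * m) powr \<epsilon> * B powr \<epsilon> * D * (1 / (1 - \<rho>)))"
          by (rule sums_mult)
        then have "(\<Sum>i. ennreal ((c * m) powr \<epsilon> * B powr \<epsilon> * D * \<rho> ^ i))
            = ennreal ((c * m) powr \<epsilon> * B powr \<epsilon> * D * (1 / (1 - \<rho>)))"
          using D \<rho> by (intro suminf_ennreal_eq) auto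
        then show ?thesis by (simp only: ennreal_suminf_multc)
      qed
      also have "ennreal ((c * m) powr \<epsilon>) * (ennreal (\<beta> + A) * emeasure mu ?U)
          + ennreal ((c * m) powr \<epsilon> * B powr \<epsilon> * D * (1 / (1 - \<rho>))) * emeasure mu ?U
          = ennreal (C0 * m powr \<epsilon>) * emeasure mu ?U"
      proof -
        have "C0 * m powr \<epsilon> = (c * m) powr \<epsilon> * (\<beta> + A) + (c * m) powr \<epsilon> * B powr \<epsilon> * D * (1 / (1 - \<rho>))"
          using c m_pos by (simp add: C0_def powr_mult algebra_simps)
        moreover have "ennreal \<dots> = ennreal ((c * m) powr \<epsilon>) * ennreal (\<beta> + A)
            + ennreal ((c * m) powr \<epsilon> * B powr \<epsilon> * D * (1 / (1 - \<rho>)))"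
          using pos D \<rho> by (subst ennreal_plus) (auto simp: ennreal_mult simp del: ennreal_plus)
        ultimately show ?thesis by (simp only: distrib_right mult.assoc)
      qed
      also have "\<dots> = ennreal (C0 * m powr q * ?v)"
        using C0 m_pos v unfolding m(2) by (subst ennreal_mult[symmetric]) (auto simp: q_def powr_add mult_ac)
      finally show ?thesis .
    qed
  qed
  have "RH_plus p q w"
    unfolding RH_plus_def
  proof (intro exI[of _ "C0 powr (1 / q)"] conjI allI impI)
    fix x :: "real ^ 'n" and t L :: real assume L: "0 < L"
    obtain m where m: "0 \<le> m" "emeasure mu (rect_upper p x t L) = ennreal (m * rect_volume CARD('n) p L)"
      using mu_rect_real[OF L] .
    let ?v = "rect_volume CARD('n) p L"
    have v: "0 < ?v" using L by (rule rect_volume_pos)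
    have "average (\<lambda>z. w z powr q) (rect_lower p x t L) \<le> ennreal (C0 * m powr q * ?v) / ennreal ?v"
      unfolding average_def mass_def emeasure_rect[OF L] by (intro divide_right_mono_ennreal int_le L m)
    also have "\<dots> = ennreal (C0 * m powr q)" using v C0 by (simp add: divide_ennreal)
    finally have "ennreal_powr (average (\<lambda>z. w z powr q) (rect_lower p x t L)) (1 / q)
        \<le> ennreal ((C0 * m powr q) powr (1 / q))"
      using C0 q by (intro ennreal_powr_le) auto
    also have "(C0 * m powr q) powr (1 / q) = C0 powr (1 / q) * m"
      using C0 m q by (simp add: powr_mult powr_powr)
    also have "ennreal (C0 powr (1 / q) * m) = ennreal (C0 powr (1 / q)) * average w (rect_upper p x t L)"
      unfolding average_upper_eq[OF L m] using m by (simp add: ennreal_mult)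
    finally show "ennreal_powr (average (\<lambda>z. w z powr q) (rect_lower p x t L)) (1 / q)
        \<le> ennreal (C0 powr (1 / q)) * average w (rect_upper p x t L)" .
  qed simp
  with q show ?thesis by blast
qed

lemma small_threshold:
  assumes "0 < \<beta>" "\<beta> < 1 / 2 powr (real CARD('n) + p)"
  shows "4 * \<beta> < 1"
proof -
  have "1 \<le> real CARD('n)" by (simp add: Suc_leI)
  then have "2 powr 2 \<le> 2 powr (real CARD('n) + p)" using p_ge_1 by (intro powr_mono) linarith+
  then have "1 / 2 powr (real CARD('n) + p) \<le> 1 / 4" by (intro divide_left_mono) auto
  with assms show ?thesis by linarith
qed

lemma sets_above_average [measurable, simp]: "{z. s < ennreal (\<alpha> * w z)} \<in> sets lebesgue"
proof -
  have "{z \<in> space lebesgue. s < ennreal (\<alpha> * w z)} \<in> sets lebesgue" by measurable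
  then show ?thesis by simp
qed

lemma RH_plus_of_superlevel:
  assumes \<alpha>: "0 < \<alpha>" and \<beta>: "0 < \<beta>" "\<beta> < 1 / 2 powr (real CARD('n) + p)"
    and le: "\<forall>x t L. 0 < L \<longrightarrow>
      (let E = rect_lower p x t L \<inter> {z. ennreal (\<alpha> * w z) > average w (rect_upper p x t L)} in
      mass w E < ennreal \<beta> * mass w (rect_upper p x t L)
        \<or> mass w E = 0 \<and> mass w (rect_upper p x t L) = 0)"
  shows "\<exists>q>1. RH_plus p q w"
proof (rule RH_plus_of_high)
  fix x :: "real ^ 'n" and t r l :: real
  assume r: "0 < r" and l: "0 \<le> l" "emeasure mu (rect_upper p x t r) \<le> ennreal (l * rect_volume CARD('n) p r)"
  let ?U = "rect_upper p x t r" and ?v = "rect_volume CARD('n) p r"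
  let ?E = "rect_lower p x t r \<inter> {z. ennreal (\<alpha> * w z) > average w ?U}"
  have v: "0 < ?v" using r by (rule rect_volume_pos)
  have "average w ?U \<le> ennreal (l * ?v) / ennreal ?v"
    unfolding average_def emeasure_rect[OF r] using l by (intro divide_right_mono_ennreal) (simp add: mass_eq)
  also have "\<dots> = ennreal l" using l v by (simp add: divide_ennreal)
  finally have avg: "average w ?U \<le> ennreal l" .
  have E: "?E \<in> sets lebesgue" by (intro sets.Int) auto
  have "emeasure mu (rect_lower p x t r \<inter> {z. 1 / \<alpha> * l < w z}) \<le> emeasure mu ?E"
  proof (intro emeasure_mono)
    have "average w ?U < ennreal (\<alpha> * w z)" if "1 / \<alpha> * l < w z" for z
    proof -
      have "l < \<alpha> * w z" using that \<alpha> by (simp add: field_simps)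
      then have "ennreal l < ennreal (\<alpha> * w z)" using l by (intro ennreal_lessI) auto
      then show ?thesis using avg by order
    qed
    then show "rect_lower p x t r \<inter> {z. 1 / \<alpha> * l < w z} \<subseteq> ?E" by blast
  qed (use E in simp)
  also have "\<dots> = mass w ?E" using E by (simp add: mass_eq)
  also have "\<dots> \<le> ennreal \<beta> * mass w ?U"
    using le[rule_format, OF r, of x t] by (auto simp: Let_def)
  finally show "emeasure mu (rect_lower p x t r \<inter> {z. 1 / \<alpha> * l < w z}) \<le> ennreal \<beta> * emeasure mu ?U"
    by (simp add: mass_eq)
qed (use \<alpha> \<beta> small_threshold in auto)

end

section \<open>Consequences of the reverse Hoelder inequality\<close>

lemma ennreal_powr_le_imp:
  assumes "ennreal_powr s (1 / q) \<le> ennreal r" "0 \<le> r" "0 < q"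
  shows "s \<le> ennreal (r powr q)"
proof (cases s)
  case (real u)
  then have "ennreal (u powr (1 / q)) \<le> ennreal r" using assms by (simp add: ennreal_powr_def)
  then have "u powr (1 / q) \<le> r" using assms by simp
  then have "(u powr (1 / q)) powr q \<le> r powr q" using assms by (intro powr_mono2) auto
  then show ?thesis using real assms by (simp add: powr_powr ennreal_leI)
next
  case top
  then show ?thesis using assms by (simp add: ennreal_powr_def top_unique)
qed

lemma ennreal_divide_mult_cancel: "0 < v \<Longrightarrow> x / ennreal v * ennreal v = x"
  by (simp add: ennreal_divide_times divide_ennreal)

lemma ln_le_powr_divide: "0 < x \<Longrightarrow> 0 < r \<Longrightarrow> ln x \<le> x powr r / (r :: real)"
proof -
  assume "0 < x" "0 < r"
  then have "r * ln x \<le> x powr r - 1" using ln_le_minus_one[of "x powr r"] by (simp add: ln_powr)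
  then show ?thesis using \<open>0 < r\<close> by (simp add: field_simps)
qed

context parabolic_weight
begin

lemma AE_zero_of_mu_zero:
  assumes "A \<in> sets lebesgue" "emeasure mu A = 0"
  shows "AE z in lebesgue. z \<in> A \<longrightarrow> w z = 0"
proof -
  have "AE z in lebesgue. ennreal (w z) * indicator A z = 0"
    using assms by (simp add: emeasure_mu nn_integral_0_iff_AE)
  then show ?thesis
    by eventually_elim (use w_nonneg in \<open>auto simp: ennreal_eq_0_iff intro: antisym split: split_indicator_asm\<close>)
qed

lemma nn_integral_zero_of_mu_zero:
  assumes A: "A \<in> sets lebesgue" "emeasure mu A = 0" and f: "\<And>z. w z = 0 \<Longrightarrow> f z = 0"
  shows "(\<integral>\<^sup>+z\<in>A. f z \<partial>lebesgue) = 0"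
proof -
  have "(\<integral>\<^sup>+z\<in>A. f z \<partial>lebesgue) = (\<integral>\<^sup>+z. 0 \<partial>(lebesgue :: ((real ^ 'n) \<times> real) measure))"
  proof (intro nn_integral_cong_AE)
    show "AE z in lebesgue. f z * indicator A z = 0"
      using AE_zero_of_mu_zero[OF A] by eventually_elim (auto simp: f split: split_indicator)
  qed
  then show ?thesis by simp
qed

lemma RH_plus_integral:
  assumes RH: "RH_plus p q w" and q: "1 < q"
  obtains C where "0 \<le> C"
    "\<And>x t L m. 0 < L \<Longrightarrow> 0 \<le> m \<Longrightarrow> emeasure mu (rect_upper p x t L) = ennreal (m * rect_volume CARD('n) p L) \<Longrightarrow>
      (\<integral>\<^sup>+z\<in>rect_lower p x t L. ennreal (w z powr q) \<partial>lebesgue) \<le> ennreal (C * m powr q * rect_volume CARD('n) p L)"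
proof -
  obtain C where C: "0 \<le> C" "\<And>x t L. L > 0 \<Longrightarrow>
     ennreal_powr (average (\<lambda>z. w z powr q) (rect_lower p x t L)) (1 / q)
       \<le> ennreal C * average w (rect_upper p x t L)"
    using RH unfolding RH_plus_def by blast
  show thesis
  proof (rule that[of "C powr q"])
    fix x :: "real ^ 'n" and t L m :: real
    assume L: "0 < L" and m: "0 \<le> m" "emeasure mu (rect_upper p x t L) = ennreal (m * rect_volume CARD('n) p L)"
    let ?v = "rect_volume CARD('n) p L" and ?I = "\<integral>\<^sup>+z\<in>rect_lower p x t L. ennreal (w z powr q) \<partial>lebesgue"
    have v: "0 < ?v" using L by (rule rect_volume_pos)
    have "ennreal_powr (?I / ennreal ?v) (1 / q) \<le> ennreal (C * m)"
      using C(2)[OF L, of x t] m C(1) unfolding average_upper_eq[OF L m]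
      by (simp add: average_def mass_def emeasure_rect[OF L] ennreal_mult)
    then have "?I / ennreal ?v \<le> ennreal ((C * m) powr q)"
      using C m q by (intro ennreal_powr_le_imp) auto
    then have "?I / ennreal ?v * ennreal ?v \<le> ennreal ((C * m) powr q) * ennreal ?v"
      by (intro mult_right_mono) auto
    moreover have "?I / ennreal ?v * ennreal ?v = ?I"
      by (rule ennreal_divide_mult_cancel[OF v])
    ultimately show "?I \<le> ennreal (C powr q * m powr q * ?v)"
      using C m v by (simp add: powr_mult ennreal_mult)
  qed simp
qed

lemma mu_lower_zero_of_RH:
  assumes RH: "RH_plus p q w" and q: "1 < q" and L: "0 < L" and zero: "emeasure mu (rect_upper p x t L) = 0"
  shows "emeasure mu (rect_lower p x t L) = 0"
proof -
  obtain C where C: "0 \<le> C"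
    "\<And>x t L m. 0 < L \<Longrightarrow> 0 \<le> m \<Longrightarrow> emeasure mu (rect_upper p x t L) = ennreal (m * rect_volume CARD('n) p L) \<Longrightarrow>
      (\<integral>\<^sup>+z\<in>rect_lower p x t L. ennreal (w z powr q) \<partial>lebesgue) \<le> ennreal (C * m powr q * rect_volume CARD('n) p L)"
    by (rule RH_plus_integral[OF RH q]) blast
  have "(\<integral>\<^sup>+z\<in>rect_lower p x t L. ennreal (w z powr q) \<partial>lebesgue) = 0"
    using C(2)[OF L, of 0 x t] zero by simp
  then have "AE z in lebesgue. ennreal (w z powr q) * indicator (rect_lower p x t L) z = 0"
    by (simp add: nn_integral_0_iff_AE)
  then have "AE z in lebesgue. ennreal (w z) * indicator (rect_lower p x t L) z = 0"
    by eventually_elim (auto split: split_indicator_asm)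
  then show ?thesis by (simp add: emeasure_mu nn_integral_0_iff_AE)
qed

lemma power_decay_of_RH:
  assumes RH: "RH_plus p q w" and q: "1 < q"
  shows "\<exists>C>0. \<exists>\<delta>>0. \<forall>x t L E. L > 0 \<longrightarrow> E \<in> sets lebesgue \<longrightarrow> E \<subseteq> rect_lower p x t L \<longrightarrow>
      mass w E / mass w (rect_upper p x t L)
        \<le> ennreal (C * (measure lebesgue E / measure lebesgue (rect_lower p x t L)) powr \<delta>)"
proof -
  obtain C where C: "0 \<le> C"
    "\<And>x t L m. 0 < L \<Longrightarrow> 0 \<le> m \<Longrightarrow> emeasure mu (rect_upper p x t L) = ennreal (m * rect_volume CARD('n) p L) \<Longrightarrow>
      (\<integral>\<^sup>+z\<in>rect_lower p x t L. ennreal (w z powr q) \<partial>lebesgue) \<le> ennreal (C * m powr q * rect_volume CARD('n) p L)"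
    by (rule RH_plus_integral[OF RH q]) blast
  define \<delta> where "\<delta> = 1 - 1 / q"
  have \<delta>: "0 < \<delta>" using q by (simp add: \<delta>_def)
  have "mass w E / mass w (rect_upper p x t L)
        \<le> ennreal ((1 + C) * (measure lebesgue E / measure lebesgue (rect_lower p x t L)) powr \<delta>)"
    if L: "L > 0" and E: "E \<in> sets lebesgue" "E \<subseteq> rect_lower p x t L" for x t L E
  proof -
    let ?v = "rect_volume CARD('n) p L" and ?U = "rect_upper p x t L"
    have v: "0 < ?v" using L by (rule rect_volume_pos)
    obtain m where m: "0 \<le> m" "emeasure mu ?U = ennreal (m * ?v)"
      using mu_rect_real[OF L] .
    have E_fin: "emeasure lebesgue E \<le> ennreal ?v"
      using emeasure_mono[OF E(2), of lebesgue] by (simp add: emeasure_rect[OF L])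
    then have E_real: "emeasure lebesgue E = ennreal (measure lebesgue E)"
      by (intro emeasure_eq_ennreal_measure) (auto simp: top_unique)
    define e where "e = measure lebesgue E / ?v"
    have e: "0 \<le> e" "measure lebesgue E = e * ?v" using v by (simp_all add: e_def)
    show ?thesis
    proof (cases "m = 0 \<or> e = 0")
      case True
      have "emeasure mu E = 0"
      proof (cases "e = 0")
        case True
        then have "E \<in> null_sets lebesgue" using E E_real e by (simp add: null_sets_def)
        then show ?thesis using null_sets_mu by blast
      next
        case False
        then have "emeasure mu (rect_lower p x t L) = 0"
          using \<open>m = 0 \<or> e = 0\<close> m by (intro mu_lower_zero_of_RH[OF RH q L]) auto
        then show ?thesis using emeasure_mono[OF E(2), of mu] by simp
      qed
      then show ?thesis using E by (simp add: mass_eq)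
    next
      case False
      then have m_pos: "0 < m" and e_pos: "0 < e" using m e by auto
      define s where "s = m * e powr (- 1 / q)"
      have s: "0 < s" using m_pos e_pos by (simp add: s_def)
      have "emeasure mu E \<le> (\<integral>\<^sup>+z. ennreal s * indicator E z
          + ennreal (s powr (1 - q)) * (ennreal (w z powr q) * indicator (rect_lower p x t L) z) \<partial>lebesgue)"
        unfolding emeasure_mu[OF E(1)]
      proof (rule nn_integral_mono)
        fix z
        have "w z \<le> s + s powr (1 - q) * w z powr q"
        proof (cases "w z \<le> s")
          case False
          then have "1 \<le> (w z / s) powr (q - 1)" using s q by (intro ge_one_powr_ge_zero) auto
          then have "w z * 1 \<le> w z * (w z / s) powr (q - 1)" by (intro mult_left_mono) auto
          also have "\<dots> = s powr (1 - q) * w z powr q"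
            using False s by (simp add: powr_divide powr_diff powr_minus field_simps)
          finally show ?thesis using s by simp
        qed (simp add: add_increasing2)
        then have "ennreal (w z) \<le> ennreal (s + s powr (1 - q) * w z powr q)" by (rule ennreal_leI)
        also have "\<dots> = ennreal s + ennreal (s powr (1 - q)) * ennreal (w z powr q)"
          using s by (simp add: ennreal_mult)
        finally show "ennreal (w z) * indicator E z \<le> ennreal s * indicator E z
          + ennreal (s powr (1 - q)) * (ennreal (w z powr q) * indicator (rect_lower p x t L) z)"
          using E by (auto split: split_indicator)
      qed
      also have "\<dots> = ennreal s * emeasure lebesgue E
          + ennreal (s powr (1 - q)) * (\<integral>\<^sup>+z\<in>rect_lower p x t L. ennreal (w z powr q) \<partial>lebesgue)"
        using E by (subst nn_integral_add) (auto simp: nn_integral_cmult_indicator nn_integral_cmult)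
      also have "\<dots> \<le> ennreal s * emeasure lebesgue E + ennreal (s powr (1 - q)) * ennreal (C * m powr q * ?v)"
        by (intro add_left_mono mult_left_mono C L m) auto
      also have "\<dots> = ennreal (s * (e * ?v) + s powr (1 - q) * (C * m powr q * ?v))"
        unfolding E_real e(2) using s e v C by (subst ennreal_plus) (auto simp: ennreal_mult)
      also have "s * (e * ?v) + s powr (1 - q) * (C * m powr q * ?v) = (1 + C) * e powr \<delta> * (m * ?v)"
      proof -
        have "s * e = m * e powr \<delta>"
          using e_pos by (simp add: s_def \<delta>_def powr_diff powr_minus_divide powr_one)
        moreover have "s powr (1 - q) * m powr q = m * e powr \<delta>"
        proof -
          have "s powr (1 - q) = m powr (1 - q) * (e powr (- 1 / q)) powr (1 - q)"
            unfolding s_def by (rule powr_mult)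
          also have "(e powr (- 1 / q)) powr (1 - q) = e powr \<delta>"
          proof -
            have "- 1 / q * (1 - q) = \<delta>" using q by (simp add: \<delta>_def field_simps)
            then show ?thesis by (simp only: powr_powr)
          qed
          also have "m powr (1 - q) = m / m powr q" using m_pos by (simp add: powr_diff)
          finally show ?thesis using m_pos by simp
        qed
        ultimately have "s * e * ?v + s powr (1 - q) * m powr q * (C * ?v) = (1 + C) * e powr \<delta> * (m * ?v)"
          by (simp add: algebra_simps)
        then show ?thesis by (simp add: mult_ac)
      qed
      finally have "mass w E \<le> ennreal ((1 + C) * e powr \<delta>) * mass w ?U"
        using E C e v m_pos by (simp add: mass_eq m(2) ennreal_mult del: ennreal_plus)
      then have "mass w E / mass w ?U \<le> ennreal ((1 + C) * e powr \<delta>)"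
        using m_pos v m(2) by (intro divide_le_posI_ennreal) (simp_all add: mass_eq mult.commute)
      then show ?thesis using measure_rect_lower[OF L, of p x t] by (simp add: e_def)
    qed
  qed
  then show ?thesis using C \<delta> by (intro exI[of _ "1 + C"] conjI exI[of _ \<delta>]) auto
qed

lemma absolute_continuity_of_power_decay:
  assumes decay: "\<forall>x t L E. L > 0 \<longrightarrow> E \<in> sets lebesgue \<longrightarrow> E \<subseteq> rect_lower p x t L \<longrightarrow>
      mass w E / mass w (rect_upper p x t L)
        \<le> ennreal (C * (measure lebesgue E / measure lebesgue (rect_lower p x t L)) powr \<delta>)"
    and pos: "0 < C" "0 < \<delta>" "0 < \<beta>"
  shows "\<exists>\<alpha>. 0 < \<alpha> \<and> \<alpha> < 1 \<and> (\<forall>x t L E. L > 0 \<longrightarrow>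
      E \<in> sets lebesgue \<longrightarrow> E \<subseteq> rect_lower p x t L \<longrightarrow>
      emeasure lebesgue E < ennreal \<alpha> * emeasure lebesgue (rect_lower p x t L) \<longrightarrow>
      mass w E < ennreal \<beta> * mass w (rect_upper p x t L)
        \<or> mass w E = 0 \<and> mass w (rect_upper p x t L) = 0)"
proof -
  define \<alpha> where "\<alpha> = min (1 / 2) ((\<beta> / (2 * C)) powr (1 / \<delta>))"
  have \<alpha>: "0 < \<alpha>" "\<alpha> < 1" using pos by (auto simp: \<alpha>_def min_less_iff_disj)
  have "\<alpha> powr \<delta> \<le> ((\<beta> / (2 * C)) powr (1 / \<delta>)) powr \<delta>"
    using \<alpha> pos by (intro powr_mono2) (auto simp: \<alpha>_def)
  also have "\<dots> = \<beta> / (2 * C)" using pos by (simp add: powr_powr)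
  finally have \<alpha>_\<delta>: "C * \<alpha> powr \<delta> \<le> \<beta> / 2" using pos by (simp add: field_simps)
  have "mass w E < ennreal \<beta> * mass w (rect_upper p x t L) \<or> mass w E = 0 \<and> mass w (rect_upper p x t L) = 0"
    if L: "L > 0" and E: "E \<in> sets lebesgue" "E \<subseteq> rect_lower p x t L"
      and small: "emeasure lebesgue E < ennreal \<alpha> * emeasure lebesgue (rect_lower p x t L)" for x t L E
  proof -
    let ?v = "rect_volume CARD('n) p L" and ?U = "rect_upper p x t L"
    have v: "0 < ?v" using L by (rule rect_volume_pos)
    have "emeasure lebesgue E < ennreal (\<alpha> * ?v)"
      using small \<alpha> v by (simp add: emeasure_rect[OF L] ennreal_mult)
    then have "measure lebesgue E \<le> \<alpha> * ?v"
      unfolding measure_def using \<alpha> v by (intro enn2real_leI) auto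
    then have "measure lebesgue E / ?v \<le> \<alpha>" using v by (simp add: field_simps)
    then have "(measure lebesgue E / ?v) powr \<delta> \<le> \<alpha> powr \<delta>" using pos v by (intro powr_mono2) auto
    then have "C * (measure lebesgue E / ?v) powr \<delta> \<le> C * \<alpha> powr \<delta>" using pos by simp
    also note \<alpha>_\<delta>
    finally have "C * (measure lebesgue E / ?v) powr \<delta> \<le> \<beta> / 2" .
    then have ratio: "mass w E / mass w ?U \<le> ennreal (\<beta> / 2)"
      by (rule order_trans[OF decay[rule_format, OF L E, unfolded measure_rect_lower[OF L]] ennreal_leI])
    obtain m where m: "0 \<le> m" "emeasure mu ?U = ennreal (m * ?v)"
      using mu_rect_real[OF L] .
    show ?thesis
    proof (cases "m = 0")
      case True
      then have U: "mass w ?U = 0" using m by (simp add: mass_eq)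
      then have "mass w E = 0" using ratio by (cases "mass w E = 0") (auto simp: top_unique)
      then show ?thesis using U by simp
    next
      case False
      have U: "mass w ?U = ennreal (m * ?v)" using m by (simp add: mass_eq)
      have mv: "0 < m * ?v" using False m v by simp
      have "mass w E = mass w E / mass w ?U * mass w ?U"
        unfolding U by (rule ennreal_divide_mult_cancel[OF mv, symmetric])
      also have "\<dots> \<le> ennreal (\<beta> / 2) * mass w ?U" by (intro mult_right_mono ratio) simp
      also have "\<dots> < ennreal \<beta> * mass w ?U"
        unfolding U using mv pos by (simp add: ennreal_less_iff flip: ennreal_mult)
      finally show ?thesis ..
    qed
  qed
  then show ?thesis using \<alpha> by blast
qed

lemma doubling_of_absolute_continuity:
  assumes \<alpha>: "0 < \<alpha>" and \<beta>: "0 \<le> \<beta>"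
    and le: "\<And>x t L E. 0 < L \<Longrightarrow> E \<in> sets lebesgue \<Longrightarrow> E \<subseteq> rect_lower p x t L \<Longrightarrow>
      emeasure lebesgue E < ennreal \<alpha> * emeasure lebesgue (rect_lower p x t L) \<Longrightarrow>
      emeasure mu E \<le> ennreal \<beta> * emeasure mu (rect_upper p x t L)"
  obtains K where "0 \<le> K" "\<And>x t L. 0 < L \<Longrightarrow> emeasure mu (rect_lower p x t L) \<le> ennreal K * emeasure mu (rect_upper p x t L)"
proof -
  obtain n where n: "1 / \<alpha> < real n" using reals_Archimedean2 by blast
  have n_pos: "0 < real n" using n \<alpha> by (meson divide_pos_pos less_trans zero_less_one)
  have "emeasure mu (rect_lower p x t L) \<le> ennreal (real n * \<beta>) * emeasure mu (rect_upper p x t L)" if L: "0 < L" for x t L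
  proof -
    let ?v = "rect_volume CARD('n) p L" and ?h = "L powr p / real n"
    have v: "0 < ?v" using L by (rule rect_volume_pos)
    have h: "0 < ?h" using L n_pos by simp
    define S where "S i = rect_lower p x t L \<inter> (cube x L \<times> {t - L powr p + real i * ?h..<t - L powr p + (real i + 1) * ?h})" for i
    have S: "S i \<in> sets lebesgue" for i unfolding S_def by (intro sets.Int sets_Times_borel) auto
    have "rect_lower p x t L \<subseteq> (\<Union>i<n. S i)"
    proof
      fix z assume z: "z \<in> rect_lower p x t L"
      define i where "i = nat \<lfloor>(snd z - (t - L powr p)) / ?h\<rfloor>"
      have s: "0 < snd z - (t - L powr p)" "snd z - (t - L powr p) < L powr p"
        using z by (auto simp: rect_lower_def)
      then have q: "0 \<le> (snd z - (t - L powr p)) / ?h" using h by simp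
      have "(snd z - (t - L powr p)) / ?h < L powr p / ?h" using s h by (intro divide_strict_right_mono)
      also have "L powr p / ?h = real n" using L n_pos by simp
      finally have "(snd z - (t - L powr p)) / ?h < real n" .
      then have "i < n" using q unfolding i_def by linarith
      have i: "real i = \<lfloor>(snd z - (t - L powr p)) / ?h\<rfloor>" using q by (simp add: i_def)
      have "real i * ?h \<le> snd z - (t - L powr p)" "snd z - (t - L powr p) < (real i + 1) * ?h"
        unfolding i using floor_divide_lower[OF h] floor_divide_upper[OF h] by auto
      then have "z \<in> S i" using z by (auto simp: S_def rect_lower_def mem_Times_iff)
      then show "z \<in> (\<Union>i<n. S i)" using \<open>i < n\<close> by blast
    qed
    then have "emeasure mu (rect_lower p x t L) \<le> emeasure mu (\<Union>i<n. S i)"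
      using S by (intro emeasure_mono sets.finite_UN) auto
    also have "\<dots> \<le> (\<Sum>i<n. emeasure mu (S i))"
      using S by (intro emeasure_subadditive_finite) auto
    also have "\<dots> \<le> (\<Sum>i<n. ennreal \<beta> * emeasure mu (rect_upper p x t L))"
    proof (intro sum_mono le L S)
      fix i
      show "S i \<subseteq> rect_lower p x t L" by (simp add: S_def)
      have "emeasure lebesgue (S i) \<le> emeasure lebesgue (cube x L \<times> {t - L powr p + real i * ?h..<t - L powr p + (real i + 1) * ?h})"
        unfolding S_def by (intro emeasure_mono sets_Times_borel) auto
      also have "\<dots> = ennreal (L ^ CARD('n)) * ennreal ?h"
      proof -
        have "emeasure lborel {s..<s + ?h} = ennreal ?h" for s using h by (subst emeasure_lborel_Ico) auto
        from this[of "t - L powr p + real i * ?h"] show ?thesis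
          using L by (subst emeasure_cube_Times) (simp_all only: distrib_right mult_1_left add.assoc less_imp_le atLeastLessThan_borel)
      qed
      also have "\<dots> = ennreal (?v / real n)"
        using L n_pos by (simp add: rect_volume_def flip: ennreal_mult)
      also have "\<dots> < ennreal (\<alpha> * ?v)"
        using n \<alpha> n_pos v by (intro ennreal_lessI) (auto simp: field_simps)
      finally show "emeasure lebesgue (S i) < ennreal \<alpha> * emeasure lebesgue (rect_lower p x t L)"
        using \<alpha> v by (simp add: emeasure_rect[OF L] ennreal_mult)
    qed
    also have "\<dots> = ennreal (real n * \<beta>) * emeasure mu (rect_upper p x t L)"
      using \<beta> by (simp add: ennreal_mult mult.assoc ennreal_of_nat_eq_real_of_nat)
    finally show ?thesis .
  qed
  then show thesis using \<beta> by (intro that[of "real n * \<beta>"]) auto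
qed

lemma superlevel_of_absolute_continuity:
  assumes \<alpha>: "0 < \<alpha>" "\<alpha> < 1" and \<beta>: "0 < \<beta>"
    and le: "\<forall>x t L E. 0 < L \<longrightarrow> E \<in> sets lebesgue \<longrightarrow> E \<subseteq> rect_lower p x t L \<longrightarrow>
      emeasure lebesgue E < ennreal \<alpha> * emeasure lebesgue (rect_lower p x t L) \<longrightarrow>
      mass w E < ennreal \<beta> * mass w (rect_upper p x t L)
        \<or> mass w E = 0 \<and> mass w (rect_upper p x t L) = 0"
  shows "\<exists>\<alpha>'. 0 < \<alpha>' \<and> \<alpha>' < 1 \<and> (\<forall>x t L. L > 0 \<longrightarrow>
      (let E = rect_lower p x t L \<inter> {z. ennreal (\<alpha>' * w z) > average w (rect_upper p x t L)} in
      mass w E < ennreal \<beta> * mass w (rect_upper p x t L)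
        \<or> mass w E = 0 \<and> mass w (rect_upper p x t L) = 0))"
proof -
  have le': "emeasure mu E \<le> ennreal \<beta> * emeasure mu (rect_upper p x t L)"
    if "0 < L" "E \<in> sets lebesgue" "E \<subseteq> rect_lower p x t L"
      "emeasure lebesgue E < ennreal \<alpha> * emeasure lebesgue (rect_lower p x t L)" for x t L E
    using le[rule_format, OF that] that by (auto simp: mass_eq)
  obtain K where K: "0 \<le> K"
    "\<And>x t L. 0 < L \<Longrightarrow> emeasure mu (rect_lower p x t L) \<le> ennreal K * emeasure mu (rect_upper p x t L)"
    by (rule doubling_of_absolute_continuity[OF \<alpha>(1) less_imp_le[OF \<beta>] le']) blast+
  define \<alpha>' where "\<alpha>' = \<alpha> / (2 * (K + 1))"
  have \<alpha>'_pos: "0 < \<alpha>'" using \<alpha> K by (simp add: \<alpha>'_def)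
  have "0 < K * \<alpha> + \<alpha> * 2" using \<alpha> K(1) by (intro add_nonneg_pos) auto
  then have \<alpha>'_K: "\<alpha>' * K < \<alpha>" using \<alpha> K(1) by (simp add: \<alpha>'_def field_simps)
  have \<alpha>'_less: "\<alpha>' < 1" using \<alpha> K(1) by (simp add: \<alpha>'_def field_simps)
  have "mass w E < ennreal \<beta> * mass w (rect_upper p x t L)
        \<or> mass w E = 0 \<and> mass w (rect_upper p x t L) = 0"
    if L: "L > 0" and E_def: "E = rect_lower p x t L \<inter> {z. ennreal (\<alpha>' * w z) > average w (rect_upper p x t L)}" for x t L E
  proof -
    let ?v = "rect_volume CARD('n) p L" and ?U = "rect_upper p x t L"
    have v: "0 < ?v" using L by (rule rect_volume_pos)
    obtain m where m: "0 \<le> m" "emeasure mu ?U = ennreal (m * ?v)"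
      using mu_rect_real[OF L] .
    have E: "E \<in> sets lebesgue" "E \<subseteq> rect_lower p x t L" unfolding E_def by (auto intro: sets.Int)
    have mu_E: "emeasure mu E \<le> ennreal K * emeasure mu ?U"
      using emeasure_mono[OF E(2), of mu] K(2)[OF L, of x t] by simp
    show ?thesis
    proof (cases "m = 0")
      case True
      then have "emeasure mu ?U = 0" using m by simp
      then show ?thesis using mu_E E by (simp add: mass_eq)
    next
      case False
      then have m_pos: "0 < m" using m by simp
      have "ennreal (m / \<alpha>') * emeasure lebesgue E \<le> emeasure mu E"
      proof (rule mu_Chebyshev_ge)
        fix z assume "z \<in> E"
        then have "ennreal m < ennreal (\<alpha>' * w z)" unfolding E_def by (simp add: average_upper_eq[OF L m])
        then have "m < \<alpha>' * w z" using m by (simp add: ennreal_less_iff)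
        then show "m / \<alpha>' \<le> w z" using \<alpha>'_pos by (simp add: field_simps)
      qed (use E m \<alpha>'_pos in auto)
      also note mu_E
      finally have "ennreal (\<alpha>' / m) * (ennreal (m / \<alpha>') * emeasure lebesgue E) \<le> ennreal (\<alpha>' / m) * (ennreal K * emeasure mu ?U)"
        by (intro mult_left_mono) auto
      moreover have "ennreal (\<alpha>' / m) * ennreal (m / \<alpha>') = 1"
        using m_pos \<alpha>'_pos by (simp flip: ennreal_mult)
      moreover have "ennreal (\<alpha>' / m) * (ennreal K * emeasure mu ?U) = ennreal (\<alpha>' * K * ?v)"
        using m_pos \<alpha>'_pos K v unfolding m(2) by (simp flip: ennreal_mult)
      ultimately have "emeasure lebesgue E \<le> ennreal (\<alpha>' * K * ?v)" by (simp flip: mult.assoc)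
      also have "\<dots> < ennreal (\<alpha> * ?v)" using \<alpha>'_K v \<alpha> K \<alpha>'_pos by (intro ennreal_lessI) auto
      finally have "emeasure lebesgue E < ennreal \<alpha> * emeasure lebesgue (rect_lower p x t L)"
        using \<alpha> v by (simp add: emeasure_rect[OF L] ennreal_mult)
      from le[rule_format, OF L E this] show ?thesis .
    qed
  qed
  then show ?thesis using \<alpha>'_pos \<alpha>'_less unfolding Let_def by blast
qed

lemma LlogL_of_RH:
  assumes RH: "RH_plus p q w" and q: "1 < q"
  shows "\<exists>C\<ge>0. \<forall>x t L. L > 0 \<longrightarrow>
      (\<integral>\<^sup>+z\<in>rect_lower p x t L. ennreal (w z) * log_plus (ennreal (w z) / average w (rect_upper p x t L)) \<partial>lebesgue)
        \<le> ennreal C * mass w (rect_upper p x t L)"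
proof -
  obtain C where C: "0 \<le> C"
    "\<And>x t L m. 0 < L \<Longrightarrow> 0 \<le> m \<Longrightarrow> emeasure mu (rect_upper p x t L) = ennreal (m * rect_volume CARD('n) p L) \<Longrightarrow>
      (\<integral>\<^sup>+z\<in>rect_lower p x t L. ennreal (w z powr q) \<partial>lebesgue) \<le> ennreal (C * m powr q * rect_volume CARD('n) p L)"
    by (rule RH_plus_integral[OF RH q]) blast
  have "(\<integral>\<^sup>+z\<in>rect_lower p x t L. ennreal (w z) * log_plus (ennreal (w z) / average w (rect_upper p x t L)) \<partial>lebesgue)
        \<le> ennreal (C / (q - 1)) * mass w (rect_upper p x t L)" (is "?I \<le> _") if L: "L > 0" for x t L
  proof -
    let ?v = "rect_volume CARD('n) p L" and ?U = "rect_upper p x t L"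
    have v: "0 < ?v" using L by (rule rect_volume_pos)
    obtain m where m: "0 \<le> m" "emeasure mu ?U = ennreal (m * ?v)"
      using mu_rect_real[OF L] .
    show ?thesis
    proof (cases "m = 0")
      case True
      then have "emeasure mu (rect_lower p x t L) = 0"
        using m by (intro mu_lower_zero_of_RH[OF RH q L]) auto
      then have "?I = 0" by (intro nn_integral_zero_of_mu_zero) auto
      then show ?thesis by simp
    next
      case False
      then have m_pos: "0 < m" using m by simp
      have "?I \<le> (\<integral>\<^sup>+z. ennreal (m powr (1 - q) / (q - 1)) * (ennreal (w z powr q) * indicator (rect_lower p x t L) z) \<partial>lebesgue)"
      proof (rule nn_integral_mono)
        fix z
        have "w z * max (ln (w z / m)) 0 \<le> m powr (1 - q) / (q - 1) * w z powr q"
        proof (cases "w z = 0")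
          case False
          then have w: "0 < w z" using w_nonneg[of z] by linarith
          have "max (ln (w z / m)) 0 \<le> (w z / m) powr (q - 1) / (q - 1)"
            using w m_pos q ln_le_powr_divide[of "w z / m" "q - 1"] by simp
          then have "w z * max (ln (w z / m)) 0 \<le> w z * ((w z / m) powr (q - 1) / (q - 1))"
            by (intro mult_left_mono) auto
          also have "\<dots> = m powr (1 - q) / (q - 1) * w z powr q"
            using w m_pos by (simp add: powr_divide powr_diff)
          finally show ?thesis .
        qed simp
        moreover have "ennreal (w z) * log_plus (ennreal (w z) / average w ?U) = ennreal (w z * max (ln (w z / m)) 0)"
          using m_pos unfolding average_upper_eq[OF L m] by (simp add: log_plus_def divide_ennreal ennreal_mult)
        ultimately have "ennreal (w z) * log_plus (ennreal (w z) / average w ?U)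
            \<le> ennreal (m powr (1 - q) / (q - 1)) * ennreal (w z powr q)"
          using q by (simp add: ennreal_leI flip: ennreal_mult)
        then show "ennreal (w z) * log_plus (ennreal (w z) / average w ?U) * indicator (rect_lower p x t L) z
          \<le> ennreal (m powr (1 - q) / (q - 1)) * (ennreal (w z powr q) * indicator (rect_lower p x t L) z)"
          by (auto split: split_indicator)
      qed
      also have "\<dots> = ennreal (m powr (1 - q) / (q - 1)) * (\<integral>\<^sup>+z\<in>rect_lower p x t L. ennreal (w z powr q) \<partial>lebesgue)"
        by (intro nn_integral_cmult) auto
      also have "\<dots> \<le> ennreal (m powr (1 - q) / (q - 1)) * ennreal (C * m powr q * ?v)"
        by (intro mult_left_mono C L m) auto
      also have "\<dots> = ennreal (m powr (1 - q) / (q - 1) * (C * m powr q * ?v))"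
        using q C v by (intro ennreal_mult[symmetric]) auto
      also have "m powr (1 - q) / (q - 1) * (C * m powr q * ?v) = C / (q - 1) * (m * ?v)"
        using m_pos by (simp add: powr_diff)
      also have "ennreal (C / (q - 1) * (m * ?v)) = ennreal (C / (q - 1)) * mass w ?U"
        unfolding mass_eq[OF sets_rect(1)] m(2) using C q m v by (intro ennreal_mult) auto
      finally show ?thesis .
    qed
  qed
  then show ?thesis using C q by (intro exI[of _ "C / (q - 1)"]) auto
qed

end

section \<open>Weak type bounds for the maximal function\<close>

lemma finite_Vitali_selection:
  fixes s :: "'i \<Rightarrow> real"
  assumes "finite I" and refl: "\<And>i. conf i i" and sym: "\<And>i j. conf i j \<Longrightarrow> conf j i"
  shows "\<exists>J\<subseteq>I. (\<forall>i\<in>J. \<forall>j\<in>J. i \<noteq> j \<longrightarrow> \<not> conf i j) \<and> (\<forall>i\<in>I. \<exists>j\<in>J. conf i j \<and> s i \<le> s j)"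
  using assms(1)
proof (induction I rule: finite_psubset_induct)
  case (psubset I)
  show ?case
  proof (cases "I = {}")
    case False
    obtain i0 where i0: "i0 \<in> I" "\<And>i. i \<in> I \<Longrightarrow> s i \<le> s i0"
      using Max_in[of "s ` I"] Max_ge[of "s ` I"] psubset.hyps False by fastforce
    let ?I = "{i \<in> I. \<not> conf i i0}"
    have "?I \<subset> I" using i0 refl by blast
    then obtain J where J: "J \<subseteq> ?I" "\<forall>i\<in>J. \<forall>j\<in>J. i \<noteq> j \<longrightarrow> \<not> conf i j"
      "\<forall>i\<in>?I. \<exists>j\<in>J. conf i j \<and> s i \<le> s j"
      using psubset.IH[of ?I] by blast
    show ?thesis
    proof (intro exI[of _ "insert i0 J"] conjI ballI impI)
      show "insert i0 J \<subseteq> I" using J(1) i0 by blast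
      show "\<not> conf i j" if "i \<in> insert i0 J" "j \<in> insert i0 J" "i \<noteq> j" for i j
        using that J(1,2) sym by blast
      show "\<exists>j\<in>insert i0 J. conf i j \<and> s i \<le> s j" if "i \<in> I" for i
        using that J(3) i0 by blast
    qed
  qed simp
qed

lemma suminf_indicator_powers_le:
  fixes s :: real
  shows "(\<Sum>k. indicator {k. 2 ^ k < s} k :: ennreal) \<le> ennreal (1 + max (ln s) 0 / ln 2)"
proof -
  define N where "N = (if s \<le> 1 then 0 else nat \<lceil>log 2 s\<rceil>)"
  have "k < N" if k: "2 ^ k < s" for k
  proof -
    have "(1 :: real) \<le> 2 ^ k" by simp
    then have s: "1 < s" using k by linarith
    have "log 2 (2 ^ k) < log 2 s" using k s by (subst log_less_cancel_iff) auto
    then have "real k < log 2 s" by (simp add: log_nat_power)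
    then show ?thesis using s by (simp add: N_def) linarith
  qed
  then have "(\<Sum>k. indicator {k. 2 ^ k < s} k :: ennreal) = (\<Sum>k<N. indicator {k. 2 ^ k < s} k)"
    by (intro suminf_finite) (auto simp: indicator_def)
  also have "\<dots> \<le> (\<Sum>k<N. 1)" by (intro sum_mono) (simp add: indicator_def)
  also have "\<dots> = ennreal (real N)" by (simp add: ennreal_of_nat_eq_real_of_nat)
  also have "\<dots> \<le> ennreal (1 + max (ln s) 0 / ln 2)"
  proof (rule ennreal_leI)
    show "real N \<le> 1 + max (ln s) 0 / ln 2"
    proof (cases "s \<le> 1")
      case False
      then have "0 < log 2 s" by simp
      then have "real (nat \<lceil>log 2 s\<rceil>) \<le> 1 + log 2 s" by linarith
      then show ?thesis using False by (simp add: N_def log_def)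
    qed (simp add: N_def)
  qed
  finally show ?thesis .
qed

lemma log_plus_measurable [measurable]: "log_plus \<in> borel_measurable borel"
  unfolding log_plus_def[abs_def] by measurable

context parabolic_weight
begin

lemma average_restricted:
  assumes "X \<in> sets lebesgue"
  shows "average (\<lambda>y. \<bar>w y * indicator X y\<bar>) (rect_upper p x t L)
    = emeasure mu (rect_upper p x t L \<inter> X) / emeasure lebesgue (rect_upper p x t L)"
proof -
  have "mass (\<lambda>y. \<bar>w y * indicator X y\<bar>) (rect_upper p x t L) = (\<integral>\<^sup>+z\<in>rect_upper p x t L \<inter> X. ennreal (w z) \<partial>lebesgue)"
    unfolding mass_def by (intro nn_integral_cong) (auto split: split_indicator)
  then show ?thesis using assms by (simp add: average_def emeasure_mu sets.Int)
qed

lemma less_average_iff: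
  assumes "0 < L" "0 \<le> l" "X \<in> sets lebesgue"
  shows "ennreal l < average (\<lambda>y. \<bar>w y * indicator X y\<bar>) (rect_upper p x t L)
    \<longleftrightarrow> ennreal (l * rect_volume CARD('n) p L) < emeasure mu (rect_upper p x t L \<inter> X)"
proof -
  let ?v = "rect_volume CARD('n) p L"
  have v: "0 < ?v" using assms(1) by (rule rect_volume_pos)
  have "emeasure mu (rect_upper p x t L \<inter> X) \<le> emeasure mu (rect_upper p x t L)"
    by (intro emeasure_mono) auto
  then have "emeasure mu (rect_upper p x t L \<inter> X) < top"
    using mu_rect_finite(1)[of x t L] by (rule order_le_less_trans)
  then obtain u where u: "0 \<le> u" "emeasure mu (rect_upper p x t L \<inter> X) = ennreal u"
    by (cases "emeasure mu (rect_upper p x t L \<inter> X)") auto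
  show ?thesis
    unfolding average_restricted[OF assms(3)] emeasure_rect[OF assms(1)] u(2)
    using u v assms(2) by (simp add: divide_ennreal ennreal_less_iff field_simps)
qed

lemma less_max_plusD:
  assumes "ennreal l < max_plus p (\<lambda>y. w y * indicator X y) z" "0 \<le> l" "X \<in> sets lebesgue"
  obtains x t L where "0 < L" "z \<in> rect_lower p x t L"
    "ennreal (l * rect_volume CARD('n) p L) < emeasure mu (rect_upper p x t L \<inter> X)"
  using assms less_average_iff unfolding max_plus_def less_SUP_iff by auto

lemma max_plus_weak_type:
  assumes X: "X \<in> sets lebesgue" and l: "0 < l"
  obtains U where "open U" "{z. ennreal l < max_plus p (\<lambda>y. w y * indicator X y) z} \<subseteq> U"
    "emeasure lebesgue U \<le> ennreal (6 * 4 ^ CARD('n) / l) * emeasure (mu_above (l / 2)) X"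
proof -
  let ?\<nu> = "mu_above (l / 2)" and ?vol = "rect_volume CARD('n) p"
  define I where "I = {(x, t, L). 0 < L \<and> ennreal (l * ?vol L) < emeasure mu (rect_upper p x t L \<inter> X)}"
  define U where "U = (\<lambda>(x :: real ^ 'n, t, L). rect_upper p x t L)"
  define S where "S = (\<lambda>(x :: real ^ 'n, t :: real, L). {y. \<forall>k. \<bar>y $ k - x $ k\<bar> < L} \<times> {t - L powr p<..<t})"
  define S' where "S' = (\<lambda>(x :: real ^ 'n, t :: real, L). cube x (4 * L) \<times> {t - 2 * L powr p<..<t + L powr p})"
  define side :: "(real ^ 'n) \<times> real \<times> real \<Rightarrow> real" where "side = (\<lambda>(x, t, L). L)"
  have side_pos: "0 < side i" if "i \<in> I" for i using that by (auto simp: I_def side_def)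
  have open_S: "open (S i)" for i
  proof -
    have "{y. \<forall>k. \<bar>y $ k - x $ k\<bar> < L} = box (\<chi> k. x $ k - L) (\<chi> k. x $ k + L)" for x :: "real ^ 'n" and L
      by (auto simp: mem_box_cart abs_less_iff) (smt (verit))+
    then show ?thesis by (auto simp: S_def split: prod.splits intro!: open_Times)
  qed
  have sets_U: "U i \<inter> X \<in> sets lebesgue" for i
    using X by (cases i) (auto simp: U_def intro: sets.Int)
  have sets_S': "S' i \<in> sets lebesgue" for i
    by (cases i) (auto simp: S'_def intro!: sets_Times_borel)
  have S'_le: "emeasure lebesgue (S' i) \<le> ennreal (6 * 4 ^ CARD('n) / l) * emeasure ?\<nu> (U i \<inter> X)" if i: "i \<in> I" for i
  proof -
    obtain x t L where i_eq: "i = (x, t, L)" by (cases i)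
    have L: "0 < L" and big: "ennreal (l * ?vol L) < emeasure mu (rect_upper p x t L \<inter> X)"
      using i by (auto simp: I_def i_eq)
    let ?U = "rect_upper p x t L"
    have v: "0 < ?vol L" using L by (rule rect_volume_pos)
    have UX: "?U \<inter> X \<in> sets lebesgue" using X by (intro sets.Int) auto
    have "ennreal (l * ?vol L) \<le> emeasure ?\<nu> (?U \<inter> X) + ennreal (l / 2) * emeasure lebesgue (?U \<inter> X)"
      using big mu_le_mu_above[OF UX, of "l / 2"] l by simp
    also have "ennreal (l / 2) * emeasure lebesgue (?U \<inter> X) \<le> ennreal (l / 2) * emeasure lebesgue ?U"
      by (intro mult_left_mono emeasure_mono) auto
    also have "\<dots> = ennreal (l * ?vol L / 2)"
      using l v by (simp add: emeasure_rect[OF L] flip: ennreal_mult)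
    finally have "ennreal (l * ?vol L / 2) + ennreal (l * ?vol L / 2) \<le> emeasure ?\<nu> (?U \<inter> X) + ennreal (l * ?vol L / 2)"
      using l v by (simp add: add_left_mono flip: ennreal_plus)
    then have half: "ennreal (l * ?vol L / 2) \<le> emeasure ?\<nu> (?U \<inter> X)" by simp
    have "emeasure lebesgue (S' i) = ennreal ((4 * L) ^ CARD('n)) * ennreal (3 * L powr p)"
      using L unfolding S'_def i_eq by (simp add: emeasure_cube_Times)
    also have "\<dots> = ennreal (6 * 4 ^ CARD('n) / l) * ennreal (l * ?vol L / 2)"
      using l L by (simp add: rect_volume_def power_mult_distrib mult_ac flip: ennreal_mult)
    also have "\<dots> \<le> ennreal (6 * 4 ^ CARD('n) / l) * emeasure ?\<nu> (?U \<inter> X)"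
      by (intro mult_left_mono half) simp
    finally show ?thesis by (simp add: U_def i_eq)
  qed
  have S_sub: "S i \<subseteq> S' j" if i: "i \<in> I" and j: "j \<in> I" and meet: "U i \<inter> U j \<noteq> {}" and le: "side i \<le> side j" for i j
  proof
    fix z assume z: "z \<in> S i"
    obtain x t L where i_eq: "i = (x, t, L)" by (cases i)
    obtain x' t' L' where j_eq: "j = (x', t', L')" by (cases j)
    obtain y where y: "y \<in> rect_upper p x t L" "y \<in> rect_upper p x' t' L'"
      using meet by (auto simp: U_def i_eq j_eq)
    have L: "0 < L" "L \<le> L'" using i le by (auto simp: I_def side_def i_eq j_eq)
    then have Lp: "L powr p \<le> L' powr p" using p_ge_1 by (intro powr_mono2) auto
    have "\<bar>fst z $ k - x' $ k\<bar> \<le> 4 * L' / 2" for k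
    proof -
      have "\<bar>fst z $ k - x $ k\<bar> < L" using z by (auto simp: S_def i_eq)
      moreover have "\<bar>fst y $ k - x $ k\<bar> \<le> L / 2" "\<bar>fst y $ k - x' $ k\<bar> \<le> L' / 2"
        using y by (auto simp: rect_upper_def cube_def)
      ultimately show ?thesis using L by (simp add: abs_if split: if_splits)
    qed
    moreover have "t' - 2 * L' powr p < snd z" "snd z < t' + L' powr p"
      using y z Lp by (auto simp: S_def i_eq rect_upper_def)
    ultimately show "z \<in> S' j" by (auto simp: S'_def j_eq cube_def mem_Times_iff)
  qed
  let ?O = "\<Union>i\<in>I. S i"
  have "open ?O" by (intro open_UN ballI open_S)
  moreover have "{z. ennreal l < max_plus p (\<lambda>y. w y * indicator X y) z} \<subseteq> ?O"
  proof
    fix z assume "z \<in> {z. ennreal l < max_plus p (\<lambda>y. w y * indicator X y) z}"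
    then obtain x t L where L: "0 < L" "z \<in> rect_lower p x t L"
      "ennreal (l * ?vol L) < emeasure mu (rect_upper p x t L \<inter> X)"
      using l X by (auto elim: less_max_plusD)
    have "\<bar>fst z $ k - x $ k\<bar> < L" for k
    proof -
      have "\<bar>fst z $ k - x $ k\<bar> \<le> L / 2" using L(2) by (auto simp: rect_lower_def cube_def)
      then show ?thesis using L(1) by linarith
    qed
    then have "z \<in> S (x, t, L)"
      using L(2) by (auto simp: S_def rect_lower_def mem_Times_iff)
    moreover have "(x, t, L) \<in> I" using L by (simp add: I_def)
    ultimately show "z \<in> ?O" by blast
  qed
  moreover have "emeasure lebesgue ?O \<le> ennreal (6 * 4 ^ CARD('n) / l) * emeasure ?\<nu> X"
  proof -
    obtain C where C: "\<And>n. compact (C n)" "\<And>n. C n \<subseteq> ?O" "\<And>n. C n \<subseteq> interior (C (Suc n))" "\<Union>(range C) = ?O"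
      using open_Union_compact_subsets[OF \<open>open ?O\<close>] by metis
    have C_sets: "C n \<in> sets lebesgue" for n using C(1)[of n] by (simp add: compact_imp_closed borel_closed)
    have "emeasure lebesgue (C n) \<le> ennreal (6 * 4 ^ CARD('n) / l) * emeasure ?\<nu> X" for n
    proof -
      obtain I' where I': "I' \<subseteq> I" "finite I'" "C n \<subseteq> (\<Union>i\<in>I'. S i)"
        using compactE_image[OF C(1), of I S n] open_S C(2)[of n] by metis
      have ne: "U i \<noteq> {}" if "i \<in> I'" for i
      proof
        assume "U i = {}"
        obtain x t L where i_eq: "i = (x, t, L)" by (cases i)
        have "0 < L" "rect_upper p x t L = {}" using that I' \<open>U i = {}\<close> by (auto simp: I_def U_def i_eq)
        then show False using emeasure_rect(1)[of L p x t] rect_volume_pos[of L "CARD('n)" p] by (simp add: ennreal_eq_0_iff)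
      qed
      obtain J where J: "J \<subseteq> I'" "\<forall>i\<in>J. \<forall>j\<in>J. i \<noteq> j \<longrightarrow> \<not> (i = j \<or> U i \<inter> U j \<noteq> {})"
        "\<forall>i\<in>I'. \<exists>j\<in>J. (i = j \<or> U i \<inter> U j \<noteq> {}) \<and> side i \<le> side j"
      proof -
        have "\<exists>J\<subseteq>I'. (\<forall>i\<in>J. \<forall>j\<in>J. i \<noteq> j \<longrightarrow> \<not> (i = j \<or> U i \<inter> U j \<noteq> {})) \<and>
          (\<forall>i\<in>I'. \<exists>j\<in>J. (i = j \<or> U i \<inter> U j \<noteq> {}) \<and> side i \<le> side j)"
          by (rule finite_Vitali_selection[OF I'(2)]) blast+
        then show thesis using that by (elim exE conjE)
      qed
      have finJ: "finite J" using J(1) I'(2) by (rule finite_subset)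
      have "C n \<subseteq> (\<Union>j\<in>J. S' j)"
      proof
        fix z assume "z \<in> C n"
        then obtain i where i: "i \<in> I'" "z \<in> S i" using I'(3) by blast
        then obtain j where j: "j \<in> J" "i = j \<or> U i \<inter> U j \<noteq> {}" "side i \<le> side j" using J(3) by blast
        then have "U i \<inter> U j \<noteq> {}" using ne[OF i(1)] by auto
        then have "S i \<subseteq> S' j" using i j I'(1) J(1) by (intro S_sub) auto
        then show "z \<in> (\<Union>j\<in>J. S' j)" using i j by blast
      qed
      then have "emeasure lebesgue (C n) \<le> emeasure lebesgue (\<Union>j\<in>J. S' j)"
        using sets_S' finJ by (intro emeasure_mono sets.finite_UN) auto
      also have "\<dots> \<le> (\<Sum>j\<in>J. emeasure lebesgue (S' j))"
        using sets_S' finJ by (intro emeasure_subadditive_finite) auto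
      also have "\<dots> \<le> (\<Sum>j\<in>J. ennreal (6 * 4 ^ CARD('n) / l) * emeasure ?\<nu> (U j \<inter> X))"
        using J(1) I'(1) by (intro sum_mono S'_le) auto
      also have "\<dots> = ennreal (6 * 4 ^ CARD('n) / l) * emeasure ?\<nu> (\<Union>j\<in>J. U j \<inter> X)"
      proof -
        have "disjoint_family_on (\<lambda>j. U j \<inter> X) J" using J(2) unfolding disjoint_family_on_def by blast
        then have "(\<Sum>j\<in>J. emeasure ?\<nu> (U j \<inter> X)) = emeasure ?\<nu> (\<Union>j\<in>J. U j \<inter> X)"
          using sets_U finJ by (intro sum_emeasure) auto
        then show ?thesis by (simp only: sum_distrib_left[symmetric])
      qed
      also have "\<dots> \<le> ennreal (6 * 4 ^ CARD('n) / l) * emeasure ?\<nu> X"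
        using X by (intro mult_left_mono emeasure_mono) auto
      finally show ?thesis .
    qed
    moreover have "emeasure lebesgue ?O = (SUP n. emeasure lebesgue (C n))"
    proof -
      have "incseq C" using C(3) interior_subset by (intro incseq_SucI) blast
      then show ?thesis
        using SUP_emeasure_incseq[of C lebesgue] C_sets C(4) by (simp add: image_subset_iff)
    qed
    ultimately show ?thesis by (simp add: SUP_least)
  qed
  ultimately show thesis by (rule that)
qed

lemma doubling_of_LlogL:
  assumes "\<And>x t L. L > 0 \<Longrightarrow>
      (\<integral>\<^sup>+z\<in>rect_lower p x t L. ennreal (w z) * log_plus (ennreal (w z) / average w (rect_upper p x t L)) \<partial>lebesgue)
        \<le> ennreal C * mass w (rect_upper p x t L)"
    and C: "0 \<le> C" and L: "0 < L"
  shows "emeasure mu (rect_lower p x t L) \<le> ennreal (exp 1 + C) * emeasure mu (rect_upper p x t L)"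
proof -
  let ?v = "rect_volume CARD('n) p L" and ?U = "rect_upper p x t L" and ?R = "rect_lower p x t L"
  have v: "0 < ?v" using L by (rule rect_volume_pos)
  obtain m where m: "0 \<le> m" "emeasure mu ?U = ennreal (m * ?v)"
    using mu_rect_real[OF L] .
  have "emeasure mu ?R \<le> (\<integral>\<^sup>+z. ennreal (exp 1 * m) * indicator ?R z
      + ennreal (w z) * log_plus (ennreal (w z) / average w ?U) * indicator ?R z \<partial>lebesgue)"
    unfolding emeasure_mu[OF sets_rect(2)]
  proof (rule nn_integral_mono)
    fix z
    have "ennreal (w z) \<le> ennreal (exp 1 * m) + ennreal (w z) * log_plus (ennreal (w z) / average w ?U)"
    proof (cases "w z \<le> exp 1 * m")
      case True
      then show ?thesis by (simp add: add_increasing2 ennreal_leI)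
    next
      case False
      then have w: "0 < w z" using m by (meson exp_ge_zero mult_nonneg_nonneg not_le order_le_less_trans)
      have "1 \<le> log_plus (ennreal (w z) / average w ?U)"
      proof (cases "m = 0")
        case True
        then show ?thesis using w unfolding average_upper_eq[OF L m] by (simp add: log_plus_def ennreal_divide_zero)
      next
        case False
        then have "ln (exp 1) \<le> ln (w z / m)"
          using \<open>\<not> w z \<le> exp 1 * m\<close> m w by (subst ln_le_cancel_iff) (auto simp: field_simps)
        then show ?thesis
          using w m False unfolding average_upper_eq[OF L m] by (simp add: log_plus_def divide_ennreal)
      qed
      then have "ennreal (w z) * 1 \<le> ennreal (w z) * log_plus (ennreal (w z) / average w ?U)"
        by (intro mult_left_mono) auto
      then show ?thesis by (simp add: add_increasing)
    qed
    then show "ennreal (w z) * indicator ?R z \<le> ennreal (exp 1 * m) * indicator ?R z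
      + ennreal (w z) * log_plus (ennreal (w z) / average w ?U) * indicator ?R z"
      by (auto split: split_indicator)
  qed
  also have "\<dots> = ennreal (exp 1 * m) * emeasure lebesgue ?R
      + (\<integral>\<^sup>+z\<in>?R. ennreal (w z) * log_plus (ennreal (w z) / average w ?U) \<partial>lebesgue)"
  proof -
    have "(\<lambda>z. ennreal (w z) * log_plus (ennreal (w z) / average w ?U)) \<in> borel_measurable lebesgue"
      unfolding divide_ennreal_def by measurable
    then show ?thesis
      using m(1) by (subst nn_integral_add) (auto simp: nn_integral_cmult_indicator)
  qed
  also have "\<dots> \<le> ennreal (exp 1 * m) * emeasure lebesgue ?R + ennreal C * emeasure mu ?U"
    using assms(1)[OF L, of x t] by (intro add_left_mono) (simp add: mass_eq)
  also have "ennreal (exp 1 * m) * emeasure lebesgue ?R = ennreal (exp 1) * emeasure mu ?U"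
    unfolding emeasure_rect[OF L] m(2) using m v by (simp add: mult.assoc flip: ennreal_mult)
  finally show ?thesis using C by (simp add: distrib_right)
qed

lemma max_plus_zero_of_mu_zero:
  assumes "X \<in> sets lebesgue" "emeasure mu X = 0"
  shows "max_plus p (\<lambda>y. w y * indicator X y) z = 0"
proof -
  have "emeasure mu (rect_upper p x t L \<inter> X) = 0" for x t L
    using emeasure_mono[of "rect_upper p x t L \<inter> X" X mu] assms by simp
  then have avg: "average (\<lambda>y. \<bar>w y * indicator X y\<bar>) (rect_upper p x t L) \<le> 0" for x t L
    unfolding average_restricted[OF assms(1)] by simp
  have "max_plus p (\<lambda>y. w y * indicator X y) z \<le> 0"
    unfolding max_plus_def
  proof (rule SUP_least)
    fix i :: "(real ^ 'n) \<times> real \<times> real"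
    obtain x t L where i: "i = (x, t, L)" by (cases i)
    show "(case i of (x, t, L) \<Rightarrow> average (\<lambda>y. \<bar>w y * indicator X y\<bar>) (rect_upper p x t L)) \<le> 0"
      unfolding i prod.case by (rule avg)
  qed
  then show ?thesis by simp
qed

lemma max_plus_integral_of_LlogL:
  assumes LlogL: "\<forall>x t L. L > 0 \<longrightarrow>
      (\<integral>\<^sup>+z\<in>rect_lower p x t L. ennreal (w z) * log_plus (ennreal (w z) / average w (rect_upper p x t L)) \<partial>lebesgue)
        \<le> ennreal C * mass w (rect_upper p x t L)"
    and C: "0 \<le> C"
  shows "\<exists>C'\<ge>0. \<forall>x t L. L > 0 \<longrightarrow>
      (\<integral>\<^sup>+z\<in>rect_lower p x t L.
          max_plus p (\<lambda>y. w y * indicator (rect_lower p x t L) y) z \<partial>lebesgue)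
        \<le> ennreal C' * mass w (rect_upper p x t L)"
proof -
  define A :: real where "A = 12 * 4 ^ CARD('n)"
  define K where "K = exp 1 + C"
  define C' where "C' = 1 + A * (2 * K + C / ln 2)"
  have nonneg: "0 \<le> A" "0 \<le> K" "0 \<le> C'" using C by (simp_all add: A_def K_def C'_def)
  have "(\<integral>\<^sup>+z\<in>rect_lower p x t L. max_plus p (\<lambda>y. w y * indicator (rect_lower p x t L) y) z \<partial>lebesgue)
        \<le> ennreal C' * mass w (rect_upper p x t L)" if L: "L > 0" for x t L
  proof -
    let ?v = "rect_volume CARD('n) p L" and ?U = "rect_upper p x t L" and ?R = "rect_lower p x t L"
    let ?M = "max_plus p (\<lambda>y. w y * indicator ?R y)"
    have v: "0 < ?v" using L by (rule rect_volume_pos)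
    obtain m where m: "0 \<le> m" "emeasure mu ?U = ennreal (m * ?v)"
      using mu_rect_real[OF L] .
    have dbl: "emeasure mu ?R \<le> ennreal K * emeasure mu ?U"
      unfolding K_def by (rule doubling_of_LlogL[OF LlogL[rule_format] C L])
    show ?thesis
    proof (cases "m = 0")
      case True
      then have "emeasure mu ?R = 0" using dbl m by simp
      then show ?thesis by (simp add: max_plus_zero_of_mu_zero)
    next
      case False
      then have m_pos: "0 < m" using m by simp
      have ex: "\<exists>O'. open O' \<and> {z. ennreal (m * 2 ^ k) < ?M z} \<subseteq> O' \<and>
        emeasure lebesgue O' \<le> ennreal (6 * 4 ^ CARD('n) / (m * 2 ^ k)) * emeasure (mu_above (m * 2 ^ k / 2)) ?R" for k :: nat
      proof -
        have l: "0 < m * 2 ^ k" using m_pos by simp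
        obtain U where "open U" "{z. ennreal (m * 2 ^ k) < ?M z} \<subseteq> U"
          "emeasure lebesgue U \<le> ennreal (6 * 4 ^ CARD('n) / (m * 2 ^ k)) * emeasure (mu_above (m * 2 ^ k / 2)) ?R"
          by (rule max_plus_weak_type[OF _ l, of ?R]) simp_all
        then show ?thesis by (intro exI[of _ U] conjI)
      qed
      define O' where "O' k = (SOME V. open V \<and> {z. ennreal (m * 2 ^ k) < ?M z} \<subseteq> V \<and>
        emeasure lebesgue V \<le> ennreal (6 * 4 ^ CARD('n) / (m * 2 ^ k)) * emeasure (mu_above (m * 2 ^ k / 2)) ?R)" for k :: nat
      have O'_all: "open (O' k) \<and> {z. ennreal (m * 2 ^ k) < ?M z} \<subseteq> O' k \<and>
        emeasure lebesgue (O' k) \<le> ennreal (6 * 4 ^ CARD('n) / (m * 2 ^ k)) * emeasure (mu_above (m * 2 ^ k / 2)) ?R" for k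
        unfolding O'_def by (rule someI_ex[OF ex])
      have O': "open (O' k)" "{z. ennreal (m * 2 ^ k) < ?M z} \<subseteq> O' k"
        "emeasure lebesgue (O' k) \<le> ennreal (6 * 4 ^ CARD('n) / (m * 2 ^ k)) * emeasure (mu_above (m * 2 ^ k / 2)) ?R" for k
        by (fact O'_all[THEN conjunct1] O'_all[THEN conjunct2, THEN conjunct1] O'_all[THEN conjunct2, THEN conjunct2])+
      have O_sets: "O' k \<in> sets lebesgue" for k using O'(1)[of k] by (simp add: borel_open)
      let ?k = "\<lambda>k. ennreal (m * 2 ^ Suc k)"
      have M_le: "?M z \<le> ennreal m + (\<Sum>k. ?k k * indicator (O' k) z)" for z
      proof (rule dense_le)
        fix y assume y: "y < ?M z"
        show "y \<le> ennreal m + (\<Sum>k. ?k k * indicator (O' k) z)"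
        proof (cases "y \<le> ennreal m")
          case True
          then show ?thesis by (simp add: add_increasing2)
        next
          case False
          have "y \<noteq> top" using y by auto
          then obtain r where r: "y = ennreal r" "0 \<le> r" by (cases y) auto
          have "m < r" using False r m by (simp add: ennreal_leI not_le[symmetric])
          then obtain i where i: "m * 2 ^ i < r" "r \<le> m * 2 ^ Suc i"
            using geometric_level[of m 2 r] m_pos by auto
          have "ennreal (m * 2 ^ i) < ?M z"
            by (rule less_trans[OF ennreal_lessI[OF _ i(1)] y[unfolded r(1)]]) (use i(1) m_pos in \<open>auto intro: less_trans[of _ "m * 2 ^ i"]\<close>)
          then have "z \<in> O' i" using O'(2) by blast
          then have "y \<le> ?k i * indicator (O' i) z" using i(2) r by (simp add: ennreal_leI)
          also have "\<dots> = (\<Sum>k\<in>{i}. ?k k * indicator (O' k) z)"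
            by (subst sum.insert) (simp_all only: finite.emptyI empty_iff not_False_eq_True sum.empty add_0_right)
          also have "\<dots> \<le> (\<Sum>k. ?k k * indicator (O' k) z)" by (intro sum_le_suminf) auto
          also have "\<dots> \<le> ennreal m + (\<Sum>k. ?k k * indicator (O' k) z)" by simp
          finally show ?thesis .
        qed
      qed
      have "(\<integral>\<^sup>+z\<in>?R. ?M z \<partial>lebesgue) \<le> (\<integral>\<^sup>+z. ennreal m * indicator ?R z + (\<Sum>k. ?k k * indicator (O' k) z) \<partial>lebesgue)"
        using M_le by (intro nn_integral_mono) (auto split: split_indicator)
      also have "\<dots> = ennreal m * emeasure lebesgue ?R + (\<Sum>k. ?k k * emeasure lebesgue (O' k))"
        using O_sets by (subst nn_integral_add) (auto simp: nn_integral_suminf nn_integral_cmult_indicator)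
      also have "\<dots> \<le> ennreal m * emeasure lebesgue ?R + (\<Sum>k. ennreal A * emeasure mu (?R \<inter> {z. m * 2 ^ k / 2 < w z}))"
      proof (intro add_left_mono suminf_le)
        fix k
        have "?k k * emeasure lebesgue (O' k)
            \<le> ?k k * (ennreal (6 * 4 ^ CARD('n) / (m * 2 ^ k)) * emeasure (mu_above (m * 2 ^ k / 2)) ?R)"
          by (intro mult_left_mono O'(3)) simp
        also have "\<dots> = (?k k * ennreal (6 * 4 ^ CARD('n) / (m * 2 ^ k))) * emeasure mu (?R \<inter> {z. m * 2 ^ k / 2 < w z})"
          by (simp only: mult.assoc emeasure_mu_above[OF sets_rect(2)])
        also have "?k k * ennreal (6 * 4 ^ CARD('n) / (m * 2 ^ k)) = ennreal A"
          using m_pos by (simp add: A_def flip: ennreal_mult)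
        finally show "?k k * emeasure lebesgue (O' k) \<le> ennreal A * emeasure mu (?R \<inter> {z. m * 2 ^ k / 2 < w z})" .
      qed simp_all
      also have "(\<Sum>k. ennreal A * emeasure mu (?R \<inter> {z. m * 2 ^ k / 2 < w z}))
          = ennreal A * (\<Sum>k. emeasure mu (?R \<inter> {z. m * 2 ^ k / 2 < w z}))"
        by (rule ennreal_suminf_cmult)
      also have "(\<Sum>k. emeasure mu (?R \<inter> {z. m * 2 ^ k / 2 < w z})) \<le> ennreal (2 * K + C / ln 2) * emeasure mu ?U"
      proof -
        let ?ind = "\<lambda>k z. indicator (?R \<inter> {z. m * 2 ^ k / 2 < w z}) z :: ennreal"
        let ?log = "\<lambda>z. log_plus (ennreal (w z) / average w ?U)"
        have RS: "?R \<inter> {z. l < w z} \<in> sets lebesgue" for l by (intro sets.Int) auto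
        have log_meas [measurable]: "?log \<in> borel_measurable lebesgue"
          unfolding divide_ennreal_def by measurable
        have "(\<Sum>k. emeasure mu (?R \<inter> {z. m * 2 ^ k / 2 < w z})) = (\<Sum>k. \<integral>\<^sup>+z. ?ind k z \<partial>mu)"
          using RS by simp
        also have "\<dots> = (\<integral>\<^sup>+z. (\<Sum>k. ?ind k z) \<partial>mu)"
          using RS by (intro nn_integral_suminf[symmetric]) auto
        also have "\<dots> = (\<integral>\<^sup>+z. ennreal (w z) * (\<Sum>k. ?ind k z) \<partial>lebesgue)"
          unfolding mu_def using RS by (intro nn_integral_density) measurable
        also have "\<dots> \<le> (\<integral>\<^sup>+z. 2 * (ennreal (w z) * indicator ?R z)
            + ennreal (1 / ln 2) * (ennreal (w z) * ?log z * indicator ?R z) \<partial>lebesgue)"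
        proof (rule nn_integral_mono)
          fix z
          have "(\<Sum>k. ?ind k z) \<le> 2 + ennreal (1 / ln 2) * ?log z" if "z \<in> ?R" "0 < w z"
          proof -
            have "(\<Sum>k. ?ind k z) = (\<Sum>k. indicator {k. 2 ^ k < 2 * w z / m} k)"
              using that m_pos by (intro suminf_cong) (simp add: indicator_def field_simps)
            also have "\<dots> \<le> ennreal (1 + max (ln (2 * w z / m)) 0 / ln 2)" by (rule suminf_indicator_powers_le)
            also have "\<dots> \<le> ennreal (2 + 1 / ln 2 * max (ln (w z / m)) 0)"
            proof (rule ennreal_leI)
              have "ln (2 * w z / m) = ln 2 + ln (w z / m)" using that m_pos ln_mult[of 2 "w z / m"] by simp
              then have "max (ln (2 * w z / m)) 0 \<le> ln 2 + max (ln (w z / m)) 0" by auto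
              then have "max (ln (2 * w z / m)) 0 / ln 2 \<le> (ln 2 + max (ln (w z / m)) 0) / ln 2"
                by (rule divide_right_mono) simp
              then show "1 + max (ln (2 * w z / m)) 0 / ln 2 \<le> 2 + 1 / ln 2 * max (ln (w z / m)) 0"
                by (simp add: add_divide_distrib)
            qed
            also have "\<dots> = 2 + ennreal (1 / ln 2) * ennreal (max (ln (w z / m)) 0)"
            proof -
              have "ennreal (2 + 1 / ln 2 * max (ln (w z / m)) 0) = ennreal 2 + ennreal (1 / ln 2 * max (ln (w z / m)) 0)"
                by (rule ennreal_plus) simp_all
              moreover have "ennreal (1 / ln 2 * max (ln (w z / m)) 0) = ennreal (1 / ln 2) * ennreal (max (ln (w z / m)) 0)"
                by (rule ennreal_mult) simp_all
              ultimately show ?thesis by (simp only: ennreal_numeral)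
            qed
            also have "ennreal (max (ln (w z / m)) 0) = ?log z"
              using m_pos unfolding average_upper_eq[OF L m] by (simp add: log_plus_def divide_ennreal)
            finally show ?thesis .
          qed
          then have "ennreal (w z) * (\<Sum>k. ?ind k z) \<le> ennreal (w z) * (2 + ennreal (1 / ln 2) * ?log z)"
            if "z \<in> ?R"
            using that w_nonneg[of z] by (cases "w z = 0") (auto intro: mult_left_mono)
          then show "ennreal (w z) * (\<Sum>k. ?ind k z) \<le> 2 * (ennreal (w z) * indicator ?R z)
            + ennreal (1 / ln 2) * (ennreal (w z) * ?log z * indicator ?R z)"
            by (cases "z \<in> ?R") (simp_all add: distrib_left mult_ac)
        qed
        also have "\<dots> = 2 * emeasure mu ?R + ennreal (1 / ln 2) * (\<integral>\<^sup>+z\<in>?R. ennreal (w z) * ?log z \<partial>lebesgue)"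
          by (subst nn_integral_add) (simp_all add: nn_integral_cmult emeasure_mu)
        also have "\<dots> \<le> 2 * (ennreal K * emeasure mu ?U) + ennreal (1 / ln 2) * (ennreal C * emeasure mu ?U)"
          using LlogL[rule_format, OF L, of x t] by (intro add_mono mult_left_mono dbl) (simp_all add: mass_eq)
        also have "\<dots> = ennreal (2 * K + C / ln 2) * emeasure mu ?U"
        proof -
          have "ennreal (2 * K + C / ln 2) = 2 * ennreal K + ennreal (1 / ln 2) * ennreal C"
          proof -
            have "2 * K + C / ln 2 = 2 * K + 1 / ln 2 * C" by simp
            moreover have "ennreal (2 * K + 1 / ln 2 * C) = ennreal (2 * K) + ennreal (1 / ln 2 * C)"
              using nonneg C by (intro ennreal_plus) simp_all
            moreover have "ennreal (2 * K) = ennreal 2 * ennreal K" "ennreal (1 / ln 2 * C) = ennreal (1 / ln 2) * ennreal C"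
              using nonneg C by (intro ennreal_mult; simp)+
            ultimately show ?thesis by (simp only: ennreal_numeral)
          qed
          then show ?thesis by (simp only: distrib_right mult.assoc)
        qed
        finally show ?thesis .
      qed
      also have "ennreal m * emeasure lebesgue ?R = 1 * emeasure mu ?U"
        unfolding emeasure_rect[OF L] m(2) using m v by (simp flip: ennreal_mult)
      also have "1 * emeasure mu ?U + ennreal A * (ennreal (2 * K + C / ln 2) * emeasure mu ?U) = ennreal C' * mass w ?U"
      proof -
        have "ennreal C' = 1 + ennreal A * ennreal (2 * K + C / ln 2)"
          unfolding C'_def using nonneg C by (subst ennreal_plus) (simp_all add: ennreal_mult del: ennreal_plus)
        then show ?thesis by (simp only: mass_eq[OF sets_rect(1)] distrib_right mult.assoc)
      qed
      finally show ?thesis by (simp add: mult_left_mono)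
    qed
  qed
  then show ?thesis using nonneg by blast
qed

end

context parabolic_grid
begin

lemma reverse_weak_type:
  assumes doubling: "\<And>x t r. 0 < r \<Longrightarrow> emeasure mu (rect_lower p x t r) \<le> ennreal K * emeasure mu (rect_upper p x t r)"
    and K: "0 \<le> K" and lam: "0 < lam"
    and root: "emeasure mu (rect_lower p root_centre root_time L) + emeasure mu (rect_upper p root_centre root_time L)
      \<le> ennreal (lam * rect_volume CARD('n) p L)"
  obtains U where "U \<in> sets lebesgue" "U \<subseteq> column \<inter> {z. snd z < b + L powr p / 2}"
    "\<And>z. z \<in> U \<Longrightarrow> z \<in> rect_lower p root_centre root_time L \<Longrightarrow>
      ennreal lam < max_plus p (\<lambda>y. w y * indicator (rect_lower p root_centre root_time L) y) z"
    "emeasure mu (column \<inter> {z. snd z < b + L powr p / 2} \<inter> {z. (2 * K + 1) * lam < w z})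
      \<le> ennreal (2 * 2 powr (real CARD('n) + p) * K * lam) * emeasure lebesgue U"
proof -
  let ?vol = "\<lambda>k. rect_volume CARD('n) p (side k)" and ?N = "real CARD('n) + p"
  let ?R = "rect_lower p root_centre root_time L"
  define D where "D = column \<inter> {z. snd z < b + L powr p / 2}"
  have h0: "height 0 = L powr p / 2" by (simp add: height_def expo_def)
  have bottom0: "bottom 0 z = b" if z: "z \<in> D" for z
  proof -
    have "time_idx 0 (fst z, snd z) = 0"
      using z by (intro time_idx_eqI) (auto simp: D_def column_def h0)
    then show ?thesis by (simp add: bottom_def)
  qed
  have sat_D: "saturated k D" for k
  proof -
    have "D = column \<inter> {z. bottom 0 z < b + L powr p / 2}"
    proof (intro equalityI subsetI)
      fix z assume "z \<in> D"
      then show "z \<in> column \<inter> {z. bottom 0 z < b + L powr p / 2}"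
        using bottom0[of z] L_pos by (simp add: D_def)
    next
      fix z assume z: "z \<in> column \<inter> {z. bottom 0 z < b + L powr p / 2}"
      then have "time_idx 0 z * height 0 < 1 * height 0" by (simp add: bottom_def h0)
      then have "real_of_int (time_idx 0 z) < 1" by (rule mult_right_less_imp_less) simp
      then have "time_idx 0 z = 0" using z time_idx_nonneg_iff[of 0 z] by (auto simp: column_def)
      then have "snd z < b + height 0" using time_bounds(2)[where k = 0 and z = z] by (simp add: bottom_def)
      then show "z \<in> D" using z by (simp add: D_def h0)
    qed
    moreover have "saturated k {z. bottom 0 z < b + L powr p / 2}"
      by (rule saturated_mono[OF le0 saturated_bottom])
    ultimately show ?thesis by (simp only: saturated_Int[OF saturated_column])
  qed
  have D_sets: "D \<in> sets lebesgue" by (rule sets_saturated[OF sat_D])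
  define B where "B k = (if 0 < k then D \<inter> {z. ennreal (lam * ?vol k) < emeasure mu (up_rect k z)} else {})" for k
  have sat_B: "saturated k (B k)" for k
  proof (cases "0 < k")
    case True
    have "saturated k {z. ennreal (lam * ?vol k) < emeasure mu (up_rect k z)}"
      using up_rect_cong unfolding saturated_def by auto
    with True show ?thesis unfolding B_def
      by (simp only: if_True saturated_Int sat_D)
  qed (simp add: B_def)
  have good: "emeasure mu (up_rect k z) \<le> ennreal (lam * ?vol k)" if z: "z \<in> D" "z \<notin> B k" for k z
  proof (cases "k = 0")
    case True
    have "bottom 0 z + height 0 + side 0 powr p \<le> b + 2 * L powr p"
      unfolding bottom0[OF z(1)] h0 by (simp add: side_def)
    then have "up_rect 0 z \<subseteq> cube root_centre L \<times> {b<..<b + 2 * L powr p}"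
      using z by (intro up_rect_subset_root) (simp add: D_def)
    then have "up_rect 0 z \<subseteq> cube root_centre L \<times> {b..<b + 2 * L powr p}" by fastforce
    from mu_root_cube_le[OF this] have "emeasure mu (up_rect 0 z) \<le> ennreal (lam * rect_volume CARD('n) p L)"
      using root by simp
    then show ?thesis by (simp add: True side_def)
  next
    case False
    with z show ?thesis by (simp add: B_def not_less)
  qed
  have cell_le: "emeasure mu (low_rect k z) \<le> ennreal (K * lam * ?vol k)" if z: "z \<in> D" "z \<notin> B k" for k z
  proof -
    have "emeasure mu (low_rect k z) \<le> ennreal K * emeasure mu (up_rect k z)"
      unfolding low_rect_def up_rect_def by (intro doubling) simp
    also have "\<dots> \<le> ennreal K * ennreal (lam * ?vol k)" by (intro mult_left_mono good z) simp
    finally show ?thesis using K by (simp add: mult.assoc flip: ennreal_mult')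
  qed
  have B_D: "B k \<subseteq> D" for k by (auto simp: B_def)
  have B_0: "B 0 = {}" by (simp add: B_def)
  define G where "G k = B k - (\<Union>j<k. B j)" for k
  have sat_G: "saturated k (G k)" for k
    unfolding G_def by (intro saturated_Diff sat_B saturated_UN saturated_mono[OF _ sat_B]) auto
  note G_sets = sets_saturated[OF sat_G]
  have G_le: "emeasure mu (G k) \<le> ennreal (2 * 2 powr ?N * K * lam) * emeasure lebesgue (G k)" for k
  proof (rule saturated_sum_le_single[OF sat_G _ sets_mu])
    show "0 \<le> 2 * 2 powr ?N * K * lam" using K lam by simp
    fix z assume z: "z \<in> G k"
    then have "k \<noteq> 0" using B_0 by (auto simp: G_def)
    then obtain j where k: "k = Suc j" using not0_implies_Suc by blast
    have zj: "z \<in> D" "z \<notin> B j" using z B_D[of k] by (auto simp: G_def k)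
    have "cell k z \<subseteq> low_rect j z"
      using cell_antimono[of j k z] cell_subset_low_rect[of j z] k by auto
    then have "emeasure mu (cell k z) \<le> emeasure mu (low_rect j z)" by (intro emeasure_mono) auto
    also note cell_le[OF zj]
    also have "K * lam * ?vol j = 2 powr ?N * K * lam * ?vol k" unfolding k rect_volume_side_Suc[of j] by simp
    also have "ennreal (2 powr ?N * K * lam * ?vol k) = ennreal (2 powr ?N * K * lam) * ennreal (?vol k)"
      using K lam by (intro ennreal_mult') simp
    also have "\<dots> \<le> ennreal (2 powr ?N * K * lam) * (2 * emeasure lebesgue (cell k z))"
      by (intro mult_left_mono rect_volume_side_le) simp
    also have "\<dots> = ennreal (2 * 2 powr ?N * K * lam) * emeasure lebesgue (cell k z)"
      using K lam by (simp add: ennreal_mult' mult_ac)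
    finally show "emeasure mu (cell k z) \<le> ennreal (2 * 2 powr ?N * K * lam) * emeasure lebesgue (cell k z)" .
  qed
  define U where "U = (\<Union>k. G k)"
  have U_sets: "U \<in> sets lebesgue" unfolding U_def using G_sets by auto
  have B_sub: "B k \<subseteq> U" for k
  proof
    fix z assume z: "z \<in> B k"
    define j where "j = (LEAST k. z \<in> B k)"
    have "z \<in> B j" unfolding j_def by (rule LeastI[of _ k]) (rule z)
    moreover have "z \<notin> B i" if "i < j" for i using that unfolding j_def by (rule not_less_Least)
    ultimately have "z \<in> G j" by (simp add: G_def)
    then show "z \<in> U" unfolding U_def by (rule UN_I[OF UNIV_I])
  qed
  have U_D: "U \<subseteq> D" using B_D unfolding U_def G_def by blast
  have U_max: "ennreal lam < max_plus p (\<lambda>y. w y * indicator ?R y) z" if z: "z \<in> U" for z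
  proof -
    obtain k where k: "z \<in> B k" using z unfolding U_def G_def by blast
    then have zk: "0 < k" "z \<in> D" "ennreal (lam * ?vol k) < emeasure mu (up_rect k z)"
      by (auto simp: B_def split: if_splits)
    have "1 * side k \<le> real_of_int (2 ^ (k - 1)) * side k"
      by (intro mult_right_mono) (auto intro: less_imp_le)
    then have "side k \<le> side 1" using side_mult[of 1 k] zk(1) by simp
    then have "side k powr p \<le> side 1 powr p"
      using p_ge_1 side_pos[of k] by (intro powr_mono2) linarith+
    also have "\<dots> = L powr p / 2 powr p" using L_pos by (simp add: side_def powr_divide)
    also have "\<dots> \<le> L powr p / 2"
    proof -
      have "2 powr 1 \<le> 2 powr p" using p_ge_1 by (intro powr_mono) auto
      then show ?thesis by (intro divide_left_mono) auto
    qed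
    finally have "bottom k z + height k + side k powr p \<le> root_time"
      using top_mono[of 0 k z] bottom0[OF zk(2)] h0 by simp
    then have "up_rect k z \<subseteq> cube root_centre L \<times> {b<..<root_time}"
      using zk(2) by (intro up_rect_subset_root) (simp add: D_def)
    then have "up_rect k z \<subseteq> ?R" by (simp add: rect_lower_def)
    then have "up_rect k z \<inter> ?R = up_rect k z" by blast
    then have "ennreal lam < average (\<lambda>y. \<bar>w y * indicator ?R y\<bar>) (up_rect k z)"
      using zk(3) lam unfolding up_rect_def by (subst less_average_iff) auto
    moreover have "z \<in> low_rect k z" using cell_self cell_subset_low_rect by blast
    ultimately show ?thesis
      unfolding max_plus_def less_SUP_iff up_rect_def low_rect_def
      by (intro bexI[of _ "(centre k z, bottom k z + height k, side k)"]) simp_all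
  qed
  let ?high = "{z. (2 * K + 1) * lam < w z}"
  have "emeasure mu ((D - U) \<inter> ?high) = 0"
  proof (rule mu_superlevel_null[where K = "2 * K * lam" and ?k0.0 = 0])
    show "D - U \<in> sets lebesgue" using D_sets U_sets by (rule sets.Diff)
    have "D - U \<subseteq> cube root_centre L \<times> {b..<b + L powr p / 2}"
      using column_subset unfolding D_def by blast
    then have "emeasure lebesgue (D - U) \<le> emeasure lebesgue (cube root_centre L \<times> {b..<b + L powr p / 2})"
      by (intro emeasure_mono sets_Times_borel) auto
    also have "\<dots> < top"
      using L_pos emeasure_bounded_finite[of "{b..<b + L powr p / 2}"]
      by (subst emeasure_cube_Times) (auto simp: ennreal_mult_less_top)
    finally show "emeasure lebesgue (D - U) < top" .
    fix z k assume "z \<in> D - U"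
    then have z: "z \<in> D" "z \<notin> B k" using B_sub by blast+
    have "emeasure mu (cell k z) \<le> emeasure mu (low_rect k z)"
      by (intro emeasure_mono cell_subset_low_rect) simp
    also note cell_le[OF z]
    also have "ennreal (K * lam * ?vol k) = ennreal (K * lam) * ennreal (?vol k)"
      using K lam by (intro ennreal_mult') simp
    also have "\<dots> \<le> ennreal (K * lam) * (2 * emeasure lebesgue (cell k z))"
      by (intro mult_left_mono rect_volume_side_le) simp
    also have "\<dots> = ennreal (2 * K * lam) * emeasure lebesgue (cell k z)"
      using K lam by (simp add: ennreal_mult' mult_ac)
    finally show "emeasure mu (cell k z) \<le> ennreal (2 * K * lam) * emeasure lebesgue (cell k z)" .
  qed (use K lam in \<open>simp_all add: distrib_right\<close>)
  then have null: "(D - U) \<inter> ?high \<in> null_sets mu"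
    using D_sets U_sets by (simp add: null_sets_def sets.Int sets.Diff)
  have "emeasure mu (D \<inter> ?high) \<le> emeasure mu (U \<union> (D - U) \<inter> ?high)"
    by (rule emeasure_mono) (blast, use U_sets null in auto)
  also have "\<dots> = emeasure mu U"
    using U_sets null by (intro emeasure_Un_null_set) auto
  also have "\<dots> \<le> (\<Sum>k. emeasure mu (G k))"
    unfolding U_def using G_sets by (intro emeasure_subadditive_countably) auto
  also have "\<dots> \<le> (\<Sum>k. ennreal (2 * 2 powr ?N * K * lam) * emeasure lebesgue (G k))"
    by (intro suminf_le G_le) auto
  also have "\<dots> = ennreal (2 * 2 powr ?N * K * lam) * (\<Sum>k. emeasure lebesgue (G k))"
    by (rule ennreal_suminf_cmult)
  also have "(\<Sum>k. emeasure lebesgue (G k)) = emeasure lebesgue U"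
    unfolding U_def
  proof (rule suminf_emeasure)
    have "G i \<inter> G j = {}" if "i < j" for i j using that by (auto simp: G_def)
    then show "disjoint_family G" unfolding disjoint_family_on_def
      by (metis Int_commute linorder_neqE_nat)
  qed (use G_sets in auto)
  finally have main: "emeasure mu (D \<inter> ?high) \<le> ennreal (2 * 2 powr ?N * K * lam) * emeasure lebesgue U" .
  show thesis
    by (rule that[OF U_sets U_D[unfolded D_def] U_max main[unfolded D_def]])
qed

end

context parabolic_weight
begin

lemma max_plus_ge:
  assumes "0 < L" "z \<in> rect_lower p x t L" "X \<in> sets lebesgue"
  shows "emeasure mu (rect_upper p x t L \<inter> X) / ennreal (rect_volume CARD('n) p L)
    \<le> max_plus p (\<lambda>y. w y * indicator X y) z"
proof -
  have "average (\<lambda>y. \<bar>w y * indicator X y\<bar>) (rect_upper p x t L) \<le> max_plus p (\<lambda>y. w y * indicator X y) z"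
    unfolding max_plus_def by (rule SUP_upper2[of "(x, t, L)"]) (use assms in auto)
  then show ?thesis unfolding average_restricted[OF assms(3)] emeasure_rect[OF assms(1)] .
qed

lemma mu_time_slice_cover:
  assumes "A \<subseteq> cube x L \<times> {s..<u}"
  shows "emeasure mu A \<le> emeasure mu (cube x L \<times> {s<..<u})"
proof -
  let ?N = "{z :: (real ^ 'n) \<times> real. snd z = s}" and ?S = "cube x L \<times> {s<..<u}"
  have S: "?S \<in> sets mu" by (simp add: sets_Times_borel)
  have N: "?N \<in> null_sets mu" by (intro null_sets_mu null_sets_time_slice)
  have "emeasure mu A \<le> emeasure mu (?S \<union> ?N)"
  proof (rule emeasure_mono)
    show "A \<subseteq> ?S \<union> ?N" using assms by fastforce
  qed (use S N in auto)
  also have "\<dots> = emeasure mu ?S" by (rule emeasure_Un_null_set[OF S N])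
  finally show ?thesis .
qed

context
  fixes C :: real
  assumes C: "0 \<le> C" and max_bound: "\<forall>x t L. L > 0 \<longrightarrow>
      (\<integral>\<^sup>+z\<in>rect_lower p x t L.
          max_plus p (\<lambda>y. w y * indicator (rect_lower p x t L) y) z \<partial>lebesgue)
        \<le> ennreal C * emeasure mu (rect_upper p x t L)"
begin

lemma mu_slab_le:
  assumes L: "0 < L"
  shows "emeasure mu (cube x L \<times> {t - (L / 2) powr p<..<t})
    \<le> ennreal (2 ^ CARD('n) * C) * emeasure mu (rect_upper p x t L)"
proof -
  define r where "r = L / 2"
  let ?v = "rect_volume CARD('n) p r" and ?R = "rect_lower p x t L" and ?U = "rect_upper p x t L"
  have r: "0 < r" using L by (simp add: r_def)
  have v: "0 < ?v" using r by (rule rect_volume_pos)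
  have "2 powr 1 \<le> 2 powr p" using p_ge_1 by (intro powr_mono) auto
  then have "2 * r powr p \<le> 2 powr p * r powr p" by (intro mult_right_mono) auto
  also have "\<dots> = L powr p" by (simp add: r_def flip: powr_mult)
  finally have rp: "2 * r powr p \<le> L powr p" .
  have piece: "emeasure mu (rect_upper p c (t - r powr p) r) \<le> ennreal C * emeasure mu ?U"
    if c: "c \<in> half_centres x L" for c
  proof -
    have cube: "cube c r \<subseteq> cube x L" unfolding r_def by (rule half_centres_subset[OF c L])
    have sub: "rect_upper p c (t - r powr p) r \<subseteq> ?R" "rect_lower p c (t - r powr p) r \<subseteq> ?R"
      using rp cube powr_gt_zero[of r p] r unfolding rect_upper_def rect_lower_def by (auto simp: mem_Times_iff)
    let ?P = "rect_upper p c (t - r powr p) r" and ?Q = "rect_lower p c (t - r powr p) r"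
    have "emeasure mu ?P = (emeasure mu ?P / ennreal ?v) * emeasure lebesgue ?Q"
      unfolding emeasure_rect[OF r] by (rule ennreal_divide_mult_cancel[OF v, symmetric])
    also have "\<dots> = (\<integral>\<^sup>+z\<in>?Q. (emeasure mu ?P / ennreal ?v) \<partial>lebesgue)"
      by (simp add: nn_integral_cmult_indicator)
    also have "\<dots> \<le> (\<integral>\<^sup>+z\<in>?R. max_plus p (\<lambda>y. w y * indicator ?R y) z \<partial>lebesgue)"
    proof (rule nn_integral_mono)
      fix z
      have "?P \<inter> ?R = ?P" using sub by blast
      then show "(emeasure mu ?P / ennreal ?v) * indicator ?Q z \<le> max_plus p (\<lambda>y. w y * indicator ?R y) z * indicator ?R z"
        using max_plus_ge[OF r, of z c "t - r powr p" ?R] sub by (auto split: split_indicator)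
    qed
    also have "\<dots> \<le> ennreal C * emeasure mu ?U" by (rule max_bound[rule_format, OF L])
    finally show ?thesis .
  qed
  have "cube x L \<times> {t - r powr p<..<t} \<subseteq> (\<Union>c\<in>half_centres x L. rect_upper p c (t - r powr p) r)"
  proof
    fix z assume z: "z \<in> cube x L \<times> {t - r powr p<..<t}"
    then obtain c where "c \<in> half_centres x L" "fst z \<in> cube c r"
      using half_centres_cover[of "fst z" x L] by (auto simp: r_def)
    then show "z \<in> (\<Union>c\<in>half_centres x L. rect_upper p c (t - r powr p) r)"
      using z by (auto simp: rect_upper_def mem_Times_iff)
  qed
  then have "emeasure mu (cube x L \<times> {t - r powr p<..<t})
      \<le> emeasure mu (\<Union>c\<in>half_centres x L. rect_upper p c (t - r powr p) r)"
    by (intro emeasure_mono sets.finite_UN) auto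
  also have "\<dots> \<le> (\<Sum>c\<in>half_centres x L. emeasure mu (rect_upper p c (t - r powr p) r))"
    by (intro emeasure_subadditive_finite) auto
  also have "\<dots> \<le> (\<Sum>c\<in>half_centres x L. ennreal C * emeasure mu ?U)"
    by (intro sum_mono piece)
  also have "\<dots> = ennreal (real (card (half_centres x L))) * (ennreal C * emeasure mu ?U)"
    by (simp add: ennreal_of_nat_eq_real_of_nat)
  also have "\<dots> \<le> ennreal (2 ^ CARD('n)) * (ennreal C * emeasure mu ?U)"
  proof (intro mult_right_mono ennreal_leI)
    have "real (card (half_centres x L)) \<le> real (2 ^ CARD('n))"
      using card_half_centres[of x L] by (simp only: of_nat_le_iff)
    then show "real (card (half_centres x L)) \<le> 2 ^ CARD('n)" by simp
  qed simp
  finally show ?thesis using C by (simp add: r_def ennreal_mult mult.assoc)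
qed

lemma mu_double_rect_le:
  obtains K where "1 \<le> K"
    "\<And>x t L. 0 < L \<Longrightarrow> emeasure mu (cube x L \<times> {t - L powr p..<t + L powr p}) \<le> ennreal K * emeasure mu (rect_upper p x t L)"
proof -
  define S where "S = 2 ^ CARD('n) * C"
  define n where "n = nat \<lceil>2 powr p\<rceil>"
  have S: "0 \<le> S" using C by (simp add: S_def)
  have "emeasure mu (cube x L \<times> {t - L powr p..<t + L powr p}) \<le> ennreal ((1 + S) ^ n) * emeasure mu (rect_upper p x t L)"
    if L: "0 < L" for x t L
  proof -
    let ?\<tau> = "(L / 2) powr p" and ?U = "rect_upper p x t L"
    have \<tau>: "0 < ?\<tau>" using L by simp
    have step: "emeasure mu (cube x L \<times> {t - real k * ?\<tau>..<t + L powr p}) \<le> ennreal ((1 + S) ^ k) * emeasure mu ?U" for k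
    proof (induction k)
      case 0
      show ?case using mu_time_slice_cover[of _ x L t "t + L powr p", OF order_refl] by (simp add: rect_upper_def)
    next
      case (Suc k)
      let ?s = "t - real k * ?\<tau>"
      have s_Suc: "t - real (Suc k) * ?\<tau> = ?s - ?\<tau>" by (simp add: algebra_simps)
      have A: "cube x L \<times> {?s - ?\<tau>..<?s} \<in> sets mu" "cube x L \<times> {?s..<t + L powr p} \<in> sets mu"
        by (simp_all add: sets_Times_borel)
      have "cube x L \<times> {?s - ?\<tau>..<t + L powr p} \<subseteq> cube x L \<times> {?s - ?\<tau>..<?s} \<union> cube x L \<times> {?s..<t + L powr p}"
        by auto
      then have "emeasure mu (cube x L \<times> {?s - ?\<tau>..<t + L powr p})
          \<le> emeasure mu (cube x L \<times> {?s - ?\<tau>..<?s} \<union> cube x L \<times> {?s..<t + L powr p})"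
        using A by (intro emeasure_mono) auto
      also have "\<dots> \<le> emeasure mu (cube x L \<times> {?s - ?\<tau>..<?s}) + emeasure mu (cube x L \<times> {?s..<t + L powr p})"
        using A by (intro emeasure_subadditive)
      also have "emeasure mu (cube x L \<times> {?s - ?\<tau>..<?s}) \<le> ennreal S * emeasure mu (cube x L \<times> {?s..<t + L powr p})"
      proof -
        have "emeasure mu (cube x L \<times> {?s - ?\<tau>..<?s}) \<le> emeasure mu (cube x L \<times> {?s - ?\<tau><..<?s})"
          by (rule mu_time_slice_cover) simp
        also have "\<dots> \<le> ennreal S * emeasure mu (rect_upper p x ?s L)"
          unfolding S_def by (rule mu_slab_le[OF L])
        also have "\<dots> \<le> ennreal S * emeasure mu (cube x L \<times> {?s..<t + L powr p})"
        proof (intro mult_left_mono emeasure_mono)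
          have "0 \<le> real k * ?\<tau>" using \<tau> by simp
          then have "{?s<..<?s + L powr p} \<subseteq> {?s..<t + L powr p}"
            unfolding subset_iff greaterThanLessThan_iff atLeastLessThan_iff by (intro allI impI) linarith
          then show "rect_upper p x ?s L \<subseteq> cube x L \<times> {?s..<t + L powr p}"
            unfolding rect_upper_def by blast
        qed (use A in auto)
        finally show ?thesis .
      qed
      also have "ennreal S * emeasure mu (cube x L \<times> {?s..<t + L powr p}) + emeasure mu (cube x L \<times> {?s..<t + L powr p})
          = ennreal (1 + S) * emeasure mu (cube x L \<times> {?s..<t + L powr p})"
        using S by (simp add: distrib_right add.commute)
      also have "\<dots> \<le> ennreal (1 + S) * (ennreal ((1 + S) ^ k) * emeasure mu ?U)"
        by (intro mult_left_mono Suc) simp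
      also have "\<dots> = ennreal ((1 + S) ^ Suc k) * emeasure mu ?U"
      proof -
        have "ennreal ((1 + S) ^ Suc k) = ennreal (1 + S) * ennreal ((1 + S) ^ k)"
          unfolding power_Suc using S by (intro ennreal_mult) auto
        then show ?thesis by (simp only: mult.assoc)
      qed
      finally show ?case unfolding s_Suc by (simp add: add_right_mono)
    qed
    have "2 powr p \<le> real n" unfolding n_def by linarith
    then have "2 powr p * ?\<tau> \<le> real n * ?\<tau>" using \<tau> by (intro mult_right_mono) auto
    moreover have "2 powr p * ?\<tau> = L powr p" by (simp flip: powr_mult)
    ultimately have "L powr p \<le> real n * ?\<tau>" by simp
    then have "cube x L \<times> {t - L powr p..<t + L powr p} \<subseteq> cube x L \<times> {t - real n * ?\<tau>..<t + L powr p}" by auto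
    then have "emeasure mu (cube x L \<times> {t - L powr p..<t + L powr p}) \<le> emeasure mu (cube x L \<times> {t - real n * ?\<tau>..<t + L powr p})"
      by (intro emeasure_mono) (simp_all add: sets_Times_borel)
    also note step[of n]
    finally show ?thesis .
  qed
  moreover have "1 \<le> (1 + S) ^ n" using S by simp
  ultimately show thesis by (intro that[of "(1 + S) ^ n"]) auto
qed

lemma superlevel_decay:
  obtains c D where "1 \<le> c" "0 \<le> D"
    "\<And>x t L m n. 0 < L \<Longrightarrow> 0 < m \<Longrightarrow> emeasure mu (rect_upper p x t L) = ennreal (m * rect_volume CARD('n) p L) \<Longrightarrow>
      of_nat n * emeasure mu (rect_lower p x t L \<inter> {z. c * m * 2 ^ n < w z}) \<le> ennreal D * emeasure mu (rect_upper p x t L)"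
    "\<And>x t L. 0 < L \<Longrightarrow> emeasure mu (rect_lower p x t L) \<le> ennreal D * emeasure mu (rect_upper p x t L)"
proof -
  obtain K where K: "1 \<le> K"
    "\<And>x t L. 0 < L \<Longrightarrow> emeasure mu (cube x L \<times> {t - L powr p..<t + L powr p}) \<le> ennreal K * emeasure mu (rect_upper p x t L)"
    by (rule mu_double_rect_le) blast
  have doubling: "emeasure mu (rect_lower p x t L) \<le> ennreal K * emeasure mu (rect_upper p x t L)" if L: "0 < L" for x t L
  proof -
    have "emeasure mu (rect_lower p x t L) \<le> emeasure mu (cube x L \<times> {t - L powr p..<t + L powr p})"
      unfolding rect_lower_def by (intro emeasure_mono) (auto simp: sets_Times_borel)
    then show ?thesis using K(2)[OF L, of x t] by (rule order_trans)
  qed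
  define N where "N = real CARD('n) + p"
  define c0 where "c0 = 2 * 2 powr N * K"
  have c0: "0 \<le> c0" using K by (simp add: c0_def)
  have half: "of_nat n * emeasure mu ((cube x r \<times> {s..<s + r powr p / 2}) \<inter> {z. (2 * K + 1) * (lam * 2 ^ n) < w z})
      \<le> ennreal (2 * c0 * C) * emeasure mu (rect_upper p x (s + r powr p) r)"
    if r: "0 < r" and lam: "0 < lam"
      and root: "emeasure mu (rect_lower p x (s + r powr p) r) + emeasure mu (rect_upper p x (s + r powr p) r)
        \<le> ennreal (lam * rect_volume CARD('n) p r)" for x s r lam n
  proof -
    let ?R = "rect_lower p x (s + r powr p) r" and ?M = "max_plus p (\<lambda>y. w y * indicator (rect_lower p x (s + r powr p) r) y)"
    interpret g: parabolic_grid p w "\<chi> i. x $ i - r / 2" s r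
      by unfold_locales (rule r)
    have x_eq: "(\<chi> i. (\<chi> i. x $ i - r / 2) $ i + r / 2) = x" by (simp add: vec_eq_iff)
    let ?D = "g.column \<inter> {z. snd z < s + r powr p / 2}"
    have ex: "\<exists>U. U \<in> sets lebesgue \<and> U \<subseteq> ?D \<and> (\<forall>z\<in>U \<inter> ?R. ennreal (lam * 2 ^ i) < ?M z) \<and>
      emeasure mu (?D \<inter> {z. (2 * K + 1) * (lam * 2 ^ i) < w z}) \<le> ennreal (c0 * (lam * 2 ^ i)) * emeasure lebesgue U" for i :: nat
    proof -
      have "lam * 1 \<le> lam * 2 ^ i" using lam by (intro mult_left_mono) auto
      then have "lam * rect_volume CARD('n) p r \<le> lam * 2 ^ i * rect_volume CARD('n) p r"
        using rect_volume_pos[OF r, of "CARD('n)" p] by (intro mult_right_mono) auto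
      then have root': "emeasure mu ?R + emeasure mu (rect_upper p x (s + r powr p) r)
          \<le> ennreal (lam * 2 ^ i * rect_volume CARD('n) p r)"
        using order_trans[OF root ennreal_leI] by blast
      have "0 \<le> K" "0 < lam * 2 ^ i" using K lam by auto
      from g.reverse_weak_type[OF doubling this, unfolded x_eq, OF _ root']
      obtain U where U: "U \<in> sets lebesgue" "U \<subseteq> ?D" "\<And>z. z \<in> U \<Longrightarrow> z \<in> ?R \<Longrightarrow> ennreal (lam * 2 ^ i) < ?M z"
        "emeasure mu (?D \<inter> {z. (2 * K + 1) * (lam * 2 ^ i) < w z}) \<le> ennreal (c0 * (lam * 2 ^ i)) * emeasure lebesgue U"
        unfolding c0_def N_def by (metis (no_types, lifting) mult.assoc)
      then show ?thesis by (intro exI[of _ U] conjI ballI) auto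
    qed
    define U where "U i = (SOME U. U \<in> sets lebesgue \<and> U \<subseteq> ?D \<and> (\<forall>z\<in>U \<inter> ?R. ennreal (lam * 2 ^ i) < ?M z) \<and>
      emeasure mu (?D \<inter> {z. (2 * K + 1) * (lam * 2 ^ i) < w z}) \<le> ennreal (c0 * (lam * 2 ^ i)) * emeasure lebesgue U)" for i :: nat
    have U_all: "U i \<in> sets lebesgue \<and> U i \<subseteq> ?D \<and> (\<forall>z\<in>U i \<inter> ?R. ennreal (lam * 2 ^ i) < ?M z) \<and>
      emeasure mu (?D \<inter> {z. (2 * K + 1) * (lam * 2 ^ i) < w z}) \<le> ennreal (c0 * (lam * 2 ^ i)) * emeasure lebesgue (U i)" for i
      unfolding U_def by (rule someI_ex[OF ex])
    then have U_sets: "U i \<in> sets lebesgue" and U_sub: "U i \<subseteq> ?D"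
      and U_M: "z \<in> U i \<Longrightarrow> z \<in> ?R \<Longrightarrow> ennreal (lam * 2 ^ i) < ?M z"
      and U_mu: "emeasure mu (?D \<inter> {z. (2 * K + 1) * (lam * 2 ^ i) < w z}) \<le> ennreal (c0 * (lam * 2 ^ i)) * emeasure lebesgue (U i)" for i z
      by blast+
    have U_R: "emeasure lebesgue (U i) = emeasure lebesgue (U i \<inter> ?R)" for i
    proof -
      let ?N = "{z :: (real ^ 'n) \<times> real. snd z = s}"
      have UR: "U i \<inter> ?R \<in> sets lebesgue" using U_sets by (intro sets.Int) auto
      have "U i \<subseteq> (U i \<inter> ?R) \<union> ?N"
        using U_sub[of i] g.column_subset[of "s + r powr p / 2"] r unfolding x_eq rect_lower_def
        by (fastforce simp: add_strict_increasing)
      then have "emeasure lebesgue (U i) \<le> emeasure lebesgue ((U i \<inter> ?R) \<union> ?N)"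
        using UR null_sets_time_slice by (intro emeasure_mono) auto
      also have "\<dots> = emeasure lebesgue (U i \<inter> ?R)"
        by (intro emeasure_Un_null_set UR null_sets_time_slice)
      finally show ?thesis using emeasure_mono[of "U i \<inter> ?R" "U i" lebesgue] U_sets by (intro antisym) auto
    qed
    have sum_le: "(\<Sum>i<n. ennreal (lam * 2 ^ i / 2) * indicator (U i \<inter> ?R) z) \<le> ?M z" for z n
    proof (induction n)
      case (Suc n)
      show ?case
      proof (cases "z \<in> U n \<inter> ?R")
        case True
        have "(\<Sum>i<Suc n. ennreal (lam * 2 ^ i / 2) * indicator (U i \<inter> ?R) z) \<le> (\<Sum>i<Suc n. ennreal (lam * 2 ^ i / 2))"
          by (intro sum_mono) (simp add: indicator_def)
        also have "\<dots> = ennreal (\<Sum>i<Suc n. lam * 2 ^ i / 2)" using lam by (intro sum_ennreal) auto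
        also have "\<dots> \<le> ennreal (lam * 2 ^ n)"
        proof (rule ennreal_leI)
          have "(\<Sum>i<Suc n. (2 :: real) ^ i) \<le> 2 * 2 ^ n" by (induction n) auto
          from mult_left_mono[OF this, of "lam / 2"] lam
          show "(\<Sum>i<Suc n. lam * 2 ^ i / 2) \<le> lam * 2 ^ n" by (simp add: sum_distrib_left mult_ac del: sum.lessThan_Suc)
        qed
        also have "\<dots> \<le> ?M z" using U_M[of z n] True by auto
        finally show ?thesis .
      qed (use Suc in simp)
    qed simp
    have "of_nat n * emeasure mu ((cube x r \<times> {s..<s + r powr p / 2}) \<inter> {z. (2 * K + 1) * (lam * 2 ^ n) < w z})
      = (\<Sum>i<n. emeasure mu ((cube x r \<times> {s..<s + r powr p / 2}) \<inter> {z. (2 * K + 1) * (lam * 2 ^ n) < w z}))" by simp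
    also have "\<dots> \<le> (\<Sum>i<n. ennreal (2 * c0) * (ennreal (lam * 2 ^ i / 2) * emeasure lebesgue (U i \<inter> ?R)))"
    proof (rule sum_mono)
      fix i assume "i \<in> {..<n}"
      let ?H = "{z. (2 * K + 1) * (lam * 2 ^ i) < w z}"
      have "(2 * K + 1) * (lam * 2 ^ i) \<le> (2 * K + 1) * (lam * 2 ^ n)"
        using K lam \<open>i \<in> {..<n}\<close> by (intro mult_left_mono power_increasing) auto
      then have "emeasure mu ((cube x r \<times> {s..<s + r powr p / 2}) \<inter> {z. (2 * K + 1) * (lam * 2 ^ n) < w z})
        \<le> emeasure mu (cube x r \<times> {s..<s + r powr p / 2} \<inter> ?H)"
        by (intro emeasure_mono) (auto intro!: sets.Int sets_Times_borel)
      also have "\<dots> \<le> emeasure mu (?D \<inter> ?H)"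
        by (rule g.mu_le_mu_column[unfolded x_eq]) simp_all
      also have "\<dots> \<le> ennreal (c0 * (lam * 2 ^ i)) * emeasure lebesgue (U i)" by (rule U_mu)
      also have "\<dots> = ennreal (2 * c0) * (ennreal (lam * 2 ^ i / 2) * emeasure lebesgue (U i \<inter> ?R))"
      proof -
        have "c0 * (lam * 2 ^ i) = 2 * c0 * (lam * 2 ^ i / 2)" by simp
        moreover have "ennreal (2 * c0 * (lam * 2 ^ i / 2)) = ennreal (2 * c0) * ennreal (lam * 2 ^ i / 2)"
          using c0 lam by (intro ennreal_mult) auto
        ultimately show ?thesis by (simp only: U_R[symmetric] mult.assoc)
      qed
      finally show "emeasure mu ((cube x r \<times> {s..<s + r powr p / 2}) \<inter> {z. (2 * K + 1) * (lam * 2 ^ n) < w z})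
        \<le> ennreal (2 * c0) * (ennreal (lam * 2 ^ i / 2) * emeasure lebesgue (U i \<inter> ?R))" .
    qed
    also have "\<dots> = ennreal (2 * c0) * (\<integral>\<^sup>+z. (\<Sum>i<n. ennreal (lam * 2 ^ i / 2) * indicator (U i \<inter> ?R) z) \<partial>lebesgue)"
    proof -
      have UR: "U i \<inter> ?R \<in> sets lebesgue" for i using U_sets by (intro sets.Int) auto
      have "(\<integral>\<^sup>+z. (\<Sum>i<n. ennreal (lam * 2 ^ i / 2) * indicator (U i \<inter> ?R) z) \<partial>lebesgue)
          = (\<Sum>i<n. \<integral>\<^sup>+z. ennreal (lam * 2 ^ i / 2) * indicator (U i \<inter> ?R) z \<partial>lebesgue)"
        by (rule nn_integral_sum) (intro borel_measurable_times_ennreal borel_measurable_indicator UR, simp)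
      moreover have "(\<integral>\<^sup>+z. ennreal (lam * 2 ^ i / 2) * indicator (U i \<inter> ?R) z \<partial>lebesgue)
          = ennreal (lam * 2 ^ i / 2) * emeasure lebesgue (U i \<inter> ?R)" for i
        by (rule nn_integral_cmult_indicator[OF UR])
      ultimately show ?thesis by (simp only: sum_distrib_left)
    qed
    also have "\<dots> \<le> ennreal (2 * c0) * (\<integral>\<^sup>+z\<in>?R. ?M z \<partial>lebesgue)"
    proof (intro mult_left_mono nn_integral_mono)
      fix z
      show "(\<Sum>i<n. ennreal (lam * 2 ^ i / 2) * indicator (U i \<inter> ?R) z) \<le> ?M z * indicator ?R z"
        using sum_le[of z n] by (cases "z \<in> ?R") auto
    qed simp
    also have "\<dots> \<le> ennreal (2 * c0) * (ennreal C * emeasure mu (rect_upper p x (s + r powr p) r))"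
      by (intro mult_left_mono max_bound[rule_format, OF r]) auto
    also have "\<dots> = ennreal (2 * c0 * C) * emeasure mu (rect_upper p x (s + r powr p) r)"
      using c0 C by (simp add: ennreal_mult mult.assoc)
    finally show ?thesis .
  qed
  define n1 where "n1 = nat \<lceil>2 * 2 powr p\<rceil>"
  define D0 where "D0 = 2 * c0 * C * K"
  define D where "D = max K (2 ^ CARD('n) * real n1 * D0)"
  define c where "c = (2 * K + 1) * (2 * K * 2 powr N)"
  have D0: "0 \<le> D0" using c0 C K by (simp add: D0_def)
  have N: "0 \<le> N" using p_ge_1 by (simp add: N_def)
  have "1 * 1 \<le> (2 * K + 1) * (2 * K * 2 powr N)"
  proof (intro mult_mono)
    have "1 * 1 \<le> (2 * K) * 2 powr N" using K N by (intro mult_mono) (auto intro: ge_one_powr_ge_zero)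
    then show "1 \<le> 2 * K * 2 powr N" by simp
  qed (use K in auto)
  then have c: "1 \<le> c" by (simp add: c_def)
  have main: "of_nat n * emeasure mu (rect_lower p x t L \<inter> {z. c * m * 2 ^ n < w z}) \<le> ennreal D * emeasure mu (rect_upper p x t L)"
    if L: "0 < L" and m: "0 < m" "emeasure mu (rect_upper p x t L) = ennreal (m * rect_volume CARD('n) p L)" for x t L m n
  proof -
    define r where "r = L / 2"
    define h where "h = r powr p / 2"
    define lam where "lam = 2 * K * 2 powr N * m"
    let ?U = "rect_upper p x t L" and ?H = "{z. c * m * 2 ^ n < w z}"
    let ?b = "\<lambda>i :: nat. t - L powr p + real i * h"
    define J where "J = {i. i < n1 \<and> ?b i < t}"
    let ?P = "\<lambda>q. (cube (fst q) r \<times> {?b (snd q)..<?b (snd q) + h}) \<inter> ?H"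
    have r: "0 < r" using L by (simp add: r_def)
    have h: "0 < h" using r by (simp add: h_def)
    have Lr: "L powr p = 2 powr p * r powr p" by (simp add: r_def flip: powr_mult)
    have "2 powr 1 \<le> 2 powr p" using p_ge_1 by (intro powr_mono) auto
    then have rp: "2 * r powr p \<le> L powr p" unfolding Lr by (intro mult_right_mono) auto
    have lam: "0 < lam" using K m by (simp add: lam_def)
    have c_lam: "c * m * 2 ^ n = (2 * K + 1) * (lam * 2 ^ n)" by (simp add: c_def lam_def)
    have piece: "of_nat n * emeasure mu (?P q) \<le> ennreal D0 * emeasure mu ?U" if q: "q \<in> half_centres x L \<times> J" for q
    proof -
      let ?c = "fst q" and ?s = "?b (snd q)"
      have cube: "cube ?c r \<subseteq> cube x L" unfolding r_def using q L by (intro half_centres_subset) auto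
      have s: "t - L powr p \<le> ?s" "?s < t" using q h by (auto simp: J_def)
      have sub: "rect_lower p ?c (?s + r powr p) r \<subseteq> cube x L \<times> {t - L powr p..<t + L powr p}"
        "rect_upper p ?c (?s + r powr p) r \<subseteq> cube x L \<times> {t - L powr p..<t + L powr p}"
      proof -
        have "0 < r powr p" using r by simp
        then have "{?s + r powr p - r powr p<..<?s + r powr p} \<subseteq> {t - L powr p..<t + L powr p}"
          "{?s + r powr p<..<?s + r powr p + r powr p} \<subseteq> {t - L powr p..<t + L powr p}"
          using s rp by (intro subsetI; simp)+
        then show "rect_lower p ?c (?s + r powr p) r \<subseteq> cube x L \<times> {t - L powr p..<t + L powr p}"
          "rect_upper p ?c (?s + r powr p) r \<subseteq> cube x L \<times> {t - L powr p..<t + L powr p}"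
          unfolding rect_lower_def rect_upper_def using cube by blast+
      qed
      have le: "emeasure mu (rect_lower p ?c (?s + r powr p) r) \<le> ennreal K * emeasure mu ?U"
        "emeasure mu (rect_upper p ?c (?s + r powr p) r) \<le> ennreal K * emeasure mu ?U"
        by (rule order_trans[OF emeasure_mono[OF sub(1)] K(2)[OF L]], simp add: sets_Times_borel,
            rule order_trans[OF emeasure_mono[OF sub(2)] K(2)[OF L]], simp add: sets_Times_borel)
      have v: "0 < rect_volume CARD('n) p L" using L by (rule rect_volume_pos)
      have "emeasure mu (rect_lower p ?c (?s + r powr p) r) + emeasure mu (rect_upper p ?c (?s + r powr p) r)
          \<le> ennreal K * emeasure mu ?U + ennreal K * emeasure mu ?U"
        by (intro add_mono le)
      also have "\<dots> = ennreal (K * (m * rect_volume CARD('n) p L) + K * (m * rect_volume CARD('n) p L))"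
        unfolding m(2) using K m v by (subst ennreal_plus) (simp_all add: ennreal_mult)
      also have "K * (m * rect_volume CARD('n) p L) + K * (m * rect_volume CARD('n) p L) = lam * rect_volume CARD('n) p r"
        using rect_volume_half_power[OF L, of p 1, where 'n = 'n] by (simp add: lam_def N_def r_def)
      finally have root: "emeasure mu (rect_lower p ?c (?s + r powr p) r) + emeasure mu (rect_upper p ?c (?s + r powr p) r)
          \<le> ennreal (lam * rect_volume CARD('n) p r)" .
      have "of_nat n * emeasure mu (?P q) \<le> ennreal (2 * c0 * C) * emeasure mu (rect_upper p ?c (?s + r powr p) r)"
        unfolding c_lam h_def by (rule half[OF r lam root[unfolded h_def]])
      also have "\<dots> \<le> ennreal (2 * c0 * C) * (ennreal K * emeasure mu ?U)"
        by (intro mult_left_mono le) simp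
      also have "\<dots> = ennreal D0 * emeasure mu ?U"
        unfolding D0_def using c0 C K by (simp add: ennreal_mult mult.assoc)
      finally show ?thesis .
    qed
    have P_sets: "?P q \<in> sets lebesgue" for q by (intro sets.Int sets_Times_borel) auto
    have finJ: "finite J" "card J \<le> n1"
    proof -
      have "J \<subseteq> {..<n1}" by (auto simp: J_def)
      then show "finite J" "card J \<le> n1" using finite_subset card_mono[of "{..<n1}" J] by auto
    qed
    have "rect_lower p x t L \<inter> ?H \<subseteq> (\<Union>q\<in>half_centres x L \<times> J. ?P q)"
    proof
      fix z assume z: "z \<in> rect_lower p x t L \<inter> ?H"
      then have zx: "fst z \<in> cube x L" and zt: "t - L powr p < snd z" "snd z < t" by (auto simp: rect_lower_def)
      obtain c' where c': "c' \<in> half_centres x L" "fst z \<in> cube c' r"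
        using half_centres_cover[OF zx] by (auto simp: r_def)
      define y where "y = (snd z - (t - L powr p)) / h"
      define i where "i = nat \<lfloor>y\<rfloor>"
      have y: "0 \<le> y" using zt h by (simp add: y_def)
      have "y < L powr p / h" unfolding y_def using zt h by (intro divide_strict_right_mono) auto
      also have "L powr p / h = 2 * 2 powr p" using r by (simp add: Lr h_def)
      finally have "i < n1" using y unfolding i_def n1_def by linarith
      have "real i \<le> y" "y < real i + 1" using y unfolding i_def by linarith+
      then have "real i * h \<le> y * h" "y * h < (real i + 1) * h" using h by (auto intro: mult_right_mono)
      moreover have "y * h = snd z - (t - L powr p)" using h by (simp add: y_def)
      ultimately have b: "?b i \<le> snd z" "snd z < ?b i + h" by (simp_all add: algebra_simps)
      then have "i \<in> J" using \<open>i < n1\<close> zt by (simp add: J_def)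
      moreover have "z \<in> ?P (c', i)" using z c' b by (simp add: mem_Times_iff)
      ultimately show "z \<in> (\<Union>q\<in>half_centres x L \<times> J. ?P q)" using c'(1) by blast
    qed
    then have "emeasure mu (rect_lower p x t L \<inter> ?H) \<le> emeasure mu (\<Union>q\<in>half_centres x L \<times> J. ?P q)"
      using P_sets finJ by (intro emeasure_mono sets.finite_UN) auto
    also have "\<dots> \<le> (\<Sum>q\<in>half_centres x L \<times> J. emeasure mu (?P q))"
      using P_sets finJ by (intro emeasure_subadditive_finite) auto
    finally have "of_nat n * emeasure mu (rect_lower p x t L \<inter> ?H)
        \<le> of_nat n * (\<Sum>q\<in>half_centres x L \<times> J. emeasure mu (?P q))"
      by (intro mult_left_mono) auto
    also have "\<dots> = (\<Sum>q\<in>half_centres x L \<times> J. of_nat n * emeasure mu (?P q))" by (rule sum_distrib_left)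
    also have "\<dots> \<le> (\<Sum>q\<in>half_centres x L \<times> J. ennreal D0 * emeasure mu ?U)"
      by (intro sum_mono piece)
    also have "\<dots> = ennreal (real (card (half_centres x L \<times> J))) * (ennreal D0 * emeasure mu ?U)"
      by (simp add: ennreal_of_nat_eq_real_of_nat)
    also have "\<dots> \<le> ennreal (2 ^ CARD('n) * real n1) * (ennreal D0 * emeasure mu ?U)"
    proof (intro mult_right_mono ennreal_leI)
      have "card (half_centres x L \<times> J) \<le> 2 ^ CARD('n) * n1"
        unfolding card_cartesian_product by (intro mult_mono card_half_centres finJ) auto
      then have "real (card (half_centres x L \<times> J)) \<le> real (2 ^ CARD('n) * n1)" by (simp only: of_nat_le_iff)
      then show "real (card (half_centres x L \<times> J)) \<le> 2 ^ CARD('n) * real n1" by simp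
    qed simp
    also have "\<dots> = ennreal (2 ^ CARD('n) * real n1 * D0) * emeasure mu ?U"
      using D0 by (simp add: ennreal_mult mult.assoc)
    also have "\<dots> \<le> ennreal D * emeasure mu ?U"
      by (intro mult_right_mono ennreal_leI) (simp_all add: D_def)
    finally show ?thesis .
  qed
  have dbl: "emeasure mu (rect_lower p x t L) \<le> ennreal D * emeasure mu (rect_upper p x t L)" if L: "0 < L" for x t L
    using doubling[OF L, of x t] by (rule order_trans) (intro mult_right_mono ennreal_leI, simp_all add: D_def)
  have "0 \<le> D" using K by (simp add: D_def)
  show thesis by (rule that[OF c \<open>0 \<le> D\<close> main dbl])
qed

lemma superlevel_of_max_plus:
  assumes \<beta>: "0 < \<beta>"
  shows "\<exists>\<alpha>. 0 < \<alpha> \<and> \<alpha> < 1 \<and> (\<forall>x t L. L > 0 \<longrightarrow>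
      (let E = rect_lower p x t L \<inter> {z. ennreal (\<alpha> * w z) > average w (rect_upper p x t L)} in
      mass w E < ennreal \<beta> * mass w (rect_upper p x t L)
        \<or> mass w E = 0 \<and> mass w (rect_upper p x t L) = 0))"
proof -
  obtain c D where c: "1 \<le> c" and D: "0 \<le> D"
    and decay: "\<And>x t L m n. 0 < L \<Longrightarrow> 0 < m \<Longrightarrow> emeasure mu (rect_upper p x t L) = ennreal (m * rect_volume CARD('n) p L) \<Longrightarrow>
      of_nat n * emeasure mu (rect_lower p x t L \<inter> {z. c * m * 2 ^ n < w z}) \<le> ennreal D * emeasure mu (rect_upper p x t L)"
    and doubling: "\<And>x t L. 0 < L \<Longrightarrow> emeasure mu (rect_lower p x t L) \<le> ennreal D * emeasure mu (rect_upper p x t L)"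
    by (rule superlevel_decay) blast
  obtain n where n: "D / \<beta> < real n" using reals_Archimedean2 by blast
  have "0 \<le> D / \<beta>" using D \<beta> by simp
  then have n_pos: "0 < n" using n by (cases n) auto
  define \<alpha> where "\<alpha> = 1 / (c * 2 ^ n)"
  have "1 * 2 ^ 1 \<le> c * 2 ^ n" using c n_pos by (intro mult_mono power_increasing) auto
  then have c2: "2 \<le> c * 2 ^ n" by simp
  then have \<alpha>: "0 < \<alpha>" "\<alpha> < 1" by (simp_all add: \<alpha>_def)
  have "mass w E < ennreal \<beta> * mass w (rect_upper p x t L)
        \<or> mass w E = 0 \<and> mass w (rect_upper p x t L) = 0"
    if L: "L > 0" and E_def: "E = rect_lower p x t L \<inter> {z. ennreal (\<alpha> * w z) > average w (rect_upper p x t L)}" for x t L E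
  proof -
    let ?v = "rect_volume CARD('n) p L" and ?U = "rect_upper p x t L"
    have v: "0 < ?v" using L by (rule rect_volume_pos)
    obtain m where m: "0 \<le> m" "emeasure mu ?U = ennreal (m * ?v)"
      using mu_rect_real[OF L] .
    have E: "E \<in> sets lebesgue" "E \<subseteq> rect_lower p x t L" unfolding E_def by (auto intro: sets.Int)
    have mu_E: "emeasure mu E \<le> ennreal D * emeasure mu ?U"
      using emeasure_mono[OF E(2), of mu] doubling[OF L, of x t] by simp
    show ?thesis
    proof (cases "m = 0")
      case True
      then have "emeasure mu ?U = 0" using m by simp
      then show ?thesis using mu_E E by (simp add: mass_eq)
    next
      case False
      then have m_pos: "0 < m" using m by simp
      have "w z > c * m * 2 ^ n" if "z \<in> E" for z
      proof -
        have "ennreal m < ennreal (\<alpha> * w z)" using that unfolding E_def by (simp add: average_upper_eq[OF L m])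
        then have "m < w z / (c * 2 ^ n)" using m by (simp add: ennreal_less_iff \<alpha>_def)
        then show ?thesis using c2 by (simp add: field_simps)
      qed
      then have "emeasure mu E \<le> emeasure mu (rect_lower p x t L \<inter> {z. c * m * 2 ^ n < w z})"
        using E by (intro emeasure_mono) (auto intro!: sets.Int)
      then have "of_nat n * emeasure mu E \<le> of_nat n * emeasure mu (rect_lower p x t L \<inter> {z. c * m * 2 ^ n < w z})"
        by (intro mult_left_mono) auto
      also have "\<dots> \<le> ennreal D * emeasure mu ?U" by (rule decay[OF L m_pos m(2)])
      also have "\<dots> = ennreal (D * (m * ?v))" unfolding m(2) using D m v by (simp add: ennreal_mult)
      finally have le: "of_nat n * emeasure mu E \<le> ennreal (D * (m * ?v))" .
      have "emeasure mu E < top" using mu_E D m v by (auto simp: m(2) top_unique intro: order_le_less_trans simp flip: ennreal_mult)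
      then obtain e where e: "0 \<le> e" "emeasure mu E = ennreal e" by (cases "emeasure mu E") auto
      have "ennreal (real n * e) \<le> ennreal (D * (m * ?v))"
        using le e by (simp add: ennreal_mult ennreal_of_nat_eq_real_of_nat)
      then have "real n * e \<le> D * (m * ?v)" using D m v by simp
      also have "\<dots> < (real n * \<beta>) * (m * ?v)"
        using n \<beta> m_pos v by (intro mult_strict_right_mono) (auto simp: field_simps)
      finally have "e < \<beta> * (m * ?v)" using n_pos by (simp add: mult.assoc)
      then have "emeasure mu E < ennreal (\<beta> * (m * ?v))" using e by (simp add: ennreal_lessI)
      then have "mass w E < ennreal \<beta> * mass w ?U"
        using \<beta> m v E by (simp add: mass_eq m(2) ennreal_mult)
      then show ?thesis ..
    qed
  qed
  then show ?thesis using \<alpha> unfolding Let_def by blast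
qed

end

end

theorem theorem3p1:
  fixes p :: real and w :: "(real ^ 'n) \<times> real \<Rightarrow> real"
  assumes "1 \<le> p" and "weight w"
  defines "i \<equiv> (\<exists>q>1. RH_plus p q w)"
    and "ii \<equiv> (\<exists>C>0. \<exists>\<delta>>0. \<forall>x t L E. L > 0 \<longrightarrow>
      E \<in> sets lebesgue \<longrightarrow> E \<subseteq> rect_lower p x t L \<longrightarrow>
      mass w E / mass w (rect_upper p x t L)
        \<le> ennreal (C * (measure lebesgue E / measure lebesgue (rect_lower p x t L)) powr \<delta>))"
    and "iii \<equiv> (\<forall>\<beta>>0. \<exists>\<alpha>. 0 < \<alpha> \<and> \<alpha> < 1 \<and> (\<forall>x t L E. L > 0 \<longrightarrow>
      E \<in> sets lebesgue \<longrightarrow> E \<subseteq> rect_lower p x t L \<longrightarrow>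
      emeasure lebesgue E < ennreal \<alpha> * emeasure lebesgue (rect_lower p x t L) \<longrightarrow>
      mass w E < ennreal \<beta> * mass w (rect_upper p x t L)
        \<or> mass w E = 0 \<and> mass w (rect_upper p x t L) = 0))"
    and "iv \<equiv> (\<exists>\<alpha> \<beta>. 0 < \<alpha> \<and> \<alpha> < 1 \<and> 0 < \<beta> \<and> \<beta> < 1 / 2 powr (real CARD('n) + p) \<and>
      (\<forall>x t L E. L > 0 \<longrightarrow>
      E \<in> sets lebesgue \<longrightarrow> E \<subseteq> rect_lower p x t L \<longrightarrow>
      emeasure lebesgue E < ennreal \<alpha> * emeasure lebesgue (rect_lower p x t L) \<longrightarrow>
      mass w E < ennreal \<beta> * mass w (rect_upper p x t L)
        \<or> mass w E = 0 \<and> mass w (rect_upper p x t L) = 0))"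
    and "v \<equiv> (\<exists>\<alpha> \<beta>. 0 < \<alpha> \<and> \<alpha> < 1 \<and> 0 < \<beta> \<and> \<beta> < 1 / 2 powr (real CARD('n) + p) \<and>
      (\<forall>x t L. L > 0 \<longrightarrow>
      (let E = rect_lower p x t L \<inter> {z. ennreal (\<alpha> * w z) > average w (rect_upper p x t L)} in
      mass w E < ennreal \<beta> * mass w (rect_upper p x t L)
        \<or> mass w E = 0 \<and> mass w (rect_upper p x t L) = 0)))"
    and "vi \<equiv> (\<exists>C\<ge>0. \<forall>x t L. L > 0 \<longrightarrow>
      (\<integral>\<^sup>+z\<in>rect_lower p x t L.
          max_plus p (\<lambda>y. w y * indicator (rect_lower p x t L) y) z \<partial>lebesgue)
        \<le> ennreal C * mass w (rect_upper p x t L))"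
    and "vii \<equiv> (\<exists>C\<ge>0. \<forall>x t L. L > 0 \<longrightarrow>
      (\<integral>\<^sup>+z\<in>rect_lower p x t L.
          ennreal (w z) * log_plus (ennreal (w z) / average w (rect_upper p x t L)) \<partial>lebesgue)
        \<le> ennreal C * mass w (rect_upper p x t L))"
  shows "(i \<longleftrightarrow> ii) \<and> (i \<longleftrightarrow> iii) \<and> (i \<longleftrightarrow> iv) \<and> (i \<longleftrightarrow> v) \<and> (i \<longleftrightarrow> vi) \<and> (i \<longleftrightarrow> vii)"
proof -
  interpret parabolic_weight p w
    by unfold_locales (use assms(1,2) in auto)
  have "0 < 1 / 2 powr (real CARD('n) + p)" by simp
  then obtain \<beta>0 where \<beta>0: "0 < \<beta>0" "\<beta>0 < 1 / 2 powr (real CARD('n) + p)"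
    using dense by blast
  have "i \<Longrightarrow> ii"
    unfolding i_def ii_def by (elim exE conjE, rule power_decay_of_RH; assumption)
  moreover have "ii \<Longrightarrow> iii"
    unfolding ii_def iii_def
    by (elim exE conjE, intro allI impI, rule absolute_continuity_of_power_decay; assumption)
  moreover have "iii \<Longrightarrow> iv"
  proof -
    assume iii
    note ex = this[unfolded iii_def, rule_format, OF \<beta>0(1)]
    show iv
      unfolding iv_def by (insert ex \<beta>0, elim exE conjE, intro exI conjI; assumption)
  qed
  moreover have "iv \<Longrightarrow> v"
  proof -
    assume iv
    then obtain \<alpha> \<beta> where a: "0 < \<alpha>" "\<alpha> < 1" "0 < \<beta>" "\<beta> < 1 / 2 powr (real CARD('n) + p)"
      and le: "\<forall>x t L E. L > 0 \<longrightarrow>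
      E \<in> sets lebesgue \<longrightarrow> E \<subseteq> rect_lower p x t L \<longrightarrow>
      emeasure lebesgue E < ennreal \<alpha> * emeasure lebesgue (rect_lower p x t L) \<longrightarrow>
      mass w E < ennreal \<beta> * mass w (rect_upper p x t L)
        \<or> mass w E = 0 \<and> mass w (rect_upper p x t L) = 0"
      unfolding iv_def by (elim exE conjE) (rule that)
    show v
      unfolding v_def
      by (insert superlevel_of_absolute_continuity[OF a(1-3) le] a(3,4), elim exE conjE, intro exI conjI; assumption)
  qed
  moreover have "v \<Longrightarrow> i"
    unfolding v_def i_def by (elim exE conjE, rule RH_plus_of_superlevel; assumption)
  moreover have "i \<Longrightarrow> vii"
    unfolding i_def vii_def by (elim exE conjE, rule LlogL_of_RH; assumption)
  moreover have "vii \<Longrightarrow> vi"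
    unfolding vii_def vi_def by (elim exE conjE, rule max_plus_integral_of_LlogL; assumption)
  moreover have "vi \<Longrightarrow> v"
  proof -
    assume vi
    then obtain C where C: "0 \<le> C" "\<forall>x t L. L > 0 \<longrightarrow>
      (\<integral>\<^sup>+z\<in>rect_lower p x t L.
          max_plus p (\<lambda>y. w y * indicator (rect_lower p x t L) y) z \<partial>lebesgue)
        \<le> ennreal C * emeasure mu (rect_upper p x t L)"
      unfolding vi_def mass_eq[OF sets_rect(1)] by blast
    show v
      unfolding v_def
      by (insert superlevel_of_max_plus[OF C \<beta>0(1)] \<beta>0, elim exE conjE, intro exI conjI; assumption)
  qed
  ultimately show ?thesis by blast
qed

end
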